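(* Let $L$ be an integral lattice of full rank in the $n$-dimensional Euclidean space $E$ and let $B\in\mathbb{R}$ be such that the set $$S:=\{v_1,\ldots,v_s\}=\{v\in L\setminus\{0\} : \|v\|\leqslant B\}$$ generates $L$. Then an orthogonal decomposition $L=L_1\oplus\cdots\oplus L_r$ of $L$ into indecomposable sublattices $L_i$, $1\leqslant i\leqslant r$, can be computed (from $B$ and $S$) in at most $O(n^6\log^2(nB)+sn^2)$ arithmetic operations.
   Context: $E$ carries the scalar product $(\cdot,\cdot)$ and the Euclidean norm $\|x\|=\sqrt{(x,x)}$. A lattice $L$ in $E$ is integral if $(x,y)\in\mathbb{Z}$ for all $x,y\in L$. The symbol $\oplus$ denotes an internal direct sum with mutually orthogonal summands. A nonzero lattice $L$ is called decomposable if there are proper sublattices $L',L''\subsetneq L$ with $L=L'+L''$ and $(L',L'')=0$; otherwise it is indecomposable. The running time is counted in arithmetic operations; $s=|S|$ is the number of vectors in the given generating system. The output consists of a lattice basis for each $L_i$. *)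

theory Defs
  imports "Jordan_Normal_Form.VS_Connect" Complex_Main
begin

section \<open>Lattices in Euclidean space\<close>

text \<open>
  The dimension has to be quantified inside the statement, because one algorithm serves all
  dimensions. So the n-dimensional Euclidean space is \<^term>\<open>carrier_vec n :: real vec set\<close> with its
  standard scalar product, i.e. vectors are given by coordinates in an orthonormal basis.
\<close>

definition vnorm :: "real vec \<Rightarrow> real" where
  "vnorm v = sqrt (v \<bullet> v)"

definition int_span :: "nat \<Rightarrow> real vec set \<Rightarrow> real vec set" where
  "int_span n G =
     {LinearCombinations.module.lincomb (module_vec TYPE(real) n) (\<lambda>v. real_of_int (c v)) A
       | c A. finite A \<and> A \<subseteq> G}"

definition lattice_basis :: "nat \<Rightarrow> real vec list \<Rightarrow> real vec set \<Rightarrow> bool" where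
  "lattice_basis n bs L \<longleftrightarrow>
     set bs \<subseteq> carrier_vec n \<and> distinct bs \<and>
     LinearCombinations.module.lin_indpt class_ring (module_vec TYPE(real) n) (set bs) \<and>
     L = int_span n (set bs)"

definition is_lattice :: "nat \<Rightarrow> real vec set \<Rightarrow> bool" where
  "is_lattice n L \<longleftrightarrow> (\<exists>bs. lattice_basis n bs L)"

definition full_rank_lattice :: "nat \<Rightarrow> real vec set \<Rightarrow> bool" where
  "full_rank_lattice n L \<longleftrightarrow> (\<exists>bs. lattice_basis n bs L \<and> length bs = n)"

definition integral_lattice :: "nat \<Rightarrow> real vec set \<Rightarrow> bool" where
  "integral_lattice n L \<longleftrightarrow> is_lattice n L \<and> (\<forall>x\<in>L. \<forall>y\<in>L. x \<bullet> y \<in> \<int>)"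

definition orthogonal_sets :: "real vec set \<Rightarrow> real vec set \<Rightarrow> bool" where
  "orthogonal_sets X Y \<longleftrightarrow> (\<forall>x\<in>X. \<forall>y\<in>Y. x \<bullet> y = 0)"

definition decomposable :: "nat \<Rightarrow> real vec set \<Rightarrow> bool" where
  "decomposable n L \<longleftrightarrow>
     (\<exists>L' L''. is_lattice n L' \<and> is_lattice n L'' \<and> L' \<subset> L \<and> L'' \<subset> L \<and>
        L = {x + y | x y. x \<in> L' \<and> y \<in> L''} \<and> orthogonal_sets L' L'')"

definition indecomposable :: "nat \<Rightarrow> real vec set \<Rightarrow> bool" where
  "indecomposable n L \<longleftrightarrow> is_lattice n L \<and> L \<noteq> {0\<^sub>v n} \<and> \<not> decomposable n L"

definition orthogonal_direct_sum :: "nat \<Rightarrow> real vec set \<Rightarrow> real vec set list \<Rightarrow> bool" where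
  "orthogonal_direct_sum n L Ls \<longleftrightarrow>
     L = {foldr (+) xs (0\<^sub>v n) | xs. list_all2 (\<in>) xs Ls} \<and>
     (\<forall>v\<in>L. \<exists>!xs. list_all2 (\<in>) xs Ls \<and> v = foldr (+) xs (0\<^sub>v n)) \<and>
     (\<forall>i<length Ls. \<forall>j<length Ls. i \<noteq> j \<longrightarrow> orthogonal_sets (Ls ! i) (Ls ! j))"


section \<open>A random access machine with unit-cost arithmetic operations\<close>

text \<open>
  Programs are finite pieces of syntax working on an unbounded array of real numbers with indirect
  addressing. The only constants are integers, so no program can hide information in a real
  constant. Besides the field operations and comparison there is \<open>Floor\<close>: division with
  remainder and rounding of quotients count as arithmetic operations. Division by zero yields
  zero. A memory address is an expression whose value is rounded down, with negative values
  read as address 0.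
\<close>

datatype rexp =
    Num int
  | Mem rexp
  | Plus rexp rexp
  | Minus rexp rexp
  | Times rexp rexp
  | Divide rexp rexp
  | Floor rexp

datatype rcom =
    Skip
  | Store rexp rexp
  | Seq rcom rcom
  | IfLess rexp rexp rcom rcom
  | WhileLess rexp rexp rcom

type_synonym memory = "nat \<Rightarrow> real"

definition addr :: "real \<Rightarrow> nat" where
  "addr x = nat \<lfloor>x\<rfloor>"

fun reval :: "rexp \<Rightarrow> memory \<Rightarrow> real" where
  "reval (Num k) \<sigma> = of_int k"
| "reval (Mem e) \<sigma> = \<sigma> (addr (reval e \<sigma>))"
| "reval (Plus e f) \<sigma> = reval e \<sigma> + reval f \<sigma>"
| "reval (Minus e f) \<sigma> = reval e \<sigma> - reval f \<sigma>"
| "reval (Times e f) \<sigma> = reval e \<sigma> * reval f \<sigma>"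
| "reval (Divide e f) \<sigma> = reval e \<sigma> / reval f \<sigma>"
| "reval (Floor e) \<sigma> = of_int \<lfloor>reval e \<sigma>\<rfloor>"

text \<open>
  Constants and memory accesses are charged as well, and so are the operations spent on indices
  and control flow: since numbers of any size may be computed with, free index arithmetic would
  be free arithmetic.
\<close>

fun rcost :: "rexp \<Rightarrow> nat" where
  "rcost (Num k) = 1"
| "rcost (Mem e) = rcost e + 1"
| "rcost (Plus e f) = rcost e + rcost f + 1"
| "rcost (Minus e f) = rcost e + rcost f + 1"
| "rcost (Times e f) = rcost e + rcost f + 1"
| "rcost (Divide e f) = rcost e + rcost f + 1"
| "rcost (Floor e) = rcost e + 1"

text \<open>\<open>exec c \<sigma> t \<sigma>'\<close>: started in \<open>\<sigma>\<close>, the program \<open>c\<close> halts in \<open>\<sigma>'\<close> after \<open>t\<close> operations.\<close>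

inductive exec :: "rcom \<Rightarrow> memory \<Rightarrow> nat \<Rightarrow> memory \<Rightarrow> bool" where
  exec_Skip: "exec Skip \<sigma> 1 \<sigma>"
| exec_Store:
    "exec (Store a e) \<sigma> (rcost a + rcost e + 1) (\<sigma>(addr (reval a \<sigma>) := reval e \<sigma>))"
| exec_Seq:
    "exec c \<sigma> t \<sigma>' \<Longrightarrow> exec d \<sigma>' t' \<sigma>'' \<Longrightarrow> exec (Seq c d) \<sigma> (t + t') \<sigma>''"
| exec_IfTrue:
    "reval e \<sigma> < reval f \<sigma> \<Longrightarrow> exec c \<sigma> t \<sigma>' \<Longrightarrow>
       exec (IfLess e f c d) \<sigma> (rcost e + rcost f + 1 + t) \<sigma>'"
| exec_IfFalse:
    "\<not> reval e \<sigma> < reval f \<sigma> \<Longrightarrow> exec d \<sigma> t \<sigma>' \<Longrightarrow>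
       exec (IfLess e f c d) \<sigma> (rcost e + rcost f + 1 + t) \<sigma>'"
| exec_WhileTrue:
    "reval e \<sigma> < reval f \<sigma> \<Longrightarrow> exec c \<sigma> t \<sigma>' \<Longrightarrow> exec (WhileLess e f c) \<sigma>' t' \<sigma>'' \<Longrightarrow>
       exec (WhileLess e f c) \<sigma> (rcost e + rcost f + 1 + t + t') \<sigma>''"
| exec_WhileFalse:
    "\<not> reval e \<sigma> < reval f \<sigma> \<Longrightarrow> exec (WhileLess e f c) \<sigma> (rcost e + rcost f + 1) \<sigma>"

definition load :: "real list \<Rightarrow> memory" where
  "load xs = (\<lambda>i. if i < length xs then xs ! i else 0)"

definition holds :: "memory \<Rightarrow> real list \<Rightarrow> bool" where
  "holds \<sigma> xs \<longleftrightarrow> (\<forall>i<length xs. \<sigma> i = xs ! i)"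

definition encode_input :: "nat \<Rightarrow> real \<Rightarrow> real vec list \<Rightarrow> real list" where
  "encode_input n B vs = real n # real (length vs) # B # concat (map list_of_vec vs)"

text \<open>
  A list of bases is stored as their number, followed by their lengths, followed by the
  coordinates of all basis vectors.
\<close>

definition encode_bases :: "real vec list list \<Rightarrow> real list" where
  "encode_bases Bs =
     real (length Bs) # map (\<lambda>bs. real (length bs)) Bs @ concat (map list_of_vec (concat Bs))"

end

theory Submission
  imports Defs "Jordan_Normal_Form.Determinant"
begin

text \<open>
  Choose vectors \<open>w\<^sub>1, \<dots>, w\<^sub>n\<close> of \<open>S\<close> greedily, each a shortest one outside the span of its
  predecessors. An orthogonal summand of a vector is shorter than the vector and also lies in \<open>S\<close>,
  so \<open>w\<^sub>p\<close> is not a sum of two nonzero orthogonal vectors of \<open>L\<close>; hence \<open>w\<^sub>p\<close> lies in one of the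
  two summands of any orthogonal decomposition of \<open>L\<close>, and such a decomposition only groups the
  coordinates with respect to \<open>w\<close>. Pivoting on the chosen vectors yields these coordinates for all
  of \<open>S\<close> in \<open>O(s n\<^sup>2)\<close> operations.

  In these coordinates a triangular basis of \<open>L\<close> is built by inserting the vectors of \<open>S\<close> with the
  Euclidean algorithm. Rounding to a nearest integer makes each exchange of rows at least double the
  index of \<open>\<int>w\<^sub>1 + \<dots> + \<int>w\<^sub>n\<close> in the lattice generated by the rows; since an integral lattice has
  covolume at least 1, there are only \<open>O(n log (n B))\<close> exchanges altogether.

  After reducing the entries above the diagonal, every basis row lies in one of the two summands of
  any orthogonal decomposition: the part of the row in the other summand has coordinates that are
  too small to be those of a nonzero lattice vector. Therefore the connected components of the graph
  of non-orthogonality on the reduced basis span the indecomposable summands.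
\<close>

section \<open>Structured programs on the machine\<close>

text \<open>An arbitrary basis of \<open>L\<close> will not do: a basis vector may have nonzero
  parts in several summands, and then non-orthogonality joins blocks that should stay separate.
  Irreducible vectors cannot spread over two summands, but deciding irreducibility for all of
  \<open>S\<close> means comparing pairs, at a cost quadratic in s, and n independent irreducible
  vectors in general generate only a sublattice of finite index. Hence the two stages: a few
  irreducible vectors as a frame, then a basis of \<open>L\<close> whose shape relative to the frame
  confines each row to one summand. No irreducibility of the rows themselves is claimed.

  Coordinates with respect to the frame are real numbers, one per cell, so only the number of
  operations is at stake, never the size of the entries. An exchange costs O(n), so all exchanges
  together contribute O(n^2 log(n B)). The O(n^3) work on the finished basis is covered by s n^2,
  because the frame consists of n distinct members of \<open>S\<close>. The total O(s n^2 + n^2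
  log(n B)) is weakened to the stated form in \<open>cost_bound\<close>.\<close>

text \<open>
  The memory is viewed as integer registers and two-dimensional real arrays of unbounded size:
  \<open>aX\<close> holds the coordinates of the input vectors, \<open>aN\<close> their squared norms, \<open>aU\<close> the columns used as
  pivots, \<open>aW\<close> the chosen vectors, \<open>aA\<close> the row being inserted into the triangular matrix \<open>aH\<close>,
  \<open>aG\<close> the resulting lattice basis, \<open>aL\<close> the component labels, \<open>aV\<close> the block lengths, and \<open>aD\<close>, \<open>aM\<close>
  are scratch cells. Registers and arrays are interleaved above the address \<open>base\<close>, which can be
  computed from cells 0 and 1; the cells below (field \<open>lo\<close>) contain first the input, then the output,
  and cells 0 and 1 are overwritten last.
\<close>

datatype reg = rR | rI | rJ | rK | rB | rP | rC | rM | rT | rO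

datatype arr = aX | aN | aU | aA | aW | aH | aG | aL | aV | aD | aM

fun rcode :: "reg \<Rightarrow> nat" where
  "rcode rR = 0" | "rcode rI = 1" | "rcode rJ = 2" | "rcode rK = 3" | "rcode rB = 4"
| "rcode rP = 5" | "rcode rC = 6" | "rcode rM = 7" | "rcode rT = 8" | "rcode rO = 9"

fun acode :: "arr \<Rightarrow> nat" where
  "acode aX = 10" | "acode aN = 11" | "acode aU = 12" | "acode aA = 13" | "acode aW = 14"
| "acode aH = 15" | "acode aG = 16" | "acode aL = 17" | "acode aV = 18" | "acode aD = 19"
| "acode aM = 20"

lemma rcode_less [simp]: "rcode x < 10"
  by (cases x) auto

lemma acode_bounds [simp]: "10 \<le> acode a" "acode a < 64"
  by (cases a; auto)+

lemma rcode_eq [simp]: "rcode x = rcode y \<longleftrightarrow> x = y"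
  by (cases x; cases y) auto

lemma acode_eq [simp]: "acode x = acode y \<longleftrightarrow> x = y"
  by (cases x; cases y) auto

record state =
  dm :: nat
  cn :: nat
  ix :: "reg \<Rightarrow> nat"
  ar :: "arr \<Rightarrow> nat \<Rightarrow> nat \<Rightarrow> real"
  lo :: "nat \<Rightarrow> real"

text \<open>The region below must hold the \<open>3 + s n\<close> input cells, later the at most
  \<open>1 + n + n^2\<close> output cells, and one spare cell at address
  \<open>1 + n + n^2\<close>.\<close>

definition base :: "state \<Rightarrow> nat" where
  "base st = dm st * cn st + dm st * dm st + (dm st + 4)"

text \<open>A pairing function that needs no division by 2: as i is at most i + j, the value lies
  between the squares of i + j and i + j + 1, so it determines i + j and then i. Gaps do no harm in
  an unbounded memory.\<close>

definition cellno :: "nat \<Rightarrow> nat \<Rightarrow> nat" where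
  "cellno i j = (i + j) * (i + j) + i"

lemma cellno_inj: "cellno i j = cellno i' j' \<longleftrightarrow> i = i' \<and> j = j'"
proof
  assume eq: "cellno i j = cellno i' j'"
  have aux: "\<not> cellno a b = cellno a' b'" if "a + b < a' + b'" for a b a' b' :: nat
  proof -
    have "(a + b + 1) * (a + b + 1) \<le> (a' + b') * (a' + b')"
      using that by (intro mult_le_mono) auto
    then show ?thesis by (auto simp: cellno_def)
  qed
  have "i + j = i' + j'" using aux[of i j i' j'] aux[of i' j' i j] eq by linarith
  then show "i = i' \<and> j = j'" using eq by (auto simp: cellno_def)
qed auto

text \<open>Cells 0 and 1 are fixed twice, as \<open>dm\<close> and \<open>cn\<close> and as part of
  \<open>lo\<close>; this is why \<open>run_emit\<close> admits only addresses from 2 on. The stride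
  64 leaves room for all codes: registers use those below 10, arrays those from 10 on.\<close>

definition rep :: "memory \<Rightarrow> state \<Rightarrow> bool" where
  "rep \<sigma> st \<longleftrightarrow> \<sigma> 0 = real (dm st) \<and> \<sigma> 1 = real (cn st) \<and>
     (\<forall>i < base st. \<sigma> i = lo st i) \<and>
     (\<forall>x. \<sigma> (base st + rcode x) = real (ix st x)) \<and>
     (\<forall>a i j. \<sigma> (base st + (64 * cellno i j + acode a)) = ar st a i j)"

section \<open>Source expressions over the abstract state and their translation\<close>

datatype iexp = IDim | ICount | IC nat | IR reg | IAdd iexp iexp | IMul iexp iexp

fun ival :: "iexp \<Rightarrow> state \<Rightarrow> nat" where
  "ival IDim st = dm st"
| "ival ICount st = cn st"
| "ival (IC k) st = k"
| "ival (IR x) st = ix st x"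
| "ival (IAdd e f) st = ival e st + ival f st"
| "ival (IMul e f) st = ival e st * ival f st"

definition base_exp :: rexp where
  "base_exp = Plus (Plus (Times (Mem (Num 0)) (Mem (Num 1))) (Times (Mem (Num 0)) (Mem (Num 0))))
     (Plus (Mem (Num 0)) (Num 4))"

definition reg_exp :: "reg \<Rightarrow> rexp" where
  "reg_exp x = Plus base_exp (Num (int (rcode x)))"

definition cell_exp :: "arr \<Rightarrow> rexp \<Rightarrow> rexp \<Rightarrow> rexp" where
  "cell_exp a e f = Plus base_exp
     (Plus (Times (Num 64) (Plus (Times (Plus e f) (Plus e f)) e)) (Num (int (acode a))))"

fun icomp :: "iexp \<Rightarrow> rexp" where
  "icomp IDim = Mem (Num 0)"
| "icomp ICount = Mem (Num 1)"
| "icomp (IC k) = Num (int k)"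
| "icomp (IR x) = Mem (reg_exp x)"
| "icomp (IAdd e f) = Plus (icomp e) (icomp f)"
| "icomp (IMul e f) = Times (icomp e) (icomp f)"

datatype vexp = VI iexp | VA arr iexp iexp | VAdd vexp vexp | VSub vexp vexp
  | VMul vexp vexp | VDiv vexp vexp | VFloor vexp

fun vval :: "vexp \<Rightarrow> state \<Rightarrow> real" where
  "vval (VI e) st = real (ival e st)"
| "vval (VA a e f) st = ar st a (ival e st) (ival f st)"
| "vval (VAdd e f) st = vval e st + vval f st"
| "vval (VSub e f) st = vval e st - vval f st"
| "vval (VMul e f) st = vval e st * vval f st"
| "vval (VDiv e f) st = vval e st / vval f st"
| "vval (VFloor e) st = of_int \<lfloor>vval e st\<rfloor>"

fun vcomp :: "vexp \<Rightarrow> rexp" where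
  "vcomp (VI e) = icomp e"
| "vcomp (VA a e f) = Mem (cell_exp a (icomp e) (icomp f))"
| "vcomp (VAdd e f) = Plus (vcomp e) (vcomp f)"
| "vcomp (VSub e f) = Minus (vcomp e) (vcomp f)"
| "vcomp (VMul e f) = Times (vcomp e) (vcomp f)"
| "vcomp (VDiv e f) = Divide (vcomp e) (vcomp f)"
| "vcomp (VFloor e) = Floor (vcomp e)"

lemma addr_of_nat [simp]: "addr (real k) = k"
  by (simp add: addr_def)

lemma addr_const [simp]: "addr 0 = 0" "addr 1 = 1"
  by (simp_all add: addr_def)

lemma reval_base:
  assumes "rep \<sigma> st"
  shows "reval base_exp \<sigma> = real (base st)"
  using assms by (simp add: base_exp_def base_def rep_def)

lemma reval_reg:
  assumes "rep \<sigma> st"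
  shows "reval (reg_exp x) \<sigma> = real (base st + rcode x)"
  using reval_base[OF assms] by (simp add: reg_exp_def)

lemma reval_cell:
  assumes "rep \<sigma> st" "reval e \<sigma> = real i" "reval f \<sigma> = real j"
  shows "reval (cell_exp a e f) \<sigma> = real (base st + (64 * cellno i j + acode a))"
  using reval_base[OF assms(1)] assms(2,3) by (simp add: cell_exp_def cellno_def)

lemma reval_icomp:
  assumes "rep \<sigma> st"
  shows "reval (icomp e) \<sigma> = real (ival e st)"
proof (induction e)
  case (IR x)
  have "reval (icomp (IR x)) \<sigma> = \<sigma> (addr (real (base st + rcode x)))"
    by (simp only: icomp.simps reval.simps reval_reg[OF assms])
  then show ?case using assms by (simp only: addr_of_nat) (simp add: rep_def)
qed (use assms in \<open>auto simp: rep_def\<close>)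

lemma reval_vcomp:
  assumes "rep \<sigma> st"
  shows "reval (vcomp e) \<sigma> = vval e st"
proof (induction e)
  case (VA a e f)
  have "reval (vcomp (VA a e f)) \<sigma>
      = \<sigma> (addr (real (base st + (64 * cellno (ival e st) (ival f st) + acode a))))"
    by (simp only: vcomp.simps reval.simps
        reval_cell[OF assms reval_icomp[OF assms] reval_icomp[OF assms]])
  then show ?case using assms by (simp only: addr_of_nat) (simp add: rep_def)
qed (use reval_icomp[OF assms] in auto)

section \<open>Commands of the source language\<close>

definition iset :: "reg \<Rightarrow> iexp \<Rightarrow> rcom" where
  "iset x e = Store (reg_exp x) (icomp e)"

definition vset :: "arr \<Rightarrow> iexp \<Rightarrow> iexp \<Rightarrow> vexp \<Rightarrow> rcom" where
  "vset a e f v = Store (cell_exp a (icomp e) (icomp f)) (vcomp v)"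

text \<open>Apart from the two numbers in cells 0 and 1, source expressions see only registers and
  arrays. The cells below \<open>base\<close> therefore need commands of their own:
  \<open>fetch\<close> reads one, \<open>emit\<close> writes one.\<close>

definition fetch :: "arr \<Rightarrow> iexp \<Rightarrow> iexp \<Rightarrow> iexp \<Rightarrow> rcom" where
  "fetch a e f g = Store (cell_exp a (icomp e) (icomp f)) (Mem (icomp g))"

definition emit :: "iexp \<Rightarrow> vexp \<Rightarrow> rcom" where
  "emit g v = Store (icomp g) (vcomp v)"

definition ifless :: "vexp \<Rightarrow> vexp \<Rightarrow> rcom \<Rightarrow> rcom \<Rightarrow> rcom" where
  "ifless e f c d = IfLess (vcomp e) (vcomp f) c d"

definition whileless :: "vexp \<Rightarrow> vexp \<Rightarrow> rcom \<Rightarrow> rcom" where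
  "whileless e f c = WhileLess (vcomp e) (vcomp f) c"

definition loop :: "reg \<Rightarrow> iexp \<Rightarrow> rcom \<Rightarrow> rcom" where
  "loop x e c = Seq (iset x (IC 0))
     (whileless (VI (IR x)) (VI e) (Seq c (iset x (IAdd (IR x) (IC 1)))))"

notation Seq (infixr \<open>;;\<close> 60)

abbreviation set_ix :: "reg \<Rightarrow> nat \<Rightarrow> state \<Rightarrow> state" where
  "set_ix x k st \<equiv> st\<lparr>ix := (ix st)(x := k)\<rparr>"

abbreviation set_ar :: "arr \<Rightarrow> nat \<Rightarrow> nat \<Rightarrow> real \<Rightarrow> state \<Rightarrow> state" where
  "set_ar a i j v st \<equiv> st\<lparr>ar := (ar st)(a := (ar st a)(i := (ar st a i)(j := v)))\<rparr>"

lemma rep_set_ix: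
  assumes "rep \<sigma> st"
  shows "rep (\<sigma>(base st + rcode x := real k)) (set_ix x k st)"
proof -
  have 1: "64 * cellno i j + acode a \<noteq> rcode x" for i j a
    using rcode_less[of x] acode_bounds(1)[of a] by linarith
  have 2: "base st \<ge> 4" "base (set_ix x k st) = base st" by (simp_all add: base_def)
  show ?thesis unfolding rep_def 2(2)
  proof (intro conjI allI impI)
    fix i assume "i < base st"
    then show "(\<sigma>(base st + rcode x := real k)) i = lo (set_ix x k st) i"
      using assms by (simp add: rep_def)
  next
    fix a i j
    show "(\<sigma>(base st + rcode x := real k)) (base st + (64 * cellno i j + acode a)) = ar (set_ix x k st) a i j"
      using assms 1[of i j a] unfolding rep_def by simp
  next
    fix y
    show "(\<sigma>(base st + rcode x := real k)) (base st + rcode y) = real (ix (set_ix x k st) y)"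
      using assms unfolding rep_def by simp
  qed (use assms 2 in \<open>simp_all add: rep_def\<close>)
qed

lemma rep_set_ar:
  assumes "rep \<sigma> st"
  shows "rep (\<sigma>(base st + (64 * cellno i j + acode a) := v)) (set_ar a i j v st)"
proof -
  let ?\<sigma> = "\<sigma>(base st + (64 * cellno i j + acode a) := v)"
  have 1: "rcode x \<noteq> 64 * cellno i j + acode a" for x
    using rcode_less[of x] acode_bounds(1)[of a] by linarith
  have 2: "base st \<ge> 4" "base (set_ar a i j v st) = base st" by (simp_all add: base_def)
  have 3: "64 * cellno i' j' + acode a' = 64 * cellno i j + acode a \<longleftrightarrow> a' = a \<and> i' = i \<and> j' = j"
    for i' j' a'
  proof
    assume "64 * cellno i' j' + acode a' = 64 * cellno i j + acode a"
    then have "(acode a' + 64 * cellno i' j') mod 64 = (acode a + 64 * cellno i j) mod 64"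
      "(acode a' + 64 * cellno i' j') div 64 = (acode a + 64 * cellno i j) div 64"
      by (simp_all add: add.commute)
    then have "acode a' = acode a" "cellno i' j' = cellno i j"
      by simp_all
    then show "a' = a \<and> i' = i \<and> j' = j" by (simp add: cellno_inj)
  qed simp
  show ?thesis unfolding rep_def 2(2)
  proof (intro conjI allI impI)
    fix k assume "k < base st"
    then show "?\<sigma> k = lo (set_ar a i j v st) k"
      using assms by (simp add: rep_def)
  next
    fix a' i' j'
    have "?\<sigma> (base st + (64 * cellno i' j' + acode a')) =
        (if a' = a \<and> i' = i \<and> j' = j then v else \<sigma> (base st + (64 * cellno i' j' + acode a')))"
      using 3[of i' j' a'] by simp
    then show "?\<sigma> (base st + (64 * cellno i' j' + acode a')) = ar (set_ar a i j v st) a' i' j'"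
      using assms unfolding rep_def by simp
  next
    fix y
    show "?\<sigma> (base st + rcode y) = real (ix (set_ar a i j v st) y)"
      using assms 1[of y] unfolding rep_def by simp
  qed (use assms 2 in \<open>simp_all add: rep_def\<close>)
qed

text \<open>
  The register \<open>rC\<close> counts exchange steps; each of them pays for \<open>\<kappa>\<close> operations, so that the
  number of exchanges only has to be bounded once, for the whole run.
\<close>

definition run :: "nat \<Rightarrow> rcom \<Rightarrow> state \<Rightarrow> nat \<Rightarrow> (state \<Rightarrow> bool) \<Rightarrow> bool" where
  "run \<kappa> c st T Q \<longleftrightarrow> (\<forall>\<sigma>. rep \<sigma> st \<longrightarrow> (\<exists>t \<sigma>' st'. exec c \<sigma> t \<sigma>' \<and> rep \<sigma>' st' \<and>
     t + \<kappa> * ix st rC \<le> T + \<kappa> * ix st' rC \<and> Q st'))"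

lemma runI:
  assumes "\<And>\<sigma>. rep \<sigma> st \<Longrightarrow> \<exists>\<sigma>'. exec c \<sigma> t \<sigma>' \<and> rep \<sigma>' st'"
    and "t + \<kappa> * ix st rC \<le> T + \<kappa> * ix st' rC" "Q st'"
  shows "run \<kappa> c st T Q"
  using assms unfolding run_def by blast

lemma run_weaken:
  assumes "run \<kappa> c st T Q" "T \<le> T'" "\<And>st'. Q st' \<Longrightarrow> Q' st'"
  shows "run \<kappa> c st T' Q'"
  unfolding run_def
proof (intro allI impI)
  fix \<sigma> assume "rep \<sigma> st"
  then obtain t \<sigma>' st' where "exec c \<sigma> t \<sigma>'" "rep \<sigma>' st'" "t + \<kappa> * ix st rC \<le> T + \<kappa> * ix st' rC" "Q st'"
    using assms(1) unfolding run_def by blast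
  then show "\<exists>t \<sigma>' st'. exec c \<sigma> t \<sigma>' \<and> rep \<sigma>' st' \<and> t + \<kappa> * ix st rC \<le> T' + \<kappa> * ix st' rC \<and> Q' st'"
    using assms(2,3) by (intro exI[of _ t] exI[of _ \<sigma>'] exI[of _ st']) auto
qed

lemma run_post:
  assumes "run \<kappa> c st T Q" "\<And>st'. Q st' \<Longrightarrow> Q' st'"
  shows "run \<kappa> c st T Q'"
  using run_weaken[OF assms(1) order_refl assms(2)] .

lemma run_cost:
  assumes "run \<kappa> c st T Q" "T \<le> T'"
  shows "run \<kappa> c st T' Q"
  using run_weaken[OF assms] .

lemma run_Skip:
  assumes "Q st"
  shows "run \<kappa> Skip st 1 Q"
  unfolding run_def using assms exec_Skip by fastforce

lemma run_Seq:
  assumes "run \<kappa> c st T1 (\<lambda>st'. run \<kappa> d st' T2 Q)"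
  shows "run \<kappa> (c ;; d) st (T1 + T2) Q"
  unfolding run_def
proof (intro allI impI)
  fix \<sigma> assume "rep \<sigma> st"
  then obtain t \<sigma>' st' where 1: "exec c \<sigma> t \<sigma>'" "rep \<sigma>' st'"
      "t + \<kappa> * ix st rC \<le> T1 + \<kappa> * ix st' rC" "run \<kappa> d st' T2 Q"
    using assms unfolding run_def[of _ c] by blast
  obtain u \<sigma>'' st'' where 2: "exec d \<sigma>' u \<sigma>''" "rep \<sigma>'' st''"
      "u + \<kappa> * ix st' rC \<le> T2 + \<kappa> * ix st'' rC" "Q st''"
    using 1(2,4) unfolding run_def by blast
  show "\<exists>t \<sigma>' st'. exec (c ;; d) \<sigma> t \<sigma>' \<and> rep \<sigma>' st' \<and>
      t + \<kappa> * ix st rC \<le> T1 + T2 + \<kappa> * ix st' rC \<and> Q st'"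
    using exec_Seq[OF 1(1) 2(1)] 1(3) 2(2-4)
    by (intro exI[of _ "t + u"] exI[of _ \<sigma>''] exI[of _ st'']) auto
qed

section \<open>Costs of expressions and rules for the commands\<close>

definition icost :: "iexp \<Rightarrow> nat" where "icost e = rcost (icomp e)"

definition vcost :: "vexp \<Rightarrow> nat" where "vcost e = rcost (vcomp e)"

lemma icost_simps [simp]:
  "icost IDim = 2" "icost ICount = 2" "icost (IC k) = 1" "icost (IR x) = 19"
  "icost (IAdd e f) = icost e + icost f + 1" "icost (IMul e f) = icost e + icost f + 1"
  by (simp_all add: icost_def reg_exp_def base_exp_def)

definition ccost :: "iexp \<Rightarrow> iexp \<Rightarrow> nat" where
  "ccost e f = 3 * icost e + 2 * icost f + 25"

lemma rcost_cell: "rcost (cell_exp a (icomp e) (icomp f)) = ccost e f"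
  by (simp add: cell_exp_def base_exp_def ccost_def icost_def)

lemma vcost_simps [simp]:
  "vcost (VI e) = icost e" "vcost (VA a e f) = ccost e f + 1"
  "vcost (VAdd u v) = vcost u + vcost v + 1" "vcost (VSub u v) = vcost u + vcost v + 1"
  "vcost (VMul u v) = vcost u + vcost v + 1" "vcost (VDiv u v) = vcost u + vcost v + 1"
  "vcost (VFloor u) = vcost u + 1"
  using rcost_cell by (simp_all add: vcost_def icost_def)

lemma rcost_reg: "rcost (reg_exp x) = 18"
  by (simp add: reg_exp_def base_exp_def)

lemma run_iset:
  assumes "Q (set_ix x (ival e st) st)" "x \<noteq> rC"
  shows "run \<kappa> (iset x e) st (icost e + 19) Q"
proof (rule runI[where st' = "set_ix x (ival e st) st" and t = "icost e + 19"])
  fix \<sigma> assume r: "rep \<sigma> st"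
  have "exec (iset x e) \<sigma> (icost e + 19) (\<sigma>(base st + rcode x := real (ival e st)))"
    using exec_Store[of "reg_exp x" "icomp e" \<sigma>]
    unfolding reval_reg[OF r] reval_icomp[OF r] addr_of_nat rcost_reg
    by (simp add: iset_def icost_def add.commute)
  then show "\<exists>\<sigma>'. exec (iset x e) \<sigma> (icost e + 19) \<sigma>' \<and> rep \<sigma>' (set_ix x (ival e st) st)"
    using rep_set_ix[OF r, of x "ival e st"] by (intro exI conjI)
qed (use assms in simp_all)

text \<open>Natural subtraction makes one rule serve two purposes: for large \<open>\<kappa>\<close>
  the increment pays for itself, and for \<open>\<kappa> = 0\<close> the actual cost 40 appears, as
  \<open>run_while_pay\<close> requires.\<close>

lemma run_count:
  assumes "Q (set_ix rC (ix st rC + 1) st)"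
  shows "run \<kappa> (iset rC (IAdd (IR rC) (IC 1))) st (40 - \<kappa>) Q"
proof (rule runI[where st' = "set_ix rC (ix st rC + 1) st" and t = 40])
  fix \<sigma> assume r: "rep \<sigma> st"
  have "exec (iset rC (IAdd (IR rC) (IC 1))) \<sigma> 40 (\<sigma>(base st + rcode rC := real (ix st rC + 1)))"
    using exec_Store[of "reg_exp rC" "icomp (IAdd (IR rC) (IC 1))" \<sigma>]
    unfolding reval_reg[OF r] reval_icomp[OF r] addr_of_nat rcost_reg icost_def[symmetric]
    by (simp add: iset_def)
  then show "\<exists>\<sigma>'. exec (iset rC (IAdd (IR rC) (IC 1))) \<sigma> 40 \<sigma>' \<and> rep \<sigma>' (set_ix rC (ix st rC + 1) st)"
    using rep_set_ix[OF r, of rC "ix st rC + 1"] by (intro exI conjI)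
qed (use assms in simp_all)

lemma run_vset:
  assumes "Q (set_ar a (ival e st) (ival f st) (vval v st) st)"
  shows "run \<kappa> (vset a e f v) st (ccost e f + vcost v + 1) Q"
proof (rule runI[where st' = "set_ar a (ival e st) (ival f st) (vval v st) st"
      and t = "ccost e f + vcost v + 1"])
  fix \<sigma> assume r: "rep \<sigma> st"
  have "exec (vset a e f v) \<sigma> (ccost e f + vcost v + 1)
     (\<sigma>(base st + (64 * cellno (ival e st) (ival f st) + acode a) := vval v st))"
    using exec_Store[of "cell_exp a (icomp e) (icomp f)" "vcomp v" \<sigma>]
    unfolding reval_cell[OF r reval_icomp[OF r] reval_icomp[OF r]] reval_vcomp[OF r]
      addr_of_nat rcost_cell
    by (simp add: vset_def vcost_def)
  then show "\<exists>\<sigma>'. exec (vset a e f v) \<sigma> (ccost e f + vcost v + 1) \<sigma>' \<and>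
      rep \<sigma>' (set_ar a (ival e st) (ival f st) (vval v st) st)"
    using rep_set_ar[OF r, of "ival e st" "ival f st" a "vval v st"] by (intro exI conjI)
qed (use assms in simp_all)

lemma run_fetch:
  assumes "Q (set_ar a (ival e st) (ival f st) (lo st (ival g st)) st)" "ival g st < base st"
  shows "run \<kappa> (fetch a e f g) st (ccost e f + icost g + 2) Q"
proof (rule runI[where st' = "set_ar a (ival e st) (ival f st) (lo st (ival g st)) st"
      and t = "ccost e f + icost g + 2"])
  fix \<sigma> assume r: "rep \<sigma> st"
  have "reval (Mem (icomp g)) \<sigma> = lo st (ival g st)"
    using r assms(2) by (simp add: reval_icomp[OF r]) (simp add: rep_def)
  then have "exec (fetch a e f g) \<sigma> (ccost e f + icost g + 2)
     (\<sigma>(base st + (64 * cellno (ival e st) (ival f st) + acode a) := lo st (ival g st)))"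
    using exec_Store[of "cell_exp a (icomp e) (icomp f)" "Mem (icomp g)" \<sigma>]
    unfolding reval_cell[OF r reval_icomp[OF r] reval_icomp[OF r]] addr_of_nat rcost_cell
    by (simp add: fetch_def icost_def)
  then show "\<exists>\<sigma>'. exec (fetch a e f g) \<sigma> (ccost e f + icost g + 2) \<sigma>' \<and>
      rep \<sigma>' (set_ar a (ival e st) (ival f st) (lo st (ival g st)) st)"
    using rep_set_ar[OF r, of "ival e st" "ival f st" a "lo st (ival g st)"] by (intro exI conjI)
qed (use assms in simp_all)

lemma run_emit:
  assumes "Q (st\<lparr>lo := (lo st)(ival g st := vval v st)\<rparr>)" "2 \<le> ival g st" "ival g st < base st"
  shows "run \<kappa> (emit g v) st (icost g + vcost v + 1) Q"
proof (rule runI[where st' = "st\<lparr>lo := (lo st)(ival g st := vval v st)\<rparr>"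
      and t = "icost g + vcost v + 1"])
  fix \<sigma> assume r: "rep \<sigma> st"
  have "exec (emit g v) \<sigma> (icost g + vcost v + 1) (\<sigma>(ival g st := vval v st))"
    using exec_Store[of "icomp g" "vcomp v" \<sigma>]
    unfolding reval_icomp[OF r] reval_vcomp[OF r] addr_of_nat
    by (simp add: emit_def vcost_def icost_def)
  moreover have "rep (\<sigma>(ival g st := vval v st)) (st\<lparr>lo := (lo st)(ival g st := vval v st)\<rparr>)"
  proof -
    have "base (st\<lparr>lo := (lo st)(ival g st := vval v st)\<rparr>) = base st" by (simp add: base_def)
    then show ?thesis using r assms(2,3) by (simp add: rep_def)
  qed
  ultimately show "\<exists>\<sigma>'. exec (emit g v) \<sigma> (icost g + vcost v + 1) \<sigma>' \<and>
      rep \<sigma>' (st\<lparr>lo := (lo st)(ival g st := vval v st)\<rparr>)"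
    by (intro exI conjI)
qed (use assms in simp_all)

text \<open>The bound adds the two branches instead of taking the maximum, since constants are
  immaterial. The premise of the branch not taken is vacuous, so that branch may be charged 0, as in
  \<open>run_ifless_true\<close>.\<close>

lemma run_ifless:
  assumes "vval e st < vval f st \<Longrightarrow> run \<kappa> c st T1 Q"
    and "\<not> vval e st < vval f st \<Longrightarrow> run \<kappa> d st T2 Q"
  shows "run \<kappa> (ifless e f c d) st (vcost e + vcost f + 1 + (T1 + T2)) Q"
proof (cases "vval e st < vval f st")
  case True
  show ?thesis unfolding run_def
  proof (intro allI impI)
    fix \<sigma> assume r: "rep \<sigma> st"
    obtain t \<sigma>' st' where 1: "exec c \<sigma> t \<sigma>'" "rep \<sigma>' st'"
      "t + \<kappa> * ix st rC \<le> T1 + \<kappa> * ix st' rC" "Q st'"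
      using assms(1)[OF True] r unfolding run_def by blast
    have "exec (ifless e f c d) \<sigma> (vcost e + vcost f + 1 + t) \<sigma>'"
      using exec_IfTrue[of "vcomp e" \<sigma> "vcomp f" c t \<sigma>' d] 1(1) True r
      by (simp add: ifless_def vcost_def reval_vcomp)
    then show "\<exists>t \<sigma>' st'. exec (ifless e f c d) \<sigma> t \<sigma>' \<and> rep \<sigma>' st' \<and>
       t + \<kappa> * ix st rC \<le> vcost e + vcost f + 1 + (T1 + T2) + \<kappa> * ix st' rC \<and> Q st'"
      using 1(2-4) by (intro exI[of _ "vcost e + vcost f + 1 + t"] exI[of _ \<sigma>'] exI[of _ st']) simp
  qed
next
  case False
  show ?thesis unfolding run_def
  proof (intro allI impI)
    fix \<sigma> assume r: "rep \<sigma> st"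
    obtain t \<sigma>' st' where 1: "exec d \<sigma> t \<sigma>'" "rep \<sigma>' st'"
      "t + \<kappa> * ix st rC \<le> T2 + \<kappa> * ix st' rC" "Q st'"
      using assms(2)[OF False] r unfolding run_def by blast
    have "exec (ifless e f c d) \<sigma> (vcost e + vcost f + 1 + t) \<sigma>'"
      using exec_IfFalse[of "vcomp e" \<sigma> "vcomp f" d t \<sigma>' c] 1(1) False r
      by (simp add: ifless_def vcost_def reval_vcomp)
    then show "\<exists>t \<sigma>' st'. exec (ifless e f c d) \<sigma> t \<sigma>' \<and> rep \<sigma>' st' \<and>
       t + \<kappa> * ix st rC \<le> vcost e + vcost f + 1 + (T1 + T2) + \<kappa> * ix st' rC \<and> Q st'"
      using 1(2-4) by (intro exI[of _ "vcost e + vcost f + 1 + t"] exI[of _ \<sigma>'] exI[of _ st']) simp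
  qed
qed

lemma run_while_stop:
  assumes "\<not> vval e st < vval f st" "Q st"
  shows "run \<kappa> (whileless e f c) st (vcost e + vcost f + 1) Q"
  unfolding run_def
proof (intro allI impI)
  fix \<sigma> assume r: "rep \<sigma> st"
  have "exec (whileless e f c) \<sigma> (vcost e + vcost f + 1) \<sigma>"
    using exec_WhileFalse[of "vcomp e" \<sigma> "vcomp f" c] assms(1) r
    by (simp add: whileless_def vcost_def reval_vcomp)
  then show "\<exists>t \<sigma>' st'. exec (whileless e f c) \<sigma> t \<sigma>' \<and> rep \<sigma>' st' \<and>
      t + \<kappa> * ix st rC \<le> vcost e + vcost f + 1 + \<kappa> * ix st' rC \<and> Q st'"
    using assms(2) r by blast
qed

lemma run_while_step:
  assumes "vval e st < vval f st" "run \<kappa> (c ;; whileless e f c) st T Q"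
  shows "run \<kappa> (whileless e f c) st (vcost e + vcost f + 1 + T) Q"
  unfolding run_def
proof (intro allI impI)
  fix \<sigma> assume r: "rep \<sigma> st"
  obtain t \<sigma>' st' where 1: "exec (c ;; whileless e f c) \<sigma> t \<sigma>'" "rep \<sigma>' st'"
      "t + \<kappa> * ix st rC \<le> T + \<kappa> * ix st' rC" "Q st'"
    using assms(2) r unfolding run_def by blast
  from 1(1) obtain t1 t2 \<sigma>1 where 2: "exec c \<sigma> t1 \<sigma>1" "exec (whileless e f c) \<sigma>1 t2 \<sigma>'" "t = t1 + t2"
    by (cases rule: exec.cases) auto
  have "exec (whileless e f c) \<sigma> (vcost e + vcost f + 1 + t1 + t2) \<sigma>'"
    using exec_WhileTrue[of "vcomp e" \<sigma> "vcomp f" c t1 \<sigma>1 t2 \<sigma>'] assms(1) r 2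
    by (simp add: whileless_def vcost_def reval_vcomp)
  then show "\<exists>t \<sigma>' st'. exec (whileless e f c) \<sigma> t \<sigma>' \<and> rep \<sigma>' st' \<and>
      t + \<kappa> * ix st rC \<le> vcost e + vcost f + 1 + T + \<kappa> * ix st' rC \<and> Q st'"
    using 1 2(3) by (intro exI[of _ "vcost e + vcost f + 1 + t1 + t2"] exI[of _ \<sigma>'] exI[of _ st']) simp
qed

text \<open>The invariant refers to the head of the loop with the counter already set, so the body
  must establish it for the state in which the counter is \<open>Suc k\<close>. Beyond the body a
  round costs \<open>icost e + 20\<close> for the test and 40 for the increment; the trailing
  \<open>icost e + 40\<close> is the initialisation and the last, failing test.\<close>

lemma run_loop:
  assumes init: "I 0 (set_ix x 0 st)"
    and step: "\<And>k st'. k < m \<Longrightarrow> I k st' \<Longrightarrow> ix st' x = k \<Longrightarrow>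
      run \<kappa> c st' T (\<lambda>st''. ix st'' x = k \<and> I (Suc k) (set_ix x (Suc k) st''))"
    and bound: "\<And>k st'. I k st' \<Longrightarrow> ival e st' = m"
    and final: "\<And>st'. I m st' \<Longrightarrow> ix st' x = m \<Longrightarrow> Q st'"
    and x: "x \<noteq> rC"
  shows "run \<kappa> (loop x e c) st (m * (T + icost e + 60) + icost e + 40) Q"
proof -
  let ?W = "whileless (VI (IR x)) (VI e) (c ;; iset x (IAdd (IR x) (IC 1)))"
  have W: "run \<kappa> ?W st' (d * (T + icost e + 60) + icost e + 20) Q"
    if "I k st'" "ix st' x = k" "k + d = m" for d k st'
    using that
  proof (induction d arbitrary: k st')
    case 0
    have "run \<kappa> ?W st' (vcost (VI (IR x)) + vcost (VI e) + 1) Q"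
      by (rule run_while_stop) (use 0 bound[of k st'] final[of st'] in simp_all)
    then show ?case by (rule run_cost) simp
  next
    case (Suc d)
    have "run \<kappa> ?W st' (vcost (VI (IR x)) + vcost (VI e) + 1 +
        ((T + (icost (IAdd (IR x) (IC 1)) + 19)) + (d * (T + icost e + 60) + icost e + 20))) Q"
    proof (rule run_while_step)
      show "vval (VI (IR x)) st' < vval (VI e) st'"
        using Suc.prems bound[of k st'] by simp
      have "run \<kappa> c st' T (\<lambda>st''. run \<kappa> (iset x (IAdd (IR x) (IC 1))) st''
          (icost (IAdd (IR x) (IC 1)) + 19)
          (\<lambda>st'. run \<kappa> ?W st' (d * (T + icost e + 60) + icost e + 20) Q))"
      proof (rule run_post)
        show "run \<kappa> c st' T (\<lambda>st''. ix st'' x = k \<and> I (Suc k) (set_ix x (Suc k) st''))"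
          using step[of k st'] Suc.prems by simp
        fix st'' assume st'': "ix st'' x = k \<and> I (Suc k) (set_ix x (Suc k) st'')"
        show "run \<kappa> (iset x (IAdd (IR x) (IC 1))) st'' (icost (IAdd (IR x) (IC 1)) + 19)
             (\<lambda>st'. run \<kappa> ?W st' (d * (T + icost e + 60) + icost e + 20) Q)"
        proof (rule run_iset[OF _ x], rule Suc.IH)
          show "I (Suc k) (set_ix x (ival (IAdd (IR x) (IC 1)) st'') st'')" using st'' by simp
        qed (use st'' Suc.prems in simp_all)
      qed
      then show "run \<kappa> ((c ;; iset x (IAdd (IR x) (IC 1))) ;; ?W) st'
          ((T + (icost (IAdd (IR x) (IC 1)) + 19)) + (d * (T + icost e + 60) + icost e + 20)) Q"
        by (rule run_Seq[OF run_Seq])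
    qed
    then show ?case by (rule run_cost) simp
  qed
  have "run \<kappa> (loop x e c) st ((icost (IC 0) + 19) + (m * (T + icost e + 60) + icost e + 20)) Q"
    unfolding loop_def
  proof (rule run_Seq, rule run_iset[OF _ x], rule W)
    show "I 0 (set_ix x (ival (IC 0) st) st)" using init by simp
  qed simp_all
  then show ?thesis by (rule run_cost) simp
qed

section \<open>Integer combinations\<close>

text \<open>Indexed by positions rather than by vectors, so that families with repetitions are
  allowed. The coefficients are real because the operation serves both for integer combinations and
  for coordinates with respect to \<open>w\<close>.\<close>

definition comb :: "nat \<Rightarrow> nat set \<Rightarrow> (nat \<Rightarrow> real) \<Rightarrow> (nat \<Rightarrow> real vec) \<Rightarrow> real vec" where
  "comb n I c b = vec n (\<lambda>j. \<Sum>i\<in>I. c i * b i $ j)"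

lemma comb_carrier [simp]: "comb n I c b \<in> carrier_vec n"
  by (simp add: comb_def)

lemma dim_comb [simp]: "dim_vec (comb n I c b) = n"
  by (simp add: comb_def)

lemma comb_index [simp]: "j < n \<Longrightarrow> comb n I c b $ j = (\<Sum>i\<in>I. c i * b i $ j)"
  by (simp add: comb_def)

lemma comb_scalar_prod:
  assumes "v \<in> carrier_vec n"
  shows "comb n I c b \<bullet> v = (\<Sum>i\<in>I. c i * (b i \<bullet> v))"
proof -
  have "comb n I c b \<bullet> v = (\<Sum>j = 0..<n. (\<Sum>i\<in>I. c i * b i $ j) * v $ j)"
    using assms by (simp add: scalar_prod_def)
  also have "\<dots> = (\<Sum>j = 0..<n. \<Sum>i\<in>I. c i * (b i $ j * v $ j))"
    by (simp add: sum_distrib_right mult.assoc)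
  also have "\<dots> = (\<Sum>i\<in>I. \<Sum>j = 0..<n. c i * (b i $ j * v $ j))"
    by (rule sum.swap)
  also have "\<dots> = (\<Sum>i\<in>I. c i * (b i \<bullet> v))"
    using assms by (simp add: scalar_prod_def sum_distrib_left)
  finally show ?thesis .
qed

lemma comb_cong:
  assumes "\<And>i. i \<in> I \<Longrightarrow> c i = d i"
  shows "comb n I c b = comb n I d b"
  using assms by (simp add: comb_def)

text \<open>Subgroups of the ambient space, for use where no lattice basis is at hand: kernels of
  functionals, and the orthogonal complement in \<open>block_indecomposable\<close>.\<close>

definition int_module :: "nat \<Rightarrow> real vec set \<Rightarrow> bool" where
  "int_module n M \<longleftrightarrow> M \<subseteq> carrier_vec n \<and> 0\<^sub>v n \<in> M \<and>
     (\<forall>x\<in>M. \<forall>y\<in>M. \<forall>k::int. x + of_int k \<cdot>\<^sub>v y \<in> M)"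

lemma int_module_carrier: "int_module n M \<Longrightarrow> x \<in> M \<Longrightarrow> x \<in> carrier_vec n"
  by (auto simp: int_module_def)

lemma int_module_zero: "int_module n M \<Longrightarrow> 0\<^sub>v n \<in> M"
  by (simp add: int_module_def)

lemma int_module_add_mult:
  "int_module n M \<Longrightarrow> x \<in> M \<Longrightarrow> y \<in> M \<Longrightarrow> x + of_int k \<cdot>\<^sub>v y \<in> M"
  by (simp add: int_module_def)

lemma int_module_add:
  assumes "int_module n M" "x \<in> M" "y \<in> M"
  shows "x + y \<in> M"
  using int_module_add_mult[OF assms, of 1] by simp

lemma int_module_diff:
  assumes "int_module n M" "x \<in> M" "y \<in> M"
  shows "x - y \<in> M"
proof -
  have "x - y = x + of_int (- 1) \<cdot>\<^sub>v y"
    using int_module_carrier[OF assms(1) assms(2)] int_module_carrier[OF assms(1) assms(3)] by auto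
  then show ?thesis using int_module_add_mult[OF assms, of "- 1"] by simp
qed

lemma lincomb_eq_iff:
  fixes c :: "real vec \<Rightarrow> real"
  assumes "finite A" "A \<subseteq> carrier_vec n"
  shows "x = LinearCombinations.module.lincomb (module_vec TYPE(real) n) c A \<longleftrightarrow>
    x \<in> carrier_vec n \<and> (\<forall>j<n. x $ j = (\<Sum>v\<in>A. c v * v $ j))"
proof -
  define y where "y = LinearCombinations.module.lincomb (module_vec TYPE(real) n) c A"
  have y: "dim_vec y = n"
    unfolding y_def by (rule vec_space.lincomb_dim[OF assms])
  have idx: "y $ j = (\<Sum>v\<in>A. c v * v $ j)" if "j < n" for j
    unfolding y_def by (rule vec_space.lincomb_index[OF that assms(2)])
  have "x = y \<longleftrightarrow> x \<in> carrier_vec n \<and> (\<forall>j<n. x $ j = (\<Sum>v\<in>A. c v * v $ j))"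
  proof (rule iffI)
    assume "x = y"
    then show "x \<in> carrier_vec n \<and> (\<forall>j<n. x $ j = (\<Sum>v\<in>A. c v * v $ j))"
      using carrier_vecI[OF y] idx by blast
  next
    assume x: "x \<in> carrier_vec n \<and> (\<forall>j<n. x $ j = (\<Sum>v\<in>A. c v * v $ j))"
    show "x = y"
    proof (rule eq_vecI)
      fix j assume "j < dim_vec y"
      then have "j < n" by (simp only: y)
      then show "x $ j = y $ j" using x idx[of j] by metis
    qed (use x y carrier_vecD in metis)
  qed
  then show ?thesis by (simp only: y_def)
qed

lemma int_span_iff:
  assumes "G \<subseteq> carrier_vec n"
  shows "x \<in> int_span n G \<longleftrightarrow> x \<in> carrier_vec n \<and>
    (\<exists>(c :: real vec \<Rightarrow> int) A. finite A \<and> A \<subseteq> G \<and> (\<forall>j<n. x $ j = (\<Sum>v\<in>A. of_int (c v) * v $ j)))"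
proof -
  have "x \<in> int_span n G \<longleftrightarrow> (\<exists>(c :: real vec \<Rightarrow> int) A. finite A \<and> A \<subseteq> G \<and>
      x = LinearCombinations.module.lincomb (module_vec TYPE(real) n) (\<lambda>v. real_of_int (c v)) A)"
    unfolding int_span_def by (simp only: mem_Collect_eq) metis
  also have "\<dots> \<longleftrightarrow> (\<exists>(c :: real vec \<Rightarrow> int) A. finite A \<and> A \<subseteq> G \<and>
      x \<in> carrier_vec n \<and> (\<forall>j<n. x $ j = (\<Sum>v\<in>A. of_int (c v) * v $ j)))"
    by (intro iff_exI conj_cong refl lincomb_eq_iff subset_trans[OF _ assms])
  finally show ?thesis by blast
qed

lemma int_span_least:
  assumes "int_module n M" "G \<subseteq> M"
  shows "int_span n G \<subseteq> M"
proof
  fix x assume "x \<in> int_span n G"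
  moreover have G: "G \<subseteq> carrier_vec n" using assms int_module_carrier by blast
  ultimately obtain c :: "real vec \<Rightarrow> int" and A where
    x: "x \<in> carrier_vec n" "finite A" "A \<subseteq> G" "\<forall>j<n. x $ j = (\<Sum>v\<in>A. of_int (c v) * v $ j)"
    unfolding int_span_iff[OF G] by blast
  have "vec n (\<lambda>j. \<Sum>v\<in>A. of_int (c v) * v $ j) \<in> M" using x(2,3)
  proof (induction A)
    case empty
    have "vec n (\<lambda>j. \<Sum>v\<in>{}. of_int (c v) * v $ j) = 0\<^sub>v n" by auto
    then show ?case using int_module_zero[OF assms(1)] by simp
  next
    case (insert v A)
    have "vec n (\<lambda>j. \<Sum>v\<in>insert v A. of_int (c v) * v $ j)
        = vec n (\<lambda>j. \<Sum>v\<in>A. of_int (c v) * v $ j) + of_int (c v) \<cdot>\<^sub>v v"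
      using insert G by (intro eq_vecI) auto
    then show ?case using insert assms(2) int_module_add_mult[OF assms(1)] by auto
  qed
  moreover have "x = vec n (\<lambda>j. \<Sum>v\<in>A. of_int (c v) * v $ j)" using x by auto
  ultimately show "x \<in> M" by simp
qed

lemma int_module_combs:
  "int_module n (range (\<lambda>c :: nat \<Rightarrow> int. comb n I (\<lambda>i. of_int (c i)) b))" (is "int_module n ?R")
  unfolding int_module_def
proof (intro conjI ballI allI)
  have "0\<^sub>v n = comb n I (\<lambda>i. of_int 0) b" by (auto simp: comb_def)
  then show "0\<^sub>v n \<in> ?R" by (rule range_eqI[where x = "\<lambda>_. 0"])
  fix x y k assume "x \<in> ?R" "y \<in> ?R"
  then obtain c d :: "nat \<Rightarrow> int"
    where "x = comb n I (\<lambda>i. of_int (c i)) b" "y = comb n I (\<lambda>i. of_int (d i)) b" by blast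
  then have "x + of_int k \<cdot>\<^sub>v y = comb n I (\<lambda>i. of_int (c i + k * d i)) b"
    by (auto simp: algebra_simps sum.distrib sum_distrib_left)
  then show "x + of_int k \<cdot>\<^sub>v y \<in> ?R"
    by (rule range_eqI[where x = "\<lambda>i. c i + k * d i"])
qed auto

lemma int_span_family:
  assumes "finite I" "b ` I \<subseteq> carrier_vec n"
  shows "int_span n (b ` I) = range (\<lambda>c :: nat \<Rightarrow> int. comb n I (\<lambda>i. of_int (c i)) b)" (is "_ = ?R")
proof (rule equalityI)
  have "b i \<in> ?R" if "i \<in> I" for i
  proof -
    define e :: "nat \<Rightarrow> int" where "e = (\<lambda>k. if k = i then 1 else 0)"
    have "(\<Sum>k\<in>I. of_int (e k) * b k $ j) = b i $ j" for j
    proof -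
      have "(\<Sum>k\<in>I. of_int (e k) * b k $ j) = (\<Sum>k\<in>I. if k = i then b k $ j else 0)"
        by (rule sum.cong) (auto simp: e_def)
      then show ?thesis using that assms(1) by simp
    qed
    then have "b i = comb n I (\<lambda>k. of_int (e k)) b"
      using assms(2) that by (intro eq_vecI) auto
    then show ?thesis by (rule range_eqI[where x = e])
  qed
  then show "int_span n (b ` I) \<subseteq> ?R" by (intro int_span_least int_module_combs image_subsetI)
  show "?R \<subseteq> int_span n (b ` I)"
  proof (rule subsetI)
    fix x assume "x \<in> ?R"
    then obtain c :: "nat \<Rightarrow> int" where x: "x = comb n I (\<lambda>i. of_int (c i)) b" by blast
    \<comment> \<open>A vector that occurs several times in the family receives the sum of its
      coefficients.\<close>
    let ?c = "\<lambda>v. \<Sum>i\<in>{i\<in>I. b i = v}. c i"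
    have *: "x $ j = (\<Sum>v\<in>b ` I. of_int (?c v) * v $ j)" if "j < n" for j
    proof -
      have "(\<Sum>v\<in>b ` I. of_int (?c v) * v $ j) = (\<Sum>v\<in>b ` I. \<Sum>i\<in>{i\<in>I. b i = v}. of_int (c i) * b i $ j)"
        by (intro sum.cong) (auto simp: sum_distrib_right)
      also have "\<dots> = (\<Sum>i\<in>I. of_int (c i) * b i $ j)"
        using sum.image_gen[OF assms(1), of "\<lambda>i. of_int (c i) * b i $ j" b] by simp
      finally show ?thesis using x that by simp
    qed
    show "x \<in> int_span n (b ` I)"
      unfolding int_span_iff[OF assms(2)]
    proof (intro conjI exI[of _ ?c] exI[of _ "b ` I"] allI impI)
      fix j assume "j < n"
      then show "x $ j = (\<Sum>v\<in>b ` I. of_int (?c v) * v $ j)" by (rule *)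
    qed (use x assms(1) in simp_all)
  qed
qed

lemma int_module_int_span:
  assumes "finite G" "G \<subseteq> carrier_vec n"
  shows "int_module n (int_span n G)"
proof -
  obtain xs where xs: "set xs = G" using finite_list[OF assms(1)] by blast
  have G: "G = (!) xs ` {..<length xs}"
    unfolding xs[symmetric] set_conv_nth by auto
  have "(!) xs ` {..<length xs} \<subseteq> carrier_vec n" using assms(2) unfolding G .
  then show ?thesis
    unfolding G by (subst int_span_family[OF finite_lessThan]) (simp_all add: int_module_combs)
qed

lemma int_span_superset:
  assumes "finite G" "G \<subseteq> carrier_vec n"
  shows "G \<subseteq> int_span n G"
proof
  fix v assume v: "v \<in> G"
  show "v \<in> int_span n G"
    unfolding int_span_iff[OF assms(2)]
    by (intro conjI exI[of _ "\<lambda>_. 1"] exI[of _ "{v}"]) (use v assms in auto)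
qed

lemma int_module_lattice:
  assumes "is_lattice n L"
  shows "int_module n L"
proof -
  obtain bs where "set bs \<subseteq> carrier_vec n" "L = int_span n (set bs)"
    using assms unfolding is_lattice_def lattice_basis_def by blast
  then show ?thesis using int_module_int_span by simp
qed


section \<open>Dual bases\<close>

lemma scalar_prod_self:
  fixes z :: "real vec"
  assumes "z \<in> carrier_vec n"
  shows "z \<bullet> z = (\<Sum>j<n. (z $ j)\<^sup>2)"
  using assms by (simp add: scalar_prod_def atLeast0LessThan power2_eq_square carrier_vecD)

lemma scalar_prod_self_zero:
  fixes z :: "real vec"
  assumes "z \<in> carrier_vec n" "z \<bullet> z = 0"
  shows "z = 0\<^sub>v n"
proof -
  have "\<forall>j\<in>{..<n}. (z $ j)\<^sup>2 = 0"
    using assms(2) unfolding scalar_prod_self[OF assms(1)]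
    by (subst (asm) sum_nonneg_eq_0_iff) auto
  then show ?thesis using assms(1) by (intro eq_vecI) auto
qed

text \<open>Duality is the matrix identity W A = 1. For square matrices A W = 1 follows, and this is
  the expansion read off in coordinates.\<close>

lemma dual_expansion:
  assumes w: "\<And>p. p < n \<Longrightarrow> w p \<in> carrier_vec n" and a: "\<And>p. p < n \<Longrightarrow> a p \<in> carrier_vec n"
    and dual: "\<And>p q. p < n \<Longrightarrow> q < n \<Longrightarrow> w p \<bullet> a q = (if p = q then 1 else (0::real))"
    and x: "x \<in> carrier_vec n"
  shows "x = comb n {..<n} (\<lambda>p. x \<bullet> a p) w"
proof (rule eq_vecI)
  define W where "W = mat n n (\<lambda>(p,j). w p $ j)"
  define A where "A = mat n n (\<lambda>(j,q). a q $ j)"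
  have WA: "W * A = 1\<^sub>m n"
  proof (rule eq_matI)
    fix i j assume ij: "i < dim_row (1\<^sub>m n)" "j < dim_col (1\<^sub>m n)"
    then have "row W i = w i" "col A j = a j"
      using w[of i] a[of j] by (auto simp: W_def A_def intro!: eq_vecI)
    then show "(W * A) $$ (i, j) = 1\<^sub>m n $$ (i, j)" using ij dual by (auto simp: W_def A_def)
  qed (auto simp: W_def A_def)
  have AW: "A * W = 1\<^sub>m n"
    by (rule mat_mult_left_right_inverse[OF _ _ WA]) (auto simp: W_def A_def)
  fix j assume "j < dim_vec (comb n {..<n} (\<lambda>p. x \<bullet> a p) w)"
  then have j: "j < n" by simp
  have AW_kj: "(\<Sum>p<n. a p $ k * w p $ j) = (if k = j then 1 else 0)" if "k < n" for k
  proof -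
    have "(A * W) $$ (k, j) = (\<Sum>p<n. a p $ k * w p $ j)"
      using that j by (simp add: A_def W_def scalar_prod_def atLeast0LessThan)
    then show ?thesis using that j by (simp add: AW)
  qed
  have "comb n {..<n} (\<lambda>p. x \<bullet> a p) w $ j = (\<Sum>p<n. (\<Sum>k<n. x $ k * a p $ k) * w p $ j)"
    using j a by (auto simp: scalar_prod_def atLeast0LessThan carrier_vecD intro!: sum.cong)
  also have "\<dots> = (\<Sum>p<n. \<Sum>k<n. x $ k * (a p $ k * w p $ j))"
    by (simp add: sum_distrib_right mult.assoc)
  also have "\<dots> = (\<Sum>k<n. x $ k * (\<Sum>p<n. a p $ k * w p $ j))"
    by (subst sum.swap) (simp add: sum_distrib_left)
  also have "\<dots> = x $ j"
    using j by (simp add: AW_kj if_distrib cong: if_cong)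
  finally show "x $ j = comb n {..<n} (\<lambda>p. x \<bullet> a p) w $ j" by simp
qed (use x in simp)

text \<open>Pairing a vanishing linear combination with \<open>d i\<close> isolates the coefficient
  of \<open>b i\<close>.\<close>

lemma lin_indpt_dual:
  assumes b: "\<And>i. i \<in> I \<Longrightarrow> b i \<in> carrier_vec n" and d: "\<And>i. i \<in> I \<Longrightarrow> d i \<in> carrier_vec n"
    and dual: "\<And>i j. i \<in> I \<Longrightarrow> j \<in> I \<Longrightarrow> b i \<bullet> d j = (if i = j then 1 else (0::real))"
  shows "LinearCombinations.module.lin_indpt class_ring (module_vec TYPE(real) n) (b ` I)"
proof -
  interpret vec_space "TYPE(real)" n .
  show ?thesis
  proof
    assume "lin_dep (b ` I)"
    then obtain A c v where A: "finite A" "A \<subseteq> b ` I" "lincomb c A = 0\<^sub>v n" "v \<in> A" "c v \<noteq> 0"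
      unfolding lin_dep_def by auto
    have Ac: "A \<subseteq> carrier_vec n" using A(2) b by auto
    obtain i where i: "i \<in> I" "v = b i" using A by auto
    have sc: "u \<bullet> d i = (\<Sum>j<n. u $ j * d i $ j)" for u
      using d[OF i(1)] by (simp add: scalar_prod_def atLeast0LessThan carrier_vecD)
    have "0 = (\<Sum>j<n. lincomb c A $ j * d i $ j)" using A(3) by simp
    also have "\<dots> = (\<Sum>j<n. \<Sum>u\<in>A. c u * (u $ j * d i $ j))"
      using lincomb_index[OF _ Ac] by (simp add: sum_distrib_right mult.assoc)
    also have "\<dots> = (\<Sum>u\<in>A. c u * (u \<bullet> d i))"
      by (subst sum.swap) (simp add: sum_distrib_left sc)
    also have "\<dots> = (\<Sum>u\<in>A. if u = v then c u else 0)"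
    proof (rule sum.cong[OF refl])
      fix u assume "u \<in> A"
      then obtain k where k: "k \<in> I" "u = b k" using A by auto
      show "c u * (u \<bullet> d i) = (if u = v then c u else 0)"
        using dual[OF k(1) i(1)] dual[OF i(1) i(1)] k i by (cases "k = i") auto
    qed
    also have "\<dots> = c v" using A by simp
    finally show False using A(5) by simp
  qed
qed

lemma inj_on_dual:
  assumes dual: "\<And>i j. i \<in> I \<Longrightarrow> j \<in> I \<Longrightarrow> b i \<bullet> d j = (if i = j then 1 else (0::real))"
  shows "inj_on b I"
proof (rule inj_onI)
  fix i j assume "i \<in> I" "j \<in> I" "b i = b j"
  then show "i = j" using dual[of i j] dual[of j j] by (auto split: if_splits)
qed

text \<open>n linearly independent vectors span the real space, so \<open>z\<close> is a real
  combination of vectors orthogonal to it, and \<open>z \<bullet> z = 0\<close>.\<close>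

lemma full_rank_orthogonal_zero:
  assumes "full_rank_lattice n L" "z \<in> carrier_vec n" "\<And>x. x \<in> L \<Longrightarrow> x \<bullet> z = 0"
  shows "z = 0\<^sub>v n"
proof -
  interpret vec_space "TYPE(real)" n .
  obtain bs where bs: "lattice_basis n bs L" "length bs = n"
    using assms(1) by (auto simp: full_rank_lattice_def)
  then have s: "set bs \<subseteq> carrier_vec n" "lin_indpt (set bs)" "card (set bs) = n" "L = int_span n (set bs)"
    by (auto simp: lattice_basis_def distinct_card)
  have "basis (set bs)"
    by (rule dim_li_is_basis) (use s dim_is_n in auto)
  then have "z \<in> span (set bs)" using assms(2) by (simp add: basis_def)
  then obtain c A where A: "finite A" "A \<subseteq> set bs" "z = lincomb c A"
    by (auto simp: span_def)
  have Ac: "A \<subseteq> carrier_vec n" using A s by auto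
  have "z \<bullet> z = (\<Sum>j<n. lincomb c A $ j * z $ j)"
    using assms(2) A(3) by (simp add: scalar_prod_def atLeast0LessThan carrier_vecD)
  also have "\<dots> = (\<Sum>j<n. \<Sum>u\<in>A. c u * (u $ j * z $ j))"
    using lincomb_index[OF _ Ac] by (simp add: sum_distrib_right mult.assoc)
  also have "\<dots> = (\<Sum>u\<in>A. c u * (u \<bullet> z))"
    using assms(2)
    by (subst sum.swap) (simp add: sum_distrib_left scalar_prod_def atLeast0LessThan carrier_vecD)
  also have "\<dots> = 0"
  proof (rule sum.neutral, rule ballI)
    fix u assume "u \<in> A"
    then have "u \<in> L" using A int_span_superset[OF _ s(1)] s by auto
    then show "c u * (u \<bullet> z) = 0" using assms(3) by simp
  qed
  finally show ?thesis using scalar_prod_self_zero[OF assms(2)] by simp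
qed

section \<open>Covolumes\<close>

lemma det_int:
  assumes "M \<in> carrier_mat n n" "\<And>i j. i < n \<Longrightarrow> j < n \<Longrightarrow> M $$ (i, j) \<in> (\<int> :: real set)"
  shows "det M \<in> \<int>"
  unfolding det_def'[OF assms(1)]
proof (intro Ints_sum Ints_mult Ints_prod)
  fix p assume "p \<in> {p. p permutes {0..<n}}"
  then have p: "p permutes {0..<n}" by simp
  show "signof p \<in> (\<int> :: real set)" by (simp add: sign_def)
  fix i assume "i \<in> {0..<n}"
  then show "M $$ (i, p i) \<in> \<int>" using permutes_in_image[OF p, of i] assms(2) by simp
qed

text \<open>Hadamard's inequality would be sharper, but the factor n! adds only n log n to the
  logarithm of the bound, which n log(n B) contains anyway.\<close>

lemma abs_det_le:
  assumes M: "M \<in> carrier_mat n n"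
    and le: "\<And>i j. i < n \<Longrightarrow> j < n \<Longrightarrow> \<bar>M $$ (i, j) :: real\<bar> \<le> B"
  shows "\<bar>det M\<bar> \<le> fact n * B ^ n"
proof -
  have "\<bar>det M\<bar> \<le> (\<Sum>p\<in>{p. p permutes {0..<n}}. \<bar>signof p * (\<Prod>i = 0..<n. M $$ (i, p i))\<bar>)"
    unfolding det_def'[OF M] by (rule sum_abs)
  also have "\<dots> \<le> (\<Sum>p\<in>{p. p permutes {0..<n}}. B ^ n)"
  proof (rule sum_mono)
    fix p assume "p \<in> {p. p permutes {0..<n}}"
    then have p: "p permutes {0..<n}" by simp
    have "\<bar>signof p :: real\<bar> = 1" by (simp add: sign_def)
    then have "\<bar>signof p * (\<Prod>i = 0..<n. M $$ (i, p i))\<bar> = (\<Prod>i = 0..<n. \<bar>M $$ (i, p i)\<bar>)"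
      by (simp add: abs_mult abs_prod)
    also have "\<dots> \<le> (\<Prod>i = 0..<n. B)"
      using permutes_in_image[OF p] le by (intro prod_mono) auto
    finally show "\<bar>signof p * (\<Prod>i = 0..<n. M $$ (i, p i))\<bar> \<le> B ^ n" by simp
  qed
  also have "\<dots> = fact n * B ^ n" by (simp add: card_permutations)
  finally show ?thesis .
qed

lemma abs_index_le_norm:
  assumes "v \<in> carrier_vec n" "j < n"
  shows "\<bar>v $ j\<bar> \<le> vnorm v"
proof -
  have "(v $ j)\<^sup>2 \<le> (\<Sum>j<n. (v $ j)\<^sup>2)"
    using assms(2) by (intro member_le_sum) auto
  then have "sqrt ((v $ j)\<^sup>2) \<le> vnorm v"
    unfolding vnorm_def scalar_prod_self[OF assms(1)] by (rule real_sqrt_le_mono)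
  then show ?thesis by simp
qed

text \<open>The rows form the product H W with H upper triangular.\<close>

lemma triangular_det:
  assumes w: "\<And>p. p < n \<Longrightarrow> w p \<in> carrier_vec n"
    and H: "\<And>i j. i < n \<Longrightarrow> j < i \<Longrightarrow> H i j = (0::real)"
  shows "det (mat n n (\<lambda>(i,j). comb n {..<n} (H i) w $ j))
    = (\<Prod>i<n. H i i) * det (mat n n (\<lambda>(p,j). w p $ j))"
proof -
  let ?W = "mat n n (\<lambda>(p,j). w p $ j)" and ?H = "mat n n (\<lambda>(i,j). H i j)"
  have "mat n n (\<lambda>(i,j). comb n {..<n} (H i) w $ j) = ?H * ?W"
    by (rule eq_matI) (auto simp: scalar_prod_def atLeast0LessThan)
  moreover have "det ?H = (\<Prod>i<n. H i i)"
  proof -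
    have "upper_triangular ?H" using H by (auto simp: upper_triangular_def)
    then have "det ?H = prod_list (diag_mat ?H)" by (rule det_upper_triangular[where n = n]) simp
    then show ?thesis by (simp add: prod_list_diag_prod atLeast0LessThan)
  qed
  ultimately show ?thesis using det_mult[of ?H n ?W] by simp
qed

lemma det_dual_nonzero:
  assumes w: "\<And>p. p < n \<Longrightarrow> w p \<in> carrier_vec n" and a: "\<And>p. p < n \<Longrightarrow> a p \<in> carrier_vec n"
    and dual: "\<And>p q. p < n \<Longrightarrow> q < n \<Longrightarrow> w p \<bullet> a q = (if p = q then 1 else (0::real))"
  shows "det (mat n n (\<lambda>(p,j). w p $ j)) \<noteq> 0"
proof -
  let ?W = "mat n n (\<lambda>(p,j). w p $ j)" and ?A = "mat n n (\<lambda>(j,q). a q $ j)"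
  have "?W * ?A = 1\<^sub>m n"
  proof (rule eq_matI)
    fix i j assume ij: "i < dim_row (1\<^sub>m n :: real mat)" "j < dim_col (1\<^sub>m n :: real mat)"
    then have "row ?W i = w i" "col ?A j = a j"
      using w[of i] a[of j] by (auto intro!: eq_vecI)
    then show "(?W * ?A) $$ (i, j) = 1\<^sub>m n $$ (i, j)" using ij dual by simp
  qed simp_all
  then have "det ?W * det ?A = 1" using det_mult[of ?W n ?A] by simp
  then show ?thesis by auto
qed

text \<open>The covolume of an integral lattice is at least 1, while Leibniz' formula bounds the
  covolume of the vectors \<open>w\<close>.\<close>

lemma triangular_prod_ge:
  assumes w: "\<And>p. p < n \<Longrightarrow> w p \<in> carrier_vec n" and a: "\<And>p. p < n \<Longrightarrow> a p \<in> carrier_vec n"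
    and dual: "\<And>p q. p < n \<Longrightarrow> q < n \<Longrightarrow> w p \<bullet> a q = (if p = q then 1 else (0::real))"
    and H: "\<And>i j. i < n \<Longrightarrow> j < i \<Longrightarrow> H i j = (0::real)"
    and diag: "\<And>i. i < n \<Longrightarrow> H i i \<noteq> 0"
    and int: "\<And>x y. x \<in> L \<Longrightarrow> y \<in> L \<Longrightarrow> x \<bullet> y \<in> \<int>"
    and rows: "\<And>i. i < n \<Longrightarrow> comb n {..<n} (H i) w \<in> L"
    and norm: "\<And>p. p < n \<Longrightarrow> vnorm (w p) \<le> B"
  shows "1 \<le> (\<Prod>i<n. \<bar>H i i\<bar>) * (fact n * B ^ n)"
proof -
  define U where "U = mat n n (\<lambda>(i,j). comb n {..<n} (H i) w $ j)"
  let ?W = "mat n n (\<lambda>(p,j). w p $ j)"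
  have U: "U \<in> carrier_mat n n" by (simp add: U_def)
  have detU: "det U = (\<Prod>i<n. H i i) * det ?W"
    unfolding U_def by (rule triangular_det[OF w H])
  \<comment> \<open>The rows need not have integer coordinates, but their scalar products are
    integers. So the Gram determinant \<open>(det U)\<^sup>2\<close> is an integer, and a nonzero
    one.\<close>
  have "det (U * transpose_mat U) \<in> \<int>"
  proof (rule det_int)
    fix i j assume ij: "i < n" "j < n"
    have "row U i = comb n {..<n} (H i) w" "row U j = comb n {..<n} (H j) w"
      using ij by (auto simp: U_def intro!: eq_vecI)
    then have "(U * transpose_mat U) $$ (i, j) = comb n {..<n} (H i) w \<bullet> comb n {..<n} (H j) w"
      using ij U by simp
    then show "(U * transpose_mat U) $$ (i, j) \<in> \<int>" using int rows ij by simp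
  qed (use U in simp)
  then have "(det U)\<^sup>2 \<in> \<int>"
    using det_mult[OF U, of "transpose_mat U"] U det_transpose[OF U] by (simp add: power2_eq_square)
  moreover have nz: "det U \<noteq> 0"
    unfolding detU using diag det_dual_nonzero[OF w a dual] by simp
  ultimately have "1 \<le> (det U)\<^sup>2"
    by (metis Ints_nonzero_abs_ge1 abs_power2 power_eq_0_iff)
  then have "1 \<le> \<bar>det U\<bar>"
    by (metis abs_le_square_iff abs_one one_power2)
  also have "\<bar>det U\<bar> = (\<Prod>i<n. \<bar>H i i\<bar>) * \<bar>det ?W\<bar>"
    unfolding detU by (simp add: abs_mult abs_prod)
  also have "\<dots> \<le> (\<Prod>i<n. \<bar>H i i\<bar>) * (fact n * B ^ n)"
  proof (intro mult_left_mono abs_det_le prod_nonneg)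
    fix i j assume "i < n" "j < n"
    then show "\<bar>?W $$ (i, j)\<bar> \<le> B"
      using abs_index_le_norm[OF w, of i j] norm[of i] by simp
  qed auto
  finally show ?thesis .
qed

text \<open>The matrix of the rows has nonzero determinant, and the columns of its inverse are the
  dual vectors. They will certify the linear independence of every block of rows.\<close>

lemma triangular_dual:
  assumes w: "\<And>p. p < n \<Longrightarrow> w p \<in> carrier_vec n" and a: "\<And>p. p < n \<Longrightarrow> a p \<in> carrier_vec n"
    and dual: "\<And>p q. p < n \<Longrightarrow> q < n \<Longrightarrow> w p \<bullet> a q = (if p = q then 1 else (0::real))"
    and H: "\<And>i j. i < n \<Longrightarrow> j < i \<Longrightarrow> H i j = (0::real)"
    and diag: "\<And>i. i < n \<Longrightarrow> H i i \<noteq> 0"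
  obtains d where "\<And>i. i < n \<Longrightarrow> d i \<in> carrier_vec n"
    "\<And>i j. i < n \<Longrightarrow> j < n \<Longrightarrow> comb n {..<n} (H i) w \<bullet> d j = (if i = j then 1 else 0)"
proof -
  define U where "U = mat n n (\<lambda>(i,j). comb n {..<n} (H i) w $ j)"
  have U: "U \<in> carrier_mat n n" by (simp add: U_def)
  have "det U = (\<Prod>i<n. H i i) * det (mat n n (\<lambda>(p,j). w p $ j))"
    unfolding U_def by (rule triangular_det[OF w H])
  then have "det U \<noteq> 0" using diag det_dual_nonzero[OF w a dual] by simp
  then obtain V where V: "V \<in> carrier_mat n n" "U * V = 1\<^sub>m n"
    using det_non_zero_imp_unit[OF U, of undefined] by (auto simp: Units_def ring_mat_def)
  show ?thesis
  proof
    fix i j assume ij: "i < n" "j < n"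
    have "row U i = comb n {..<n} (H i) w" using ij by (auto simp: U_def intro!: eq_vecI)
    then have "comb n {..<n} (H i) w \<bullet> col V j = (U * V) $$ (i, j)"
      using index_mult_mat(1)[of i U j V] ij U V(1) by simp
    then show "comb n {..<n} (H i) w \<bullet> col V j = (if i = j then 1 else 0)" using V ij by simp
  qed (use V in auto)
qed


section \<open>Reduced triangular bases respect orthogonal decompositions\<close>

text \<open>Let c be the coefficients of \<open>y\<close> in the rows. Going through the columns
  from left to right, triangularity leaves only c k times \<open>H k k\<close> in column k. This is
  0 or \<open>H i k\<close> with i < k, so c k is 0 or an integer in [-1/2, 1/2), hence 0.\<close>

lemma reduced_row_zero:
  assumes w: "\<And>p. p < n \<Longrightarrow> w p \<in> carrier_vec n" and a: "\<And>p. p < n \<Longrightarrow> a p \<in> carrier_vec n"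
    and dual: "\<And>p q. p < n \<Longrightarrow> q < n \<Longrightarrow> w p \<bullet> a q = (if p = q then 1 else (0::real))"
    and H: "\<And>i j. i < n \<Longrightarrow> j < i \<Longrightarrow> H i j = (0::real)"
    and diag: "\<And>i. i < n \<Longrightarrow> H i i \<noteq> 0"
    and red: "\<And>i j. i < j \<Longrightarrow> j < n \<Longrightarrow> - 1 / 2 \<le> H i j / H j j \<and> H i j / H j j < 1 / 2"
    and y: "y \<in> int_span n ((\<lambda>i. comb n {..<n} (H i) w) ` {..<n})"
    and coord: "\<And>j. j < n \<Longrightarrow> y \<bullet> a j = 0 \<or> (i < j \<and> y \<bullet> a j = H i j)"
  shows "y = 0\<^sub>v n"
proof -
  let ?b = "\<lambda>i. comb n {..<n} (H i) w"
  obtain c :: "nat \<Rightarrow> int" where yc: "y = comb n {..<n} (\<lambda>i. of_int (c i)) ?b"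
    using y unfolding int_span_family[OF finite_lessThan image_subsetI[OF comb_carrier]] by blast
  have b: "?b k \<bullet> a j = H k j" if "j < n" for k j
  proof -
    have "?b k \<bullet> a j = (\<Sum>p<n. H k p * (w p \<bullet> a j))" by (rule comb_scalar_prod[OF a[OF that]])
    also have "\<dots> = (\<Sum>p<n. if p = j then H k p else 0)" using dual that by (intro sum.cong) auto
    finally show ?thesis using that by simp
  qed
  have "c k = 0" if "k < n" for k
    using that
  proof (induction k rule: less_induct)
    case (less k)
    have "y \<bullet> a k = (\<Sum>m<n. of_int (c m) * (?b m \<bullet> a k))"
      unfolding yc by (rule comb_scalar_prod[OF a[OF less.prems]])
    also have "\<dots> = (\<Sum>m<n. of_int (c m) * H m k)"
      by (simp only: b[OF less.prems])
    also have "\<dots> = (\<Sum>m<n. if m = k then of_int (c m) * H m k else 0)"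
    proof (rule sum.cong[OF refl])
      fix m assume m: "m \<in> {..<n}"
      show "of_int (c m) * H m k = (if m = k then of_int (c m) * H m k else 0)"
        using less.IH[of m] H[of m k] m by (cases m k rule: linorder_cases) auto
    qed
    also have "\<dots> = of_int (c k) * H k k" using less.prems by simp
    finally have yk: "y \<bullet> a k = of_int (c k) * H k k" .
    show ?case
    proof (cases "y \<bullet> a k = 0")
      case True
      then show ?thesis using yk diag[OF less.prems] by simp
    next
      case False
      then have "i < k" "H i k / H k k = of_int (c k)"
        using coord[OF less.prems] yk diag[OF less.prems] by (auto simp: nonzero_divide_eq_eq)
      then have "- 1 / 2 \<le> real_of_int (c k)" "real_of_int (c k) < 1 / 2"
        using red[OF _ less.prems, of i] by auto
      then show ?thesis by linarith
    qed
  qed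
  then show ?thesis unfolding yc by (auto intro!: eq_vecI)
qed

text \<open>Grouping the coordinates of the row by the side on which the \<open>w p\<close> lie
  writes it as y + z, with y orthogonal to \<open>C\<close> and z orthogonal to \<open>A\<close>.
  This agrees with the splitting x + x' inside the lattice, so y and z are lattice vectors. The one
  that lacks the diagonal coordinate i has only reduced entries and vanishes by
  \<open>reduced_row_zero\<close>.\<close>

lemma reduced_row_split:
  assumes w: "\<And>p. p < n \<Longrightarrow> w p \<in> carrier_vec n" and a: "\<And>p. p < n \<Longrightarrow> a p \<in> carrier_vec n"
    and dual: "\<And>p q. p < n \<Longrightarrow> q < n \<Longrightarrow> w p \<bullet> a q = (if p = q then 1 else (0::real))"
    and H: "\<And>i j. i < n \<Longrightarrow> j < i \<Longrightarrow> H i j = (0::real)"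
    and diag: "\<And>i. i < n \<Longrightarrow> H i i \<noteq> 0"
    and red: "\<And>i j. i < j \<Longrightarrow> j < n \<Longrightarrow> - 1 / 2 \<le> H i j / H j j \<and> H i j / H j j < 1 / 2"
    and L: "L = int_span n ((\<lambda>i. comb n {..<n} (H i) w) ` {..<n})"
    and AC: "A \<subseteq> L" "C \<subseteq> L"
    and orth: "\<And>x y. x \<in> A \<Longrightarrow> y \<in> C \<Longrightarrow> x \<bullet> y = 0"
    and split: "\<And>z. z \<in> L \<Longrightarrow> \<exists>x\<in>A. \<exists>y\<in>C. z = x + y"
    and wAC: "\<And>p. p < n \<Longrightarrow> w p \<in> A \<or> w p \<in> C"
    and i: "i < n"
  shows "comb n {..<n} (H i) w \<in> A \<or> comb n {..<n} (H i) w \<in> C"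
proof -
  let ?b = "comb n {..<n} (H i) w"
  define P where "P = {p. p < n \<and> w p \<in> A}"
  define Q where "Q = {p. p < n \<and> w p \<notin> A}"
  define y z where "y = comb n P (H i) w" and "z = comb n Q (H i) w"
  have PQ: "P \<union> Q = {..<n}" "P \<inter> Q = {}" "finite P" "finite Q" by (auto simp: P_def Q_def)
  have Lc: "L \<subseteq> carrier_vec n"
    unfolding L by (rule int_module_carrier[THEN subsetI, OF int_module_int_span]) auto
  have bL: "?b \<in> L" unfolding L using i by (intro int_span_superset[THEN subsetD]) auto
  have byz: "?b = y + z"
    unfolding y_def z_def
  proof (rule eq_vecI)
    fix j assume "j < dim_vec (comb n P (H i) w + comb n Q (H i) w)"
    then show "?b $ j = (comb n P (H i) w + comb n Q (H i) w) $ j"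
      using sum.union_disjoint[OF PQ(3,4,2), of "\<lambda>p. H i p * w p $ j"] by (simp add: PQ(1))
  qed simp
  have yc: "y \<in> carrier_vec n" and zc: "z \<in> carrier_vec n" by (simp_all add: y_def z_def)
  obtain x x' where x: "x \<in> A" "x' \<in> C" "?b = x + x'" using split[OF bL] by blast
  have xc: "x \<in> carrier_vec n" "x' \<in> carrier_vec n" using x AC Lc by auto
  have y_orth: "y \<bullet> u = 0" if "u \<in> C" for u
    unfolding y_def using that AC Lc orth
    by (subst comb_scalar_prod) (auto simp: P_def intro!: sum.neutral)
  have z_orth: "u \<bullet> z = 0" if "u \<in> A" for u
  proof -
    have u: "u \<in> carrier_vec n" using that AC Lc by auto
    have "z \<bullet> u = (\<Sum>p\<in>Q. H i p * (w p \<bullet> u))" unfolding z_def by (rule comb_scalar_prod[OF u])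
    also have "\<dots> = 0"
    proof (intro sum.neutral ballI)
      fix p assume "p \<in> Q"
      then have "p < n" "w p \<in> C" using wAC by (auto simp: Q_def)
      then show "H i p * (w p \<bullet> u) = 0"
        using orth[OF that] comm_scalar_prod[OF w[of p] u] by simp
    qed
    finally show ?thesis using comm_scalar_prod[OF zc u] by simp
  qed
  have zy: "y \<bullet> z = 0"
    unfolding y_def using z_orth zc by (subst comb_scalar_prod) (auto simp: P_def intro!: sum.neutral)
  have d: "x - y = z - x'"
  proof (rule eq_vecI)
    fix j assume "j < dim_vec (z - x')"
    then have "j < n" using xc zc by simp
    then show "(x - y) $ j = (z - x') $ j"
      using arg_cong[OF x(3), of "\<lambda>v. v $ j"] arg_cong[OF byz, of "\<lambda>v. v $ j"] xc yc zc by simp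
  qed (use xc yc zc in simp)
  \<comment> \<open>One and the same vector is x - y and z - x'. All four scalar products between
    the two forms vanish, so the vector is orthogonal to itself.\<close>
  have "(x - y) \<bullet> (x - y) = (x - y) \<bullet> (z - x')" using d by simp
  also have "\<dots> = (x \<bullet> z - x \<bullet> x') - (y \<bullet> z - y \<bullet> x')"
    using xc yc zc by (simp add: minus_scalar_prod_distrib[of _ n] scalar_prod_minus_distrib[of _ n])
  also have "\<dots> = 0" using z_orth[OF x(1)] orth[OF x(1,2)] zy y_orth[OF x(2)] by simp
  finally have "x - y = 0\<^sub>v n" using scalar_prod_self_zero[of "x - y" n] xc yc by auto
  then have xy: "x = y" "x' = z"
  proof -
    assume 0: "x - y = 0\<^sub>v n"
    have "x $ j = y $ j" "x' $ j = z $ j" if "j < n" for j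
      using arg_cong[OF 0, of "\<lambda>v. v $ j"] arg_cong[OF 0[unfolded d], of "\<lambda>v. v $ j"] that xc yc zc by auto
    then show "x = y" "x' = z" using xc yc zc by (auto intro!: eq_vecI)
  qed
  have coord: "comb n R (H i) w \<bullet> a j = (if j \<in> R then H i j else 0)" if "j < n" "R \<subseteq> {..<n}" for j R
  proof -
    have "comb n R (H i) w \<bullet> a j = (\<Sum>p\<in>R. H i p * (w p \<bullet> a j))" by (rule comb_scalar_prod[OF a[OF that(1)]])
    also have "\<dots> = (\<Sum>p\<in>R. if p = j then H i p else 0)" using dual that by (intro sum.cong) auto
    finally show ?thesis using that finite_subset[OF that(2)] by simp
  qed
  show ?thesis
  proof (cases "i \<in> P")
    case True
    have "z = 0\<^sub>v n"
    proof (rule reduced_row_zero[OF w a dual H diag red])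
      show "z \<in> int_span n ((\<lambda>i. comb n {..<n} (H i) w) ` {..<n})" using x xy AC L by auto
      fix j assume j: "j < n"
      have "Q \<subseteq> {..<n}" using PQ by auto
      from coord[OF j this] show "z \<bullet> a j = 0 \<or> (i < j \<and> z \<bullet> a j = H i j)"
        unfolding z_def using H[OF i, of j] True PQ(2) by (cases i j rule: linorder_cases) auto
    qed
    then have "?b = y" using byz yc by simp
    then show ?thesis using x xy by simp
  next
    case False
    have "y = 0\<^sub>v n"
    proof (rule reduced_row_zero[OF w a dual H diag red])
      show "y \<in> int_span n ((\<lambda>i. comb n {..<n} (H i) w) ` {..<n})" using x xy AC L by auto
      fix j assume j: "j < n"
      have "P \<subseteq> {..<n}" using PQ by auto
      from coord[OF j this] show "y \<bullet> a j = 0 \<or> (i < j \<and> y \<bullet> a j = H i j)"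
        unfolding y_def using H[OF i, of j] False by (cases i j rule: linorder_cases) auto
    qed
    then have "?b = z" using byz zc by simp
    then show ?thesis using x xy by simp
  qed
qed

section \<open>From the connected components to the decomposition\<close>

lemma foldr_add_carrier:
  assumes "set xs \<subseteq> carrier_vec n"
  shows "foldr (+) xs (0\<^sub>v n) \<in> carrier_vec n"
  using assms by (induction xs) auto

lemma foldr_add_index:
  assumes "set xs \<subseteq> carrier_vec n" "j < n"
  shows "foldr (+) xs (0\<^sub>v n) $ j = (\<Sum>k<length xs. xs ! k $ j)"
proof -
  have "foldr (+) xs (0\<^sub>v n) $ j = (\<Sum>x\<leftarrow>xs. x $ j)"
    using assms
  proof (induction xs)
    case (Cons x xs)
    then have "foldr (+) xs (0\<^sub>v n) \<in> carrier_vec n" by (intro foldr_add_carrier) simp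
    then show ?case using Cons by simp
  qed simp
  then show ?thesis by (simp add: sum_list_sum_nth atLeast0LessThan)
qed

lemma foldr_add_scalar_prod:
  assumes "set xs \<subseteq> carrier_vec n" "v \<in> carrier_vec n"
  shows "foldr (+) xs (0\<^sub>v n) \<bullet> v = (\<Sum>k<length xs. (xs ! k \<bullet> v :: real))"
proof -
  have "foldr (+) xs (0\<^sub>v n) \<bullet> v = (\<Sum>x\<leftarrow>xs. x \<bullet> v)"
    using assms(1)
  proof (induction xs)
    case Nil
    then show ?case using assms(2) by simp
  next
    case (Cons x xs)
    then have "foldr (+) xs (0\<^sub>v n) \<in> carrier_vec n" by (intro foldr_add_carrier) simp
    then show ?case using Cons assms(2) by (simp add: add_scalar_prod_distrib[of _ n])
  qed
  then show ?thesis by (simp add: sum_list_sum_nth atLeast0LessThan)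
qed

lemma int_module_foldr_add:
  assumes "int_module n M" "set xs \<subseteq> M"
  shows "foldr (+) xs (0\<^sub>v n) \<in> M"
  using assms(2)
proof (induction xs)
  case Nil
  then show ?case using int_module_zero[OF assms(1)] by simp
next
  case (Cons x xs)
  then show ?case using int_module_add[OF assms(1)] by simp
qed

text \<open>Pairing both sums with the difference d of their k-th entries removes every summand but
  the k-th, so \<open>d \<bullet> d = 0\<close>.\<close>

lemma orthogonal_summands_unique:
  assumes Ls: "\<And>k. k < length Ls \<Longrightarrow> int_module n (Ls ! k)"
    and orth: "\<And>i j. i < length Ls \<Longrightarrow> j < length Ls \<Longrightarrow> i \<noteq> j \<Longrightarrow> orthogonal_sets (Ls ! i) (Ls ! j)"
    and xs: "list_all2 (\<in>) xs Ls" and ys: "list_all2 (\<in>) ys Ls"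
    and eq: "foldr (+) xs (0\<^sub>v n) = foldr (+) ys (0\<^sub>v n)"
  shows "xs = ys"
proof (rule nth_equalityI)
  have len: "length xs = length Ls" "length ys = length Ls"
    using xs ys by (auto dest: list_all2_lengthD)
  then show "length xs = length ys" by simp
  have mem: "xs ! k \<in> Ls ! k" "ys ! k \<in> Ls ! k" if "k < length Ls" for k
    using xs ys that by (auto simp: list_all2_conv_all_nth)
  have car: "xs ! k \<in> carrier_vec n" "ys ! k \<in> carrier_vec n" if "k < length Ls" for k
    using mem[OF that] int_module_carrier[OF Ls[OF that]] by auto
  have sub: "set xs \<subseteq> carrier_vec n" "set ys \<subseteq> carrier_vec n"
    using car len by (auto simp: in_set_conv_nth)
  fix k assume "k < length xs"
  then have k: "k < length Ls" using len by simp
  define d where "d = xs ! k - ys ! k"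
  have dL: "d \<in> Ls ! k" unfolding d_def by (rule int_module_diff[OF Ls[OF k] mem[OF k]])
  have d: "d \<in> carrier_vec n" using int_module_carrier[OF Ls[OF k] dL] .
  have single: "foldr (+) zs (0\<^sub>v n) \<bullet> d = zs ! k \<bullet> d"
    if z: "length zs = length Ls" "set zs \<subseteq> carrier_vec n" "\<And>m. m < length Ls \<Longrightarrow> zs ! m \<in> Ls ! m" for zs
  proof -
    have "foldr (+) zs (0\<^sub>v n) \<bullet> d = (\<Sum>m<length Ls. zs ! m \<bullet> d)"
      using foldr_add_scalar_prod[OF z(2) d] z(1) by simp
    also have "\<dots> = (\<Sum>m<length Ls. if m = k then zs ! m \<bullet> d else 0)"
      using orth[of _ k] z(3) dL k by (intro sum.cong refl) (auto simp: orthogonal_sets_def)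
    finally show ?thesis using k by simp
  qed
  have "xs ! k \<bullet> d = ys ! k \<bullet> d"
    using single[OF len(1) sub(1) mem(1)] single[OF len(2) sub(2) mem(2)] eq by simp
  then have "d \<bullet> d = 0"
    using minus_scalar_prod_distrib[OF car[OF k] d] by (simp add: d_def)
  then have 0: "d = 0\<^sub>v n" using scalar_prod_self_zero[OF d] by simp
  have "xs ! k $ j = ys ! k $ j" if "j < n" for j
    using arg_cong[OF 0, of "\<lambda>v. v $ j"] that car[OF k] by (simp add: d_def)
  then show "xs ! k = ys ! k" using car[OF k] by (intro eq_vecI) auto
qed

definition block :: "nat \<Rightarrow> (nat \<Rightarrow> nat) \<Rightarrow> nat \<Rightarrow> nat list" where
  "block n lab l = filter (\<lambda>i. lab i = l) [0..<n]"

text \<open>Labels that die out when components are merged leave empty blocks. Their span is the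
  zero lattice, which does not count as indecomposable, so they are dropped.\<close>

definition blocks :: "nat \<Rightarrow> (nat \<Rightarrow> nat) \<Rightarrow> (nat \<Rightarrow> real vec) \<Rightarrow> real vec list list" where
  "blocks n lab b = map (\<lambda>l. map b (block n lab l)) (filter (\<lambda>l. block n lab l \<noteq> []) [0..<n])"

lemma set_block: "set (block n lab l) = {i. i < n \<and> lab i = l}"
  by (auto simp: block_def)

lemma blocks_lattice_basis:
  assumes b: "\<And>i. i < n \<Longrightarrow> b i \<in> carrier_vec n" and d: "\<And>i. i < n \<Longrightarrow> d i \<in> carrier_vec n"
    and dual: "\<And>i j. i < n \<Longrightarrow> j < n \<Longrightarrow> b i \<bullet> d j = (if i = j then 1 else (0::real))"
  shows "lattice_basis n (map b (block n lab l)) (int_span n (b ` {i. i < n \<and> lab i = l}))"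
  unfolding lattice_basis_def
proof (intro conjI)
  show "set (map b (block n lab l)) \<subseteq> carrier_vec n" using b by (auto simp: set_block)
  have "inj_on b {i. i < n \<and> lab i = l}" by (rule inj_on_dual[where d = d]) (use dual in auto)
  then show "distinct (map b (block n lab l))"
    by (simp add: distinct_map set_block) (simp add: block_def)
  have "LinearCombinations.module.lin_indpt class_ring (module_vec TYPE(real) n)
     (b ` {i. i < n \<and> lab i = l})"
    by (rule lin_indpt_dual[where d = d]) (use b d dual in auto)
  then show "LinearCombinations.module.lin_indpt class_ring (module_vec TYPE(real) n)
     (set (map b (block n lab l)))" by (simp add: set_block)
qed (simp add: set_block)

lemma block_span_orthogonal:
  assumes b: "\<And>i. i < n \<Longrightarrow> b i \<in> carrier_vec n" and IJ: "I \<subseteq> {..<n}" "J \<subseteq> {..<n}"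
    and orth: "\<And>i j. i \<in> I \<Longrightarrow> j \<in> J \<Longrightarrow> b i \<bullet> b j = (0::real)"
  shows "orthogonal_sets (int_span n (b ` I)) (int_span n (b ` J))"
  unfolding orthogonal_sets_def
proof (intro ballI)
  have fin: "finite I" "finite J" using IJ finite_subset by blast+
  have sub: "b ` I \<subseteq> carrier_vec n" "b ` J \<subseteq> carrier_vec n" using b IJ by auto
  fix x y assume "x \<in> int_span n (b ` I)" "y \<in> int_span n (b ` J)"
  then obtain c e :: "nat \<Rightarrow> int"
    where x: "x = comb n I (\<lambda>i. of_int (c i)) b" and y: "y = comb n J (\<lambda>i. of_int (e i)) b"
    unfolding int_span_family[OF fin(1) sub(1)] int_span_family[OF fin(2) sub(2)] by blast
  have "b i \<bullet> y = 0" if "i \<in> I" for i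
  proof -
    have bi: "b i \<in> carrier_vec n" using that sub by auto
    have "y \<bullet> b i = (\<Sum>j\<in>J. of_int (e j) * (b j \<bullet> b i))"
      unfolding y by (rule comb_scalar_prod[OF bi])
    also have "\<dots> = 0"
    proof (intro sum.neutral ballI)
      fix j assume j: "j \<in> J"
      then have "b j \<bullet> b i = b i \<bullet> b j" using sub by (intro comm_scalar_prod[OF _ bi]) auto
      then show "of_int (e j) * (b j \<bullet> b i) = 0" using orth[OF that j] by simp
    qed
    finally show ?thesis using comm_scalar_prod[OF bi, of y] y by simp
  qed
  moreover have "x \<bullet> y = (\<Sum>i\<in>I. of_int (c i) * (b i \<bullet> y))"
    unfolding x by (rule comb_scalar_prod) (simp add: y)
  ultimately show "x \<bullet> y = 0" by simp
qed

text \<open>Existence comes from sorting the coefficients of a vector by label, uniqueness from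
  orthogonality alone.\<close>

lemma blocks_direct_sum:
  assumes b: "\<And>i. i < n \<Longrightarrow> b i \<in> carrier_vec n"
    and L: "L = int_span n (b ` {..<n})"
    and lab: "\<And>i. i < n \<Longrightarrow> lab i < n"
    and edge: "\<And>i j. i < n \<Longrightarrow> j < n \<Longrightarrow> b i \<bullet> b j \<noteq> (0::real) \<Longrightarrow> lab i = lab j"
  shows "orthogonal_direct_sum n L (map (\<lambda>bs. int_span n (set bs)) (blocks n lab b))"
proof -
  define I where "I = (\<lambda>l. {i. i < n \<and> lab i = l})"
  define ls where "ls = filter (\<lambda>l. block n lab l \<noteq> []) [0..<n]"
  define Ls where "Ls = map (\<lambda>l. int_span n (b ` I l)) ls"
  have Ls: "map (\<lambda>bs. int_span n (set bs)) (blocks n lab b) = Ls"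
    by (simp add: blocks_def Ls_def ls_def I_def set_block)
  have I: "finite (I l)" "I l \<subseteq> {..<n}" "b ` I l \<subseteq> carrier_vec n" for l using b by (auto simp: I_def)
  have ls: "distinct ls" by (simp add: ls_def)
  have non_edge: "b i \<bullet> b j = 0" if "i < n" "j < n" "lab i \<noteq> lab j" for i j
    using edge that by blast
  have mod: "int_module n (Ls ! k)" if "k < length Ls" for k
    using that int_module_int_span[OF finite_imageI[OF I(1)] I(3)] by (simp add: Ls_def)
  have Lmod: "int_module n L"
    unfolding L by (rule int_module_int_span) (use b in auto)
  have LsL: "Ls ! k \<subseteq> L" if "k < length Ls" for k
  proof -
    have "b ` I (ls ! k) \<subseteq> L"
      unfolding L using int_span_superset[of "b ` {..<n}" n] b by (force simp: I_def)
    then show ?thesis using that int_span_least[OF Lmod] by (simp add: Ls_def)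
  qed
  have orth: "orthogonal_sets (Ls ! k) (Ls ! m)" if "k < length Ls" "m < length Ls" "k \<noteq> m" for k m
  proof -
    have "ls ! k \<noteq> ls ! m" using that ls by (simp add: Ls_def nth_eq_iff_index_eq)
    then have "orthogonal_sets (int_span n (b ` I (ls ! k))) (int_span n (b ` I (ls ! m)))"
      by (intro block_span_orthogonal[OF b I(2) I(2)]) (use non_edge in \<open>auto simp: I_def\<close>)
    then show ?thesis using that by (simp add: Ls_def)
  qed
  have ex: "\<exists>xs. list_all2 (\<in>) xs Ls \<and> v = foldr (+) xs (0\<^sub>v n)" if "v \<in> L" for v
  proof -
    have "b ` {..<n} \<subseteq> carrier_vec n" using b by auto
    from that[unfolded L int_span_family[OF finite_lessThan this]]
    obtain c :: "nat \<Rightarrow> int" where v: "v = comb n {..<n} (\<lambda>i. of_int (c i)) b"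
      by blast
    define xs where "xs = map (\<lambda>l. comb n (I l) (\<lambda>i. of_int (c i)) b) ls"
    have "comb n (I l) (\<lambda>i. of_int (c i)) b \<in> int_span n (b ` I l)" for l
      unfolding int_span_family[OF I(1) I(3)] by (rule rangeI)
    then have "list_all2 (\<in>) xs Ls" by (simp add: xs_def Ls_def list_all2_conv_all_nth)
    moreover have "v = foldr (+) xs (0\<^sub>v n)"
    proof (rule eq_vecI)
      have xs: "set xs \<subseteq> carrier_vec n" by (auto simp: xs_def)
      show "dim_vec v = dim_vec (foldr (+) xs (0\<^sub>v n))" using foldr_add_carrier[OF xs] v by simp
      fix j assume "j < dim_vec (foldr (+) xs (0\<^sub>v n))"
      then have j: "j < n" using foldr_add_carrier[OF xs] by simp
      let ?f = "\<lambda>i. of_int (c i) * b i $ j"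
      have "foldr (+) xs (0\<^sub>v n) $ j = (\<Sum>k<length ls. \<Sum>i\<in>I (ls ! k). ?f i)"
        using foldr_add_index[OF xs j] j by (simp add: xs_def)
      also have "\<dots> = (\<Sum>l\<in>set ls. \<Sum>i\<in>I l. ?f i)"
        by (subst sum_list_distinct_conv_sum_set[OF ls, symmetric])
          (simp add: sum_list_sum_nth atLeast0LessThan)
      also have "\<dots> = (\<Sum>l\<in>set ls. \<Sum>i\<in>{i \<in> {..<n}. lab i = l}. ?f i)" by (simp add: I_def)
      also have "\<dots> = (\<Sum>i<n. ?f i)"
      proof (rule sum.group)
        show "lab ` {..<n} \<subseteq> set ls"
        proof (rule image_subsetI)
          fix i assume "i \<in> {..<n}"
          then have "i \<in> set (block n lab (lab i))" by (simp add: set_block)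
          then show "lab i \<in> set ls" using lab \<open>i \<in> {..<n}\<close> by (auto simp: ls_def)
        qed
      qed simp_all
      finally show "v $ j = foldr (+) xs (0\<^sub>v n) $ j" using v j by simp
    qed
    ultimately show ?thesis by blast
  qed
  have conv: "foldr (+) xs (0\<^sub>v n) \<in> L" if "list_all2 (\<in>) xs Ls" for xs
  proof (rule int_module_foldr_add[OF Lmod])
    show "set xs \<subseteq> L" using that LsL by (force simp: list_all2_conv_all_nth in_set_conv_nth)
  qed
  show ?thesis
    unfolding Ls orthogonal_direct_sum_def
  proof (intro conjI ballI allI impI)
    show "L = {foldr (+) xs (0\<^sub>v n) |xs. list_all2 (\<in>) xs Ls}" using ex conv by blast
    show "\<exists>!xs. list_all2 (\<in>) xs Ls \<and> v = foldr (+) xs (0\<^sub>v n)" if "v \<in> L" for v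
      using ex[OF that] orthogonal_summands_unique[OF mod orth] by metis
  qed (use orth in auto)
qed

text \<open>A decomposition of \<open>M\<close> into \<open>L1\<close> and \<open>L2\<close> is
  extended to all of \<open>L\<close> by replacing \<open>L2\<close> with everything in
  \<open>L\<close> orthogonal to \<open>L1\<close>; then \<open>split\<close> puts each basis vector
  on one side. An edge cannot join the two sides, so a connected block lies on a single side, and
  \<open>L1\<close> or \<open>L2\<close> exhausts \<open>M\<close>.\<close>

lemma block_indecomposable:
  assumes b: "\<And>i. i < n \<Longrightarrow> b i \<in> carrier_vec n" and nz: "\<And>i. i < n \<Longrightarrow> b i \<noteq> 0\<^sub>v n"
    and L: "L = int_span n (b ` {..<n})"
    and edge: "\<And>i j. i < n \<Longrightarrow> j < n \<Longrightarrow> b i \<bullet> b j \<noteq> (0::real) \<Longrightarrow> lab i = lab j"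
    and conn: "\<And>i j. i < n \<Longrightarrow> j < n \<Longrightarrow> lab i = lab j \<Longrightarrow>
      (i, j) \<in> {(i, j). i < n \<and> j < n \<and> b i \<bullet> b j \<noteq> 0}\<^sup>*"
    and split: "\<And>A C i. A \<subseteq> L \<Longrightarrow> C \<subseteq> L \<Longrightarrow> (\<And>x y. x \<in> A \<Longrightarrow> y \<in> C \<Longrightarrow> x \<bullet> y = 0) \<Longrightarrow>
      (\<And>z. z \<in> L \<Longrightarrow> \<exists>x\<in>A. \<exists>y\<in>C. z = x + y) \<Longrightarrow> i < n \<Longrightarrow> b i \<in> A \<or> b i \<in> C"
    and M: "M = int_span n (b ` {i. i < n \<and> lab i = l})" "is_lattice n M"
    and i0: "i0 < n" "lab i0 = l"
  shows "indecomposable n M"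
proof -
  define I where "I = {i. i < n \<and> lab i = l}"
  define J where "J = {i. i < n \<and> lab i \<noteq> l}"
  have IJ: "finite I" "finite J" "I \<union> J = {..<n}" "I \<inter> J = {}" "I \<subseteq> {..<n}" "J \<subseteq> {..<n}"
    by (auto simp: I_def J_def)
  have sub: "b ` I \<subseteq> carrier_vec n" "b ` J \<subseteq> carrier_vec n" "b ` {..<n} \<subseteq> carrier_vec n"
    using b by (auto simp: I_def J_def)
  have MI: "M = int_span n (b ` I)" using M by (simp add: I_def)
  have bL: "b i \<in> L" if "i < n" for i
    unfolding L using int_span_superset[OF _ sub(3)] that by auto
  have bM: "b i \<in> M" if "i \<in> I" for i
    unfolding MI using int_span_superset[OF _ sub(1)] IJ(1) that by auto
  have Lmod: "int_module n L" unfolding L by (rule int_module_int_span[OF _ sub(3)]) simp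
  have Mmod: "int_module n M" using M(2) by (rule int_module_lattice)
  have non_edge: "b i \<bullet> b j = 0" if "i < n" "j < n" "lab i \<noteq> lab j" for i j
    using edge that by blast
  have orthIJ: "orthogonal_sets M (int_span n (b ` J))"
    unfolding MI by (rule block_span_orthogonal[OF b IJ(5,6)]) (use non_edge in \<open>auto simp: I_def J_def\<close>)
  have M_le_L: "M \<subseteq> L" unfolding MI by (rule int_span_least[OF Lmod]) (use bL IJ in auto)
  have JL: "int_span n (b ` J) \<subseteq> L" by (rule int_span_least[OF Lmod]) (use bL IJ in auto)
  have i0I: "i0 \<in> I" using i0 by (simp add: I_def)
  have "M \<noteq> {0\<^sub>v n}" using bM[OF i0I] nz[OF i0(1)] by auto
  moreover have "\<not> decomposable n M"
  proof
    assume "decomposable n M"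
    then obtain L1 L2 where lat: "is_lattice n L1" "is_lattice n L2"
      and proper: "L1 \<subset> M" "L2 \<subset> M" and sum: "M = {x + y | x y. x \<in> L1 \<and> y \<in> L2}"
      and orth: "orthogonal_sets L1 L2"
      unfolding decomposable_def by blast
    note mod1 = int_module_lattice[OF lat(1)] and mod2 = int_module_lattice[OF lat(2)]
    \<comment> \<open>\<open>C\<close> contains \<open>L2\<close> and the span of all other blocks,
      hence \<open>L1 + C = L\<close>.\<close>
    define C where "C = {z \<in> L. \<forall>x\<in>L1. x \<bullet> z = 0}"
    have Cmod: "int_module n C"
      unfolding int_module_def
    proof (intro conjI ballI allI)
      show "C \<subseteq> carrier_vec n" using int_module_carrier[OF Lmod] by (auto simp: C_def)
      show "0\<^sub>v n \<in> C" using int_module_zero[OF Lmod] int_module_carrier[OF mod1] by (auto simp: C_def)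
      fix z y k assume zy: "z \<in> C" "y \<in> C"
      have "x \<bullet> (z + of_int k \<cdot>\<^sub>v y) = 0" if x: "x \<in> L1" for x
      proof -
        have c: "x \<in> carrier_vec n" "z \<in> carrier_vec n" "y \<in> carrier_vec n"
          using int_module_carrier[OF Lmod] int_module_carrier[OF mod1] zy x by (auto simp: C_def)
        then have "x \<bullet> (z + of_int k \<cdot>\<^sub>v y) = x \<bullet> z + of_int k * (x \<bullet> y)"
          by (simp add: scalar_prod_add_distrib[of _ n])
        then show ?thesis using zy x by (simp add: C_def)
      qed
      then show "z + of_int k \<cdot>\<^sub>v y \<in> C"
        using zy int_module_add_mult[OF Lmod] by (simp add: C_def)
    qed
    have side: "b i \<in> L1 \<or> b i \<in> C" if i: "i < n" for i
    proof (rule split[OF _ _ _ _ i])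
      show "L1 \<subseteq> L" using proper M_le_L by auto
      show "C \<subseteq> L" by (auto simp: C_def)
      show "x \<bullet> y = 0" if "x \<in> L1" "y \<in> C" for x y using that by (simp add: C_def)
      fix z assume "z \<in> L"
      then obtain c :: "nat \<Rightarrow> int" where z: "z = comb n {..<n} (\<lambda>i. of_int (c i)) b"
        unfolding L int_span_family[OF finite_lessThan sub(3)] by blast
      define zI where "zI = comb n I (\<lambda>i. of_int (c i)) b"
      define zJ where "zJ = comb n J (\<lambda>i. of_int (c i)) b"
      have zIM: "zI \<in> M" unfolding zI_def MI int_span_family[OF IJ(1) sub(1)] by (rule rangeI)
      have zJJ: "zJ \<in> int_span n (b ` J)"
        unfolding zJ_def int_span_family[OF IJ(2) sub(2)] by (rule rangeI)
      obtain x y where xy: "zI = x + y" "x \<in> L1" "y \<in> L2" using zIM sum by blast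
      have xyM: "x \<in> M" "y \<in> M" using xy proper by auto
      have c: "x \<in> carrier_vec n" "y \<in> carrier_vec n" "zJ \<in> carrier_vec n"
        using xy int_module_carrier[OF mod1] int_module_carrier[OF mod2] by (auto simp: zJ_def)
      have "z = zI + zJ"
      proof (rule eq_vecI)
        fix j assume "j < dim_vec (zI + zJ)"
        then show "z $ j = (zI + zJ) $ j"
          using sum.union_disjoint[OF IJ(1,2,4), of "\<lambda>i. of_int (c i) * b i $ j"] z
          by (simp add: zI_def zJ_def IJ(3))
      qed (simp add: z zJ_def)
      then have "z = x + (y + zJ)" using xy(1) c by (auto simp: assoc_add_vec[of _ n])
      moreover have "y + zJ \<in> C"
      proof -
        have "u \<bullet> (y + zJ) = 0" if u: "u \<in> L1" for u
        proof -
          have "u \<in> M" "u \<in> carrier_vec n" using u proper int_module_carrier[OF mod1] by auto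
          then have "u \<bullet> (y + zJ) = u \<bullet> y + u \<bullet> zJ" using c by (simp add: scalar_prod_add_distrib[of _ n])
          then show ?thesis using orth orthIJ u xy(3) zJJ \<open>u \<in> M\<close> by (simp add: orthogonal_sets_def)
        qed
        moreover have "y + zJ \<in> L" using int_module_add[OF Lmod] xyM M_le_L JL zJJ by blast
        ultimately show ?thesis by (simp add: C_def)
      qed
      ultimately show "\<exists>x\<in>L1. \<exists>y\<in>C. z = x + y" using xy(2) by blast
    qed
    have step: "b j \<in> L1" if "b i \<in> L1" "j < n" "b i \<bullet> b j \<noteq> 0" for i j
      using side[OF that(2)] that by (auto simp: C_def)
    have path: "b i \<in> L1 \<longrightarrow> b j \<in> L1"
      if "(i, j) \<in> {(i, j). i < n \<and> j < n \<and> b i \<bullet> b j \<noteq> 0}\<^sup>*" for i j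
      using that by (induction rule: rtrancl_induct) (use step in auto)
    show False
    proof (cases "b i0 \<in> L1")
      case True
      have "b i \<in> L1" if "i \<in> I" for i using path[OF conn[of i0 i]] True i0 that by (simp add: I_def)
      then have "M \<subseteq> L1" unfolding MI by (intro int_span_least[OF mod1]) auto
      then show False using proper by auto
    next
      \<comment> \<open>Now the whole block is orthogonal to \<open>L1\<close>, which lies in its
        span \<open>M\<close>. So \<open>L1\<close> is zero and \<open>L2\<close> is all of
        \<open>M\<close>.\<close>
      case False
      have "b i \<in> C" if "i \<in> I" for i
        using path[OF conn[of i i0]] False i0 that side[of i] by (auto simp: I_def)
      then have "M \<subseteq> C" unfolding MI by (intro int_span_least[OF Cmod]) auto
      then have "x \<bullet> x = 0" if "x \<in> L1" for x using that proper by (auto simp: C_def)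
      then have zero: "x = 0\<^sub>v n" if "x \<in> L1" for x
        using that int_module_carrier[OF mod1] scalar_prod_self_zero by blast
      have "x + y \<in> L2" if "x \<in> L1" "y \<in> L2" for x y
        using zero[OF that(1)] that(2) int_module_carrier[OF mod2] by simp
      then have "M \<subseteq> L2" using sum by blast
      then show False using proper by auto
    qed
  qed
  ultimately show ?thesis using M(2) by (simp add: indecomposable_def)
qed

section \<open>Elementary loops\<close>

abbreviation set_row :: "arr \<Rightarrow> nat \<Rightarrow> (nat \<Rightarrow> real) \<Rightarrow> state \<Rightarrow> state" where
  "set_row a i r st \<equiv> st\<lparr>ar := (ar st)(a := (ar st a)(i := r))\<rparr>"

abbreviation VN :: "nat \<Rightarrow> vexp" where
  "VN k \<equiv> VI (IC k)"

definition row_loop :: "reg \<Rightarrow> arr \<Rightarrow> iexp \<Rightarrow> vexp \<Rightarrow> rcom" where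
  "row_loop x a e v = loop x IDim (vset a e (IR x) v)"

definition fetch_loop :: "reg \<Rightarrow> arr \<Rightarrow> iexp \<Rightarrow> iexp \<Rightarrow> rcom" where
  "fetch_loop x a e g = loop x IDim (fetch a e (IR x) g)"

definition sum_loop :: "reg \<Rightarrow> arr \<Rightarrow> iexp \<Rightarrow> iexp \<Rightarrow> vexp \<Rightarrow> rcom" where
  "sum_loop x a e f v = vset a e f (VN 0) ;; loop x IDim (vset a e f (VAdd (VA a e f) v))"

text \<open>\<open>v\<close> is evaluated when the entries before k already have their new values;
  this covers rows that are updated in place.\<close>

lemma run_row_loop:
  assumes "\<And>k r. ival e (set_ix x k (set_row a i r st)) = i"
    and "\<And>k. k < dm st \<Longrightarrow>
      vval v (set_ix x k (set_row a i (\<lambda>j. if j < k then V j else ar st a i j) st)) = V k"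
    and "Q (set_ix x (dm st) (set_row a i (\<lambda>j. if j < dm st then V j else ar st a i j) st))"
    and "x \<noteq> rC"
  shows "run \<kappa> (row_loop x a e v) st (dm st * (ccost e (IR x) + vcost v + 63) + 42) Q"
proof -
  let ?S = "\<lambda>k. set_ix x k (set_row a i (\<lambda>j. if j < k then V j else ar st a i j) st)"
  have "run \<kappa> (row_loop x a e v) st
      (dm st * (ccost e (IR x) + vcost v + 1 + icost IDim + 60) + icost IDim + 40) Q"
    unfolding row_loop_def
  proof (rule run_loop[where I = "\<lambda>k st'. st' = ?S k"])
    fix k st' assume k: "k < dm st" and st': "st' = ?S k"
    have "set_ix x (Suc k) (set_ar a i k (V k) (?S k)) = ?S (Suc k)"
      by (auto simp: fun_eq_iff intro!: state.equality)
    then show "run \<kappa> (vset a e (IR x) v) st' (ccost e (IR x) + vcost v + 1)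
        (\<lambda>st''. ix st'' x = k \<and> set_ix x (Suc k) st'' = ?S (Suc k))"
      unfolding st' using assms(1,2) k
      by (intro run_vset) simp
  qed (use assms in \<open>auto intro!: state.equality\<close>)
  then show ?thesis by (rule run_cost) simp
qed

lemma run_fetch_loop:
  assumes "\<And>k r. ival e (set_ix x k (set_row a i r st)) = i"
    and "\<And>k r. k < dm st \<Longrightarrow> ival g (set_ix x k (set_row a i r st)) = G k"
    and "\<And>k. k < dm st \<Longrightarrow> G k < base st"
    and "\<And>k. k < dm st \<Longrightarrow> lo st (G k) = V k"
    and "Q (set_ix x (dm st) (set_row a i (\<lambda>j. if j < dm st then V j else ar st a i j) st))"
    and "x \<noteq> rC"
  shows "run \<kappa> (fetch_loop x a e g) st (dm st * (ccost e (IR x) + icost g + 64) + 42) Q"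
proof -
  let ?S = "\<lambda>k. set_ix x k (set_row a i (\<lambda>j. if j < k then V j else ar st a i j) st)"
  have "run \<kappa> (fetch_loop x a e g) st
      (dm st * (ccost e (IR x) + icost g + 2 + icost IDim + 60) + icost IDim + 40) Q"
    unfolding fetch_loop_def
  proof (rule run_loop[where I = "\<lambda>k st'. st' = ?S k"])
    fix k st' assume k: "k < dm st" and st': "st' = ?S k"
    have "set_ix x (Suc k) (set_ar a i k (V k) (?S k)) = ?S (Suc k)"
      by (auto simp: fun_eq_iff intro!: state.equality)
    moreover have "base (?S k) = base st" by (simp add: base_def)
    ultimately show "run \<kappa> (fetch a e (IR x) g) st' (ccost e (IR x) + icost g + 2)
        (\<lambda>st''. ix st'' x = k \<and> set_ix x (Suc k) st'' = ?S (Suc k))"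
      unfolding st' using assms(1-4) k
      by (intro run_fetch) simp_all
  qed (use assms in \<open>auto intro!: state.equality\<close>)
  then show ?thesis by (rule run_cost) simp
qed

lemma run_sum_loop:
  assumes "ival e st = i" "ival f st = j"
    and "\<And>k c. ival e (set_ix x k (set_ar a i j c st)) = i"
    and "\<And>k c. ival f (set_ix x k (set_ar a i j c st)) = j"
    and "\<And>k c. k < dm st \<Longrightarrow> vval v (set_ix x k (set_ar a i j c st)) = V k"
    and "Q (set_ix x (dm st) (set_ar a i j (\<Sum>k<dm st. V k) st))"
    and "x \<noteq> rC"
  shows "run \<kappa> (sum_loop x a e f v) st
    (ccost e f + 2 + (dm st * (2 * ccost e f + vcost v + 65) + 42)) Q"
proof -
  let ?S = "\<lambda>k. set_ix x k (set_ar a i j (\<Sum>m<k. V m) st)"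
  let ?st = "set_ar a i j 0 st"
  have "run \<kappa> (loop x IDim (vset a e f (VAdd (VA a e f) v))) ?st
      (dm st * (ccost e f + vcost (VAdd (VA a e f) v) + 1 + icost IDim + 60) + icost IDim + 40) Q"
  proof (rule run_loop[where I = "\<lambda>k st'. st' = ?S k"])
    fix k st' assume k: "k < dm st" and st': "st' = ?S k"
    have "set_ix x (Suc k) (set_ar a i j (sum V {..<k} + V k) (?S k)) = ?S (Suc k)"
      by (auto simp: fun_eq_iff intro!: state.equality)
    then show "run \<kappa> (vset a e f (VAdd (VA a e f) v)) st'
        (ccost e f + vcost (VAdd (VA a e f) v) + 1)
        (\<lambda>st''. ix st'' x = k \<and> set_ix x (Suc k) st'' = ?S (Suc k))"
      unfolding st' using assms(3-5) k
      by (intro run_vset) simp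
  qed (use assms in \<open>auto intro!: state.equality\<close>)
  then have "run \<kappa> (loop x IDim (vset a e f (VAdd (VA a e f) v))) ?st
      (dm st * (2 * ccost e f + vcost v + 65) + 42) Q"
    by (rule run_cost) simp
  then have "run \<kappa> (sum_loop x a e f v) st
      (ccost e f + vcost (VN 0) + 1 + (dm st * (2 * ccost e f + vcost v + 65) + 42)) Q"
    unfolding sum_loop_def using assms(1,2) by (intro run_Seq run_vset) simp
  then show ?thesis by (rule run_cost) simp
qed

definition frame :: "reg set \<Rightarrow> arr set \<Rightarrow> state \<Rightarrow> state \<Rightarrow> bool" where
  "frame R A st st' \<longleftrightarrow> dm st' = dm st \<and> cn st' = cn st \<and> lo st' = lo st \<and>
     (\<forall>x. x \<notin> R \<longrightarrow> ix st' x = ix st x) \<and> (\<forall>a. a \<notin> A \<longrightarrow> ar st' a = ar st a)"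

lemma frame_trans:
  assumes "frame R A st st'" "frame R' A' st' st''" "R \<subseteq> R''" "R' \<subseteq> R''" "A \<subseteq> A''" "A' \<subseteq> A''"
  shows "frame R'' A'' st st''"
  using assms unfolding frame_def by (metis subsetD)

section \<open>Loading the vectors\<close>

definition load_prog :: rcom where
  "load_prog = loop rR ICount
     (fetch_loop rJ aX (IR rR) (IAdd (IC 3) (IAdd (IMul (IR rR) IDim) (IR rJ))) ;;
      sum_loop rJ aN (IR rR) (IC 0) (VMul (VA aX (IR rR) (IR rJ)) (VA aX (IR rR) (IR rJ))))"

lemma input_address:
  assumes "r < cn st" "j < dm st"
  shows "3 + (r * dm st + j) < base st"
proof -
  have "Suc r * dm st \<le> cn st * dm st" using assms(1) by (intro mult_le_mono1) simp
  then have "r * dm st + j < cn st * dm st" using assms(2) by simp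
  then show ?thesis by (simp add: base_def mult.commute)
qed

lemma run_load_prog:
  "run \<kappa> load_prog st (2000 * (cn st + 1) * (dm st + 1)) (\<lambda>st'.
     frame {rR, rJ} {aX, aN} st st' \<and>
     (\<forall>r<cn st. \<forall>j<dm st. ar st' aX r j = lo st (3 + (r * dm st + j))) \<and>
     (\<forall>r<cn st. ar st' aN r 0 = (\<Sum>j<dm st. (lo st (3 + (r * dm st + j)))\<^sup>2)))" (is "run _ _ _ _ ?Q")
proof -
  let ?V = "\<lambda>r j. lo st (3 + (r * dm st + j))"
  define I where "I = (\<lambda>k st'. frame {rR, rJ} {aX, aN} st st' \<and>
     (\<forall>r<k. \<forall>j<dm st. ar st' aX r j = ?V r j) \<and>
     (\<forall>r<k. ar st' aN r 0 = (\<Sum>j<dm st. (?V r j)\<^sup>2)))"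
  have "run \<kappa> load_prog st (cn st * (1000 * (dm st + 1) + icost ICount + 60) + icost ICount + 40) ?Q"
    unfolding load_prog_def
  proof (rule run_loop[where I = I])
    fix k st' assume k: "k < cn st" "I k st'" "ix st' rR = k"
    have fr: "dm st' = dm st" "cn st' = cn st" "lo st' = lo st" using k by (auto simp: I_def frame_def)
    let ?st1 = "set_ix rJ (dm st) (set_row aX k (\<lambda>j. if j < dm st then ?V k j else ar st' aX k j) st')"
    let ?st2 = "set_ix rJ (dm st) (set_ar aN k 0 (\<Sum>j<dm st. (?V k j)\<^sup>2) ?st1)"
    have I2: "I (Suc k) (set_ix rR (Suc k) ?st2)"
      using k fr unfolding I_def frame_def by (auto simp: less_Suc_eq)
    show "run \<kappa> (fetch_loop rJ aX (IR rR) (IAdd (IC 3) (IAdd (IMul (IR rR) IDim) (IR rJ))) ;;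
      sum_loop rJ aN (IR rR) (IC 0) (VMul (VA aX (IR rR) (IR rJ)) (VA aX (IR rR) (IR rJ)))) st'
      (1000 * (dm st + 1)) (\<lambda>st''. ix st'' rR = k \<and> I (Suc k) (set_ix rR (Suc k) st''))"
      apply (rule run_cost, rule run_Seq)
       apply (rule run_fetch_loop[where G = "\<lambda>j. 3 + (k * dm st + j)" and i = k and V = "?V k"])
           apply (use k fr input_address[of k st'] in simp_all)[4]
        apply (rule run_sum_loop[where V = "\<lambda>j. (?V k j)\<^sup>2" and i = k and j = 0])
              apply (use k fr I2 in \<open>simp_all add: power2_eq_square\<close>)[7]
       apply simp
      apply (simp add: ccost_def fr)
      done
  qed (auto simp: I_def frame_def)
  then show ?thesis by (rule run_cost) (simp add: algebra_simps)
qed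

section \<open>Choosing short independent vectors\<close>

text \<open>\<open>aU\<close> flags the columns already used as pivots by 1. The sum is positive iff
  some other coordinate is nonzero, that is, iff the vector lies outside the span of the chosen
  ones. Squares appear because the machine can only test for \<open><\<close>.\<close>

definition residual :: "state \<Rightarrow> nat \<Rightarrow> real" where
  "residual st r = (\<Sum>j<dm st. (1 - ar st aU 0 j) * (ar st aX r j * ar st aX r j))"

text \<open>\<open>B^2 + 1\<close> exceeds every squared norm in \<open>S\<close> and plays the role
  of infinity in the search for a minimum.\<close>

definition select_prog :: rcom where
  "select_prog =
     fetch aM (IC 0) (IC 0) (IC 2) ;;
     vset aM (IC 0) (IC 0) (VAdd (VMul (VA aM (IC 0) (IC 0)) (VA aM (IC 0) (IC 0))) (VN 1)) ;;
     loop rR ICount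
       (sum_loop rJ aD (IC 0) (IC 0) (VMul (VSub (VN 1) (VA aU (IC 0) (IR rJ)))
          (VMul (VA aX (IR rR) (IR rJ)) (VA aX (IR rR) (IR rJ)))) ;;
        ifless (VN 0) (VA aD (IC 0) (IC 0))
          (ifless (VA aN (IR rR) (IC 0)) (VA aM (IC 0) (IC 0))
             (vset aM (IC 0) (IC 0) (VA aN (IR rR) (IC 0)) ;; iset rB (IR rR)) Skip) Skip)"

lemma run_select_prog:
  assumes ex: "\<exists>r<cn st. 0 < residual st r \<and> ar st aN r 0 < lo st 2 * lo st 2 + 1"
  shows "run \<kappa> select_prog st (3000 * (cn st + 1) * (dm st + 1)) (\<lambda>st'.
     frame {rR, rJ, rB} {aD, aM} st st' \<and> ix st' rB < cn st \<and> 0 < residual st (ix st' rB) \<and>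
     (\<forall>r<cn st. 0 < residual st r \<longrightarrow> ar st aN (ix st' rB) 0 \<le> ar st aN r 0))" (is "run _ _ _ _ ?Q")
proof -
  let ?M = "lo st 2 * lo st 2 + 1"
  define I where "I = (\<lambda>k st'. frame {rR, rJ, rB} {aD, aM} st st' \<and> ar st' aM 0 0 \<le> ?M \<and>
     (\<forall>r<k. 0 < residual st r \<longrightarrow> ar st' aM 0 0 \<le> ar st aN r 0) \<and>
     (ar st' aM 0 0 = ?M \<or> (ix st' rB < k \<and> 0 < residual st (ix st' rB) \<and>
        ar st' aM 0 0 = ar st aN (ix st' rB) 0)))"
  let ?body = "sum_loop rJ aD (IC 0) (IC 0) (VMul (VSub (VN 1) (VA aU (IC 0) (IR rJ)))
          (VMul (VA aX (IR rR) (IR rJ)) (VA aX (IR rR) (IR rJ)))) ;;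
        ifless (VN 0) (VA aD (IC 0) (IC 0))
          (ifless (VA aN (IR rR) (IC 0)) (VA aM (IC 0) (IC 0))
             (vset aM (IC 0) (IC 0) (VA aN (IR rR) (IC 0)) ;; iset rB (IR rR)) Skip) Skip"
  have loop: "run \<kappa> (loop rR ICount ?body) st1
      (cn st * (1000 * (dm st + 1) + icost ICount + 60) + icost ICount + 40) ?Q"
    if st1: "st1 = set_ar aM 0 0 ?M st" for st1
  proof (rule run_loop[where I = I])
    fix k st' assume k: "k < cn st" "I k st'" "ix st' rR = k"
    have fr: "dm st' = dm st" "cn st' = cn st" "lo st' = lo st" "ar st' aU = ar st aU"
      "ar st' aX = ar st aX" "ar st' aN = ar st aN"
      using k by (auto simp: I_def frame_def)
    let ?st2 = "set_ix rJ (dm st) (set_ar aD 0 0 (residual st k) st')"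
    have skip: "I (Suc k) (set_ix rR (Suc k) ?st2)"
      if "\<not> 0 < residual st k \<or> ar st' aM 0 0 \<le> ar st aN k 0"
      using k that unfolding I_def frame_def by (auto simp: less_Suc_eq)
    have upd: "I (Suc k) (set_ix rR (Suc k) (set_ix rB k (set_ar aM 0 0 (ar st aN k 0) ?st2)))"
      if "0 < residual st k" "ar st aN k 0 < ar st' aM 0 0"
      using k that unfolding I_def frame_def by (force simp: less_Suc_eq)
    show "run \<kappa> ?body st' (1000 * (dm st + 1)) (\<lambda>st''. ix st'' rR = k \<and> I (Suc k) (set_ix rR (Suc k) st''))"
      apply (rule run_cost, rule run_Seq)
       apply (rule run_sum_loop[where V = "\<lambda>j. (1 - ar st aU 0 j) * (ar st aX k j * ar st aX k j)"
            and i = 0 and j = 0])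
             apply (use k fr in simp_all)[5]
        apply (rule run_ifless)
         apply (rule run_ifless)
          apply (rule run_Seq)
          apply (rule run_vset)
          apply (rule run_iset)
           apply (use k fr upd in \<open>simp add: residual_def\<close>)
          apply simp
         apply (rule run_Skip)
         apply (use k fr skip in \<open>simp add: residual_def\<close>)
        apply (rule run_Skip)
        apply (use k fr skip in \<open>simp add: residual_def\<close>)
       apply simp
      apply (simp add: ccost_def fr)
      done
  next
    show "I 0 (set_ix rR 0 st1)" by (simp add: I_def frame_def st1)
    fix st' assume I: "I (cn st) st'"
    obtain r where r: "r < cn st" "0 < residual st r" "ar st aN r 0 < ?M" using ex by blast
    have "ar st' aM 0 0 \<le> ar st aN r 0" using I r by (simp add: I_def)
    then have "ar st' aM 0 0 \<noteq> ?M" using r by simp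
    then show "?Q st'" using I by (auto simp: I_def)
  qed (auto simp: I_def frame_def)
  show ?thesis
    unfolding select_prog_def
    apply (rule run_cost)
     apply (rule run_Seq)
     apply (rule run_fetch)
      apply (rule run_Seq)
      apply (rule run_vset)
      apply (rule loop)
      apply simp
     apply (simp add: base_def)
    apply (simp add: ccost_def algebra_simps)
    done
qed

definition pivot_prog :: rcom where
  "pivot_prog = loop rJ IDim (ifless (VN 0)
     (VMul (VSub (VN 1) (VA aU (IC 0) (IR rJ))) (VMul (VA aX (IR rB) (IR rJ)) (VA aX (IR rB) (IR rJ))))
     (iset rP (IR rJ)) Skip)"

lemma run_pivot_prog:
  assumes "0 < residual st (ix st rB)"
  shows "run \<kappa> pivot_prog st (600 * (dm st + 1)) (\<lambda>st'. frame {rJ, rP} {} st st' \<and>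
    ix st' rP < dm st \<and>
    0 < (1 - ar st aU 0 (ix st' rP)) * (ar st aX (ix st rB) (ix st' rP) * ar st aX (ix st rB) (ix st' rP)))"
    (is "run _ _ _ _ ?Q")
proof -
  let ?f = "\<lambda>j. (1 - ar st aU 0 j) * (ar st aX (ix st rB) j * ar st aX (ix st rB) j)"
  define I where "I = (\<lambda>k st'. frame {rJ, rP} {} st st' \<and>
     ((\<exists>j<k. 0 < ?f j) \<longrightarrow> ix st' rP < k \<and> 0 < ?f (ix st' rP)))"
  obtain j0 where j0: "j0 < dm st" "0 < ?f j0"
    using assms sum_nonpos[of "{..<dm st}" ?f] unfolding residual_def by (force simp: not_less[symmetric])
  have "run \<kappa> pivot_prog st (dm st * (500 + icost IDim + 60) + icost IDim + 40) ?Q"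
    unfolding pivot_prog_def
  proof (rule run_loop[where I = I])
    fix k st' assume k: "k < dm st" "I k st'" "ix st' rJ = k"
    have fr: "ar st' aU = ar st aU" "ar st' aX = ar st aX" "ix st' rB = ix st rB"
      using k by (auto simp: I_def frame_def)
    have skip: "I (Suc k) (set_ix rJ (Suc k) st')" if "\<not> 0 < ?f k"
      using k that unfolding I_def frame_def by (auto simp: less_Suc_eq)
    have upd: "I (Suc k) (set_ix rJ (Suc k) (set_ix rP k st'))" if "0 < ?f k"
      using k that unfolding I_def frame_def by auto
    show "run \<kappa> (ifless (VN 0)
     (VMul (VSub (VN 1) (VA aU (IC 0) (IR rJ))) (VMul (VA aX (IR rB) (IR rJ)) (VA aX (IR rB) (IR rJ))))
     (iset rP (IR rJ)) Skip) st' 500 (\<lambda>st''. ix st'' rJ = k \<and> I (Suc k) (set_ix rJ (Suc k) st''))"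
      apply (rule run_cost)
       apply (rule run_ifless)
        apply (rule run_iset)
         apply (use k fr upd in simp)
        apply simp
       apply (rule run_Skip)
       apply (use k fr skip in simp)
      apply (simp add: ccost_def)
      done
  qed (use j0 in \<open>auto simp: I_def frame_def\<close>)
  then show ?thesis by (rule run_cost) simp
qed

text \<open>One Gauss-Jordan step on row \<open>rB\<close> and column \<open>rP\<close>. The pivot
  row is copied to \<open>aA\<close> because the sweep changes it as well, and column
  \<open>rP\<close>, which the row operation turns into zero, is filled in afterwards. The chosen
  vector is taken from the input cells, since \<open>aX\<close> holds only its current
  coordinates.\<close>

definition exchange_prog :: rcom where
  "exchange_prog =
     vset aU (IC 0) (IR rP) (VN 1) ;;
     fetch_loop rJ aW (IR rP) (IAdd (IC 3) (IAdd (IMul (IR rB) IDim) (IR rJ))) ;;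
     row_loop rJ aA (IC 0) (VA aX (IR rB) (IR rJ)) ;;
     loop rR ICount
       (vset aD (IC 0) (IC 0) (VDiv (VA aX (IR rR) (IR rP)) (VA aA (IC 0) (IR rP))) ;;
        row_loop rJ aX (IR rR)
          (VSub (VA aX (IR rR) (IR rJ)) (VMul (VA aD (IC 0) (IC 0)) (VA aA (IC 0) (IR rJ)))) ;;
        vset aX (IR rR) (IR rP) (VA aD (IC 0) (IC 0)))"

lemma run_exchange_prog:
  assumes b: "ix st rB = b" "b < cn st" and p: "ix st rP = p" "p < dm st"
  shows "run \<kappa> exchange_prog st (2000 * (cn st + 1) * (dm st + 1)) (\<lambda>st'.
     frame {rJ, rR} {aU, aW, aA, aD, aX} st st' \<and>
     ar st' aU 0 = (ar st aU 0)(p := 1) \<and>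
     (\<forall>j<dm st. ar st' aW p j = lo st (3 + (b * dm st + j))) \<and>
     (\<forall>q. q \<noteq> p \<longrightarrow> ar st' aW q = ar st aW q) \<and>
     (\<forall>r<cn st. \<forall>j<dm st. ar st' aX r j = (if j = p then ar st aX r p / ar st aX b p
        else ar st aX r j - ar st aX r p / ar st aX b p * ar st aX b j)))" (is "run _ _ _ _ ?Q")
proof -
  let ?n = "dm st"
  let ?st1 = "set_ar aU 0 p 1 st"
  let ?st2 = "set_ix rJ ?n (set_row aW p (\<lambda>j. if j < ?n then lo st (3 + (b * ?n + j)) else ar st aW p j) ?st1)"
  let ?st3 = "set_ix rJ ?n (set_row aA 0 (\<lambda>j. if j < ?n then ar st aX b j else ar st aA 0 j) ?st2)"
  let ?x = "\<lambda>r j. if j = p then ar st aX r p / ar st aX b p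
        else ar st aX r j - ar st aX r p / ar st aX b p * ar st aX b j"
  define I where "I = (\<lambda>k st'. frame {rJ, rR} {aD, aX} ?st3 st' \<and>
     (\<forall>r<k. \<forall>j<?n. ar st' aX r j = ?x r j) \<and> (\<forall>r. k \<le> r \<longrightarrow> ar st' aX r = ar st aX r))"
  let ?body = "vset aD (IC 0) (IC 0) (VDiv (VA aX (IR rR) (IR rP)) (VA aA (IC 0) (IR rP))) ;;
        row_loop rJ aX (IR rR)
          (VSub (VA aX (IR rR) (IR rJ)) (VMul (VA aD (IC 0) (IC 0)) (VA aA (IC 0) (IR rJ)))) ;;
        vset aX (IR rR) (IR rP) (VA aD (IC 0) (IC 0))"
  have loop: "run \<kappa> (loop rR ICount ?body) ?st3
      (cn st * (1000 * (?n + 1) + icost ICount + 60) + icost ICount + 40) ?Q"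
  proof (rule run_loop[where I = I])
    fix k st' assume k: "k < cn st" "I k st'" "ix st' rR = k"
    have fr: "dm st' = dm st" "ix st' rP = p" "\<And>j. j < ?n \<Longrightarrow> ar st' aA 0 j = ar st aX b j"
      "ar st' aX k = ar st aX k"
      using k p by (auto simp: I_def frame_def)
    let ?D = "ar st aX k p / ar st aX b p"
    let ?st4 = "set_ar aD 0 0 ?D st'"
    let ?V = "\<lambda>j. ar st aX k j - ?D * ar st aX b j"
    let ?st5 = "set_ix rJ ?n (set_row aX k (\<lambda>j. if j < ?n then ?V j else ar st aX k j) ?st4)"
    have I5: "I (Suc k) (set_ix rR (Suc k) (set_ar aX k p ?D ?st5))"
      using k unfolding I_def frame_def by (auto simp: less_Suc_eq)
    show "run \<kappa> ?body st' (1000 * (?n + 1)) (\<lambda>st''. ix st'' rR = k \<and> I (Suc k) (set_ix rR (Suc k) st''))"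
      apply (rule run_cost, rule run_Seq, rule run_vset, rule run_Seq)
       apply (rule run_row_loop[where i = k and V = ?V])
          apply (use k fr p in simp_all)[2]
        apply (rule run_vset)
        apply (use k fr p I5 in \<open>simp cong: if_cong\<close>)
       apply simp
      apply (simp add: ccost_def fr)
      done
  qed (use p b in \<open>auto simp: I_def frame_def\<close>)
  show ?thesis
    unfolding exchange_prog_def
    apply (rule run_cost)
     apply (rule run_Seq, rule run_vset, rule run_Seq)
     apply (rule run_fetch_loop[where i = p and G = "\<lambda>j. 3 + (b * ?n + j)" and V = "\<lambda>j. lo st (3 + (b * ?n + j))"])
         apply (use b p in simp_all)[2]
       apply (use input_address[OF b(2)] in \<open>simp add: base_def\<close>)
      apply simp
     apply (rule run_Seq)
      apply (rule run_row_loop[where i = 0 and V = "\<lambda>j. ar st aX b j"])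
        apply (use b p in simp_all)[2]
      apply (use b p loop in \<open>simp cong: if_cong\<close>)
     apply simp
    apply simp
    apply (simp add: ccost_def algebra_simps)
    done
qed

text \<open>Steinitz exchange seen on the dual basis: divide \<open>a p\<close> by
  \<open>v \<bullet> a p\<close> and subtract multiples of \<open>a p\<close> from the other
  \<open>a q\<close>. The formula for \<open>x \<bullet> a' q\<close> is the arithmetic of
  \<open>exchange_prog\<close>.\<close>

lemma pivot_dual:
  assumes w: "\<And>p. p < n \<Longrightarrow> w p \<in> carrier_vec n" and a: "\<And>p. p < n \<Longrightarrow> a p \<in> carrier_vec n"
    and dual: "\<And>p q. p < n \<Longrightarrow> q < n \<Longrightarrow> w p \<bullet> a q = (if p = q then 1 else (0::real))"
    and v: "v \<in> carrier_vec n" and p: "p < n" "v \<bullet> a p \<noteq> 0"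
  obtains a' where "\<And>q. q < n \<Longrightarrow> a' q \<in> carrier_vec n"
    "\<And>x q. x \<in> carrier_vec n \<Longrightarrow> q < n \<Longrightarrow> x \<bullet> a' q = (if q = p then x \<bullet> a p / (v \<bullet> a p)
        else x \<bullet> a q - x \<bullet> a p / (v \<bullet> a p) * (v \<bullet> a q))"
    "\<And>u q. u < n \<Longrightarrow> q < n \<Longrightarrow> (w(p := v)) u \<bullet> a' q = (if u = q then 1 else 0)"
proof -
  define a' where "a' = (\<lambda>q. if q = p then (1 / (v \<bullet> a p)) \<cdot>\<^sub>v a p
      else a q - ((v \<bullet> a q) / (v \<bullet> a p)) \<cdot>\<^sub>v a p)"
  have 1: "a' q \<in> carrier_vec n" if "q < n" for q using that p a by (simp add: a'_def)
  have 2: "x \<bullet> a' q = (if q = p then x \<bullet> a p / (v \<bullet> a p)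
        else x \<bullet> a q - x \<bullet> a p / (v \<bullet> a p) * (v \<bullet> a q))" if "x \<in> carrier_vec n" "q < n" for x q
    using that a[of q] a[OF p(1)]
    by (simp add: a'_def scalar_prod_minus_distrib[of _ n] mult.commute)
  have 3: "(w(p := v)) u \<bullet> a' q = (if u = q then 1 else 0)" if "u < n" "q < n" for u q
  proof (cases "u = p")
    case True
    then show ?thesis using 2[OF v that(2)] p by auto
  next
    case False
    then show ?thesis
      using 2[OF w[OF that(1)] that(2)] dual[OF that] dual[OF that(1) p(1)] by auto
  qed
  show ?thesis using 1 2 3 by (rule that)
qed

section \<open>The input lattice and its irreducible short vectors\<close>

locale lattice_input =
  fixes n :: nat and L :: "real vec set" and B :: real and vs :: "real vec list"
  assumes full_rank: "full_rank_lattice n L"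
    and integral: "integral_lattice n L"
    and distinct_vs: "distinct vs"
    and set_vs: "set vs = {v \<in> L - {0\<^sub>v n}. vnorm v \<le> B}"
    and generates: "int_span n (set vs) = L"
begin

abbreviation s :: nat where "s \<equiv> length vs"

lemma L_module: "int_module n L"
  using integral by (simp add: integral_lattice_def int_module_lattice)

lemma L_carrier: "x \<in> L \<Longrightarrow> x \<in> carrier_vec n"
  by (rule int_module_carrier[OF L_module])

lemma L_int: "x \<in> L \<Longrightarrow> y \<in> L \<Longrightarrow> x \<bullet> y \<in> \<int>"
  using integral by (simp add: integral_lattice_def)

lemma vs_L: "r < s \<Longrightarrow> vs ! r \<in> L"
  using nth_mem[of r vs] set_vs by auto

lemma vs_carrier: "r < s \<Longrightarrow> vs ! r \<in> carrier_vec n"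
  using vs_L L_carrier by blast

lemma vs_norm: "r < s \<Longrightarrow> vnorm (vs ! r) \<le> B"
  using nth_mem[of r vs] set_vs by auto

lemma vs_sq_norm:
  assumes "r < s"
  shows "vs ! r \<bullet> vs ! r \<le> B * B"
proof -
  have nn: "0 \<le> vs ! r \<bullet> vs ! r"
    unfolding scalar_prod_self[OF vs_carrier[OF assms]] by (rule sum_nonneg) simp
  then have "vs ! r \<bullet> vs ! r = vnorm (vs ! r) * vnorm (vs ! r)" by (simp add: vnorm_def)
  moreover have "0 \<le> vnorm (vs ! r)" using nn by (simp add: vnorm_def)
  ultimately show ?thesis using vs_norm[OF assms] by (simp add: mult_mono)
qed

text \<open>Here it matters that \<open>S\<close> consists of all short nonzero vectors of
  \<open>L\<close> and is not merely some generating system.\<close>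

lemma short_in_vs:
  assumes "x \<in> L" "x \<noteq> 0\<^sub>v n" "r < s" "x \<bullet> x \<le> vs ! r \<bullet> vs ! r"
  obtains m where "m < s" "x = vs ! m"
proof -
  have "vnorm x \<le> B" using assms(4) vs_norm[OF assms(3)] by (simp add: vnorm_def) (meson order_trans real_sqrt_le_iff)
  then have "x \<in> set vs" using assms set_vs by simp
  then show ?thesis using that by (auto simp: in_set_conv_nth)
qed

definition irred :: "real vec \<Rightarrow> bool" where
  "irred v \<longleftrightarrow> (\<forall>x\<in>L. \<forall>y\<in>L. x \<bullet> y = 0 \<longrightarrow> v = x + y \<longrightarrow> x = 0\<^sub>v n \<or> y = 0\<^sub>v n)"

text \<open>An orthogonal summand of a vector is shorter than the vector, so a shortest vector outside
  a proper subspace (given by the vanishing of some functionals) is irreducible.\<close>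

lemma irred_shortest:
  assumes a: "\<And>q. q \<in> Q \<Longrightarrow> a q \<in> carrier_vec n"
    and b: "b < s" "t \<in> Q" "vs ! b \<bullet> a t \<noteq> 0"
    and min: "\<And>r q. r < s \<Longrightarrow> q \<in> Q \<Longrightarrow> vs ! r \<bullet> a q \<noteq> 0 \<Longrightarrow> vs ! b \<bullet> vs ! b \<le> vs ! r \<bullet> vs ! r"
  shows "irred (vs ! b)"
  unfolding irred_def
proof (intro ballI impI)
  fix x y assume xy: "x \<in> L" "y \<in> L" "x \<bullet> y = 0" "vs ! b = x + y"
  note c = xy(1,2)[THEN L_carrier]
  have yx: "y \<bullet> x = 0" using comm_scalar_prod[OF c] xy(3) by simp
  have sq: "vs ! b \<bullet> vs ! b = x \<bullet> x + y \<bullet> y"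
    unfolding xy(4) using c xy(3) yx
    by (simp add: add_scalar_prod_distrib[of _ n] scalar_prod_add_distrib[of _ n])
  have part: "z \<bullet> a t = 0" if z: "z \<in> L" "z \<noteq> 0\<^sub>v n" "z \<bullet> z < vs ! b \<bullet> vs ! b" for z
  proof (rule ccontr)
    assume "z \<bullet> a t \<noteq> 0"
    moreover obtain m where "m < s" "z = vs ! m"
      using short_in_vs[OF z(1,2) b(1)] z(3) by auto
    ultimately show False using min[of m t] b z by auto
  qed
  have pos: "0 < z \<bullet> z" if "z \<in> L" "z \<noteq> 0\<^sub>v n" for z
  proof -
    have "0 \<le> z \<bullet> z" unfolding scalar_prod_self[OF L_carrier[OF that(1)]] by (rule sum_nonneg) simp
    then show ?thesis using scalar_prod_self_zero[OF L_carrier[OF that(1)]] that(2) by linarith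
  qed
  show "x = 0\<^sub>v n \<or> y = 0\<^sub>v n"
  proof (rule ccontr)
    assume "\<not> ?thesis"
    then have nz: "x \<noteq> 0\<^sub>v n" "y \<noteq> 0\<^sub>v n" by auto
    have "x \<bullet> a t = 0" "y \<bullet> a t = 0"
      using part[OF xy(1) nz(1)] part[OF xy(2) nz(2)] pos[OF xy(1) nz(1)] pos[OF xy(2) nz(2)] sq by auto
    then have "vs ! b \<bullet> a t = 0"
      unfolding xy(4) using c a[OF b(2)] by (simp add: add_scalar_prod_distrib[of _ n])
    then show False using b(3) by simp
  qed
qed

text \<open>The kernel of a functional is closed under integer combinations. If it contains
  \<open>S\<close> it contains \<open>L\<close>, and full rank makes the functional zero. Hence the
  greedy choice never runs out of candidates early.\<close>

lemma functional_nonzero: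
  assumes a: "a \<in> carrier_vec n" "a \<noteq> 0\<^sub>v n"
  shows "\<exists>r<s. vs ! r \<bullet> a \<noteq> 0"
proof (rule ccontr)
  assume "\<not> ?thesis"
  then have 0: "vs ! r \<bullet> a = 0" if "r < s" for r using that by blast
  let ?M = "{x \<in> carrier_vec n. x \<bullet> a = 0}"
  have "int_module n ?M"
    unfolding int_module_def using a by (auto simp: add_scalar_prod_distrib[of _ n])
  moreover have "set vs \<subseteq> ?M" using 0 vs_carrier by (auto simp: in_set_conv_nth)
  ultimately have "L \<subseteq> ?M" using int_span_least generates by metis
  then have "a = 0\<^sub>v n" by (intro full_rank_orthogonal_zero[OF full_rank a(1)]) auto
  then show False using a(2) by simp
qed

section \<open>Invariant of the greedy choice\<close>

definition loaded :: "state \<Rightarrow> bool" where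
  "loaded st \<longleftrightarrow> dm st = n \<and> cn st = s \<and> lo st 2 = B \<and>
     (\<forall>r<s. \<forall>j<n. lo st (3 + (r * n + j)) = vs ! r $ j) \<and>
     (\<forall>r<s. ar st aN r 0 = vs ! r \<bullet> vs ! r)"

text \<open>The basis reached so far in an exchange process that starts from the standard basis:
  unit vectors hold the places of the columns not yet used.\<close>

definition current :: "state \<Rightarrow> nat \<Rightarrow> real vec" where
  "current st p = (if ar st aU 0 p = 1 then vec n (ar st aW p) else unit_vec n p)"

text \<open>\<open>a\<close> is the basis dual to \<open>current\<close>. The program never stores
  it; \<open>aX\<close> contains its values on \<open>S\<close>, which are the coordinates of those
  vectors with respect to \<open>current\<close>.\<close>

definition chosen :: "nat \<Rightarrow> state \<Rightarrow> bool" where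
  "chosen k st \<longleftrightarrow> (\<exists>a. (\<forall>q<n. a q \<in> carrier_vec n) \<and>
     (\<forall>r<s. \<forall>q<n. ar st aX r q = vs ! r \<bullet> a q) \<and>
     (\<forall>p<n. ar st aU 0 p = 0 \<or> ar st aU 0 p = 1) \<and>
     card {p \<in> {..<n}. ar st aU 0 p = 1} = k \<and>
     (\<forall>p<n. ar st aU 0 p = 1 \<longrightarrow> (\<exists>r<s. vec n (ar st aW p) = vs ! r \<and> irred (vs ! r))) \<and>
     (\<forall>p<n. \<forall>q<n. current st p \<bullet> a q = (if p = q then 1 else 0)))"

lemma residual_pos_iff:
  assumes "dm st = n" "\<forall>p<n. ar st aU 0 p = 0 \<or> ar st aU 0 p = 1"
  shows "0 < residual st r \<longleftrightarrow> (\<exists>q<n. ar st aU 0 q = 0 \<and> ar st aX r q \<noteq> 0)"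
proof -
  let ?f = "\<lambda>j. (1 - ar st aU 0 j) * (ar st aX r j * ar st aX r j)"
  have nn: "0 \<le> ?f j" if "j < n" for j using assms(2) that by auto
  have "residual st r = sum ?f {..<n}" by (simp add: residual_def assms(1))
  moreover have "0 \<le> sum ?f {..<n}" by (rule sum_nonneg) (use nn in auto)
  moreover have "sum ?f {..<n} = 0 \<longleftrightarrow> (\<forall>j\<in>{..<n}. ?f j = 0)"
    by (rule sum_nonneg_eq_0_iff) (use nn in auto)
  ultimately have "0 < residual st r \<longleftrightarrow> (\<exists>q<n. ?f q \<noteq> 0)" by auto
  also have "\<dots> \<longleftrightarrow> (\<exists>q<n. ar st aU 0 q = 0 \<and> ar st aX r q \<noteq> 0)" using assms(2) by auto
  finally show ?thesis .
qed

lemma chosen_residual: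
  assumes st: "loaded st" "chosen k st" "k < n"
  shows "\<exists>r<cn st. 0 < residual st r \<and> ar st aN r 0 < lo st 2 * lo st 2 + 1"
proof -
  have lo: "dm st = n" "cn st = s" "lo st 2 = B" "\<forall>r<s. ar st aN r 0 = vs ! r \<bullet> vs ! r"
    using st by (auto simp: loaded_def)
  obtain a where a: "\<forall>q<n. a q \<in> carrier_vec n" "\<forall>r<s. \<forall>q<n. ar st aX r q = vs ! r \<bullet> a q"
    "\<forall>p<n. ar st aU 0 p = 0 \<or> ar st aU 0 p = 1" "card {p \<in> {..<n}. ar st aU 0 p = 1} = k"
    "\<forall>p<n. \<forall>q<n. current st p \<bullet> a q = (if p = q then 1 else 0)"
    using st(2) unfolding chosen_def by blast
  have "\<exists>q<n. ar st aU 0 q \<noteq> 1"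
  proof (rule ccontr)
    assume "\<not> ?thesis"
    then have e: "{p \<in> {..<n}. ar st aU 0 p = 1} = {..<n}" by blast
    show False using a(4) st(3) unfolding e by simp
  qed
  then obtain q where q: "q < n" "ar st aU 0 q = 0" using a(3) by blast
  have "current st q \<bullet> a q = 1" using a(5) q by simp
  then have "a q \<noteq> 0\<^sub>v n" using a(1) q by (auto simp: current_def)
  then obtain r where r: "r < s" "vs ! r \<bullet> a q \<noteq> 0" using functional_nonzero a(1) q by blast
  then have "0 < residual st r" using residual_pos_iff[OF lo(1) a(3)] a(2) q by auto
  then show ?thesis using r lo vs_sq_norm[OF r(1)] by auto
qed

lemma chosen_step:
  assumes st: "loaded st" "chosen k st"
    and b: "b < s" "0 < residual st b"
    and min: "\<forall>r<s. 0 < residual st r \<longrightarrow> ar st aN b 0 \<le> ar st aN r 0"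
    and p: "p < n" "0 < (1 - ar st aU 0 p) * (ar st aX b p * ar st aX b p)"
    and U: "ar st' aU 0 = (ar st aU 0)(p := 1)"
    and W: "\<forall>j<n. ar st' aW p j = lo st (3 + (b * n + j))" "\<forall>q. q \<noteq> p \<longrightarrow> ar st' aW q = ar st aW q"
    and X: "\<forall>r<s. \<forall>j<n. ar st' aX r j = (if j = p then ar st aX r p / ar st aX b p
        else ar st aX r j - ar st aX r p / ar st aX b p * ar st aX b j)"
  shows "chosen (Suc k) st'"
proof -
  have lo: "dm st = n" "\<forall>r<s. \<forall>j<n. lo st (3 + (r * n + j)) = vs ! r $ j"
    "\<forall>r<s. ar st aN r 0 = vs ! r \<bullet> vs ! r"
    using st by (auto simp: loaded_def)
  obtain a where a: "\<And>q. q < n \<Longrightarrow> a q \<in> carrier_vec n" "\<forall>r<s. \<forall>q<n. ar st aX r q = vs ! r \<bullet> a q"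
    "\<forall>p<n. ar st aU 0 p = 0 \<or> ar st aU 0 p = 1" "card {p \<in> {..<n}. ar st aU 0 p = 1} = k"
    "\<forall>p<n. ar st aU 0 p = 1 \<longrightarrow> (\<exists>r<s. vec n (ar st aW p) = vs ! r \<and> irred (vs ! r))"
    "\<And>p q. p < n \<Longrightarrow> q < n \<Longrightarrow> current st p \<bullet> a q = (if p = q then 1 else 0)"
    using st(2) unfolding chosen_def by blast
  have p0: "ar st aU 0 p = 0" "vs ! b \<bullet> a p \<noteq> 0" using p a(2,3) b by auto
  have cur: "current st q \<in> carrier_vec n" for q by (simp add: current_def)
  obtain a' where a': "\<And>q. q < n \<Longrightarrow> a' q \<in> carrier_vec n"
    "\<And>x q. x \<in> carrier_vec n \<Longrightarrow> q < n \<Longrightarrow> x \<bullet> a' q = (if q = p then x \<bullet> a p / (vs ! b \<bullet> a p)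
        else x \<bullet> a q - x \<bullet> a p / (vs ! b \<bullet> a p) * (vs ! b \<bullet> a q))"
    "\<And>u q. u < n \<Longrightarrow> q < n \<Longrightarrow> ((current st)(p := vs ! b)) u \<bullet> a' q = (if u = q then 1 else 0)"
    using pivot_dual[OF cur a(1) a(6) vs_carrier[OF b(1)] p(1) p0(2)] by blast
  have Wp: "vec n (ar st' aW p) = vs ! b"
    using W(1) lo(2) b vs_carrier[OF b(1)] by (intro eq_vecI) auto
  have cur': "current st' = (current st)(p := vs ! b)"
    using Wp W(2) U by (auto simp: current_def fun_eq_iff)
  have irr: "irred (vs ! b)"
  proof (rule irred_shortest[where Q = "{q. q < n \<and> ar st aU 0 q = 0}" and a = a and t = p])
    fix r q assume r: "r < s" "q \<in> {q. q < n \<and> ar st aU 0 q = 0}" "vs ! r \<bullet> a q \<noteq> 0"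
    then have "0 < residual st r" using residual_pos_iff[OF lo(1) a(3)] a(2) by auto
    then show "vs ! b \<bullet> vs ! b \<le> vs ! r \<bullet> vs ! r" using min r(1) lo(3) b by auto
  qed (use a b p p0 in auto)
  have "{q \<in> {..<n}. ar st' aU 0 q = 1} = insert p {q \<in> {..<n}. ar st aU 0 q = 1}"
    using p U by auto
  then have card: "card {q \<in> {..<n}. ar st' aU 0 q = 1} = Suc k" using a(4) p0 by simp
  show ?thesis
    unfolding chosen_def
  proof (intro exI[of _ a'] conjI allI impI card)
    fix r q assume rq: "r < s" "q < n"
    then show "ar st' aX r q = vs ! r \<bullet> a' q"
      using X a'(2)[OF vs_carrier[OF rq(1)] rq(2)] a(2) p b by auto
  next
    fix q assume "q < n" "ar st' aU 0 q = 1"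
    then show "\<exists>r<s. vec n (ar st' aW q) = vs ! r \<and> irred (vs ! r)"
      using a(5) Wp irr b(1) W(2) U by (cases "q = p") auto
  next
    fix q r assume "q < n" "r < n"
    then show "current st' q \<bullet> a' r = (if q = r then 1 else 0)" using a'(3) cur' by simp
  qed (use a'(1) a(3) U in auto)
qed

definition basis_chosen :: "state \<Rightarrow> (nat \<Rightarrow> real vec) \<Rightarrow> (nat \<Rightarrow> real vec) \<Rightarrow> bool" where
  "basis_chosen st w a \<longleftrightarrow> w = (\<lambda>p. vec n (ar st aW p)) \<and> (\<forall>q<n. a q \<in> carrier_vec n) \<and>
     (\<forall>r<s. \<forall>q<n. ar st aX r q = vs ! r \<bullet> a q) \<and>
     (\<forall>p<n. \<exists>r<s. w p = vs ! r \<and> irred (vs ! r)) \<and>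
     (\<forall>p<n. \<forall>q<n. w p \<bullet> a q = (if p = q then 1 else 0))"

lemma chosen_all:
  assumes "chosen n st"
  shows "\<exists>w a. basis_chosen st w a"
proof -
  obtain a where a: "\<forall>q<n. a q \<in> carrier_vec n" "\<forall>r<s. \<forall>q<n. ar st aX r q = vs ! r \<bullet> a q"
    "card {p \<in> {..<n}. ar st aU 0 p = 1} = n"
    "\<forall>p<n. ar st aU 0 p = 1 \<longrightarrow> (\<exists>r<s. vec n (ar st aW p) = vs ! r \<and> irred (vs ! r))"
    "\<forall>p<n. \<forall>q<n. current st p \<bullet> a q = (if p = q then 1 else 0)"
    using assms unfolding chosen_def by blast
  have "{p \<in> {..<n}. ar st aU 0 p = 1} = {..<n}"
    using a(3) by (intro card_subset_eq) auto
  then have U: "ar st aU 0 p = 1" if "p < n" for p using that by auto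
  show ?thesis
    unfolding basis_chosen_def using a U
    by (intro exI[of _ "\<lambda>p. vec n (ar st aW p)"] exI[of _ a]) (simp add: current_def)
qed

end

definition choose_prog :: rcom where
  "choose_prog = row_loop rJ aU (IC 0) (VN 0) ;;
     loop rK IDim (select_prog ;; pivot_prog ;; exchange_prog)"

lemma (in lattice_input) run_choose_prog:
  assumes st: "loaded st" "\<forall>r<s. \<forall>j<n. ar st aX r j = vs ! r $ j"
  shows "run \<kappa> choose_prog st (10000 * (s + 1) * (n + 1) * (n + 1)) (\<lambda>st'.
     frame {rR, rJ, rB, rP, rK} {aU, aM, aD, aW, aA, aX} st st' \<and> (\<exists>w a. basis_chosen st' w a))"
    (is "run _ _ _ _ ?Q")
proof -
  have lo: "dm st = n" "cn st = s" using st by (auto simp: loaded_def)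
  let ?R = "{rR, rJ, rB, rP, rK}" and ?A = "{aU, aM, aD, aW, aA, aX}"
  define I where "I = (\<lambda>k st'. frame ?R ?A st st' \<and> chosen k st')"
  let ?st1 = "set_ix rJ n (set_row aU 0 (\<lambda>j. if j < n then 0 else ar st aU 0 j) st)"
  have loop: "run \<kappa> (loop rK IDim (select_prog ;; pivot_prog ;; exchange_prog)) ?st1
      (n * ((3000 * (s + 1) * (n + 1) + (600 * (n + 1) + 2000 * (s + 1) * (n + 1))) + icost IDim + 60)
        + icost IDim + 40) ?Q"
  proof (rule run_loop[where I = I])
    \<comment> \<open>Before any choice the standard basis is its own dual, and \<open>aX\<close>
      holds the plain coordinates.\<close>
    have "chosen 0 (set_ix rK 0 ?st1)"
      unfolding chosen_def
      by (rule exI[of _ "unit_vec n"]) (use st in \<open>auto simp: current_def vs_carrier scalar_prod_right_unit[of _ n]\<close>)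
    then show "I 0 (set_ix rK 0 ?st1)" by (simp add: I_def frame_def)
  next
    fix k st' assume k: "k < n" "I k st'" "ix st' rK = k"
    then have ch: "chosen k st'" and fr: "frame ?R ?A st st'" by (auto simp: I_def)
    have lo': "dm st' = n" "cn st' = s" "loaded st'"
      using st fr by (auto simp: loaded_def frame_def)
    show "run \<kappa> (select_prog ;; pivot_prog ;; exchange_prog) st'
      (3000 * (s + 1) * (n + 1) + (600 * (n + 1) + 2000 * (s + 1) * (n + 1)))
      (\<lambda>st''. ix st'' rK = k \<and> I (Suc k) (set_ix rK (Suc k) st''))"
    proof (rule run_Seq, rule run_post)
      show "run \<kappa> select_prog st' (3000 * (s + 1) * (n + 1)) (\<lambda>st''.
         frame {rR, rJ, rB} {aD, aM} st' st'' \<and> ix st'' rB < cn st' \<and> 0 < residual st' (ix st'' rB) \<and>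
         (\<forall>r<cn st'. 0 < residual st' r \<longrightarrow> ar st' aN (ix st'' rB) 0 \<le> ar st' aN r 0))"
        using run_select_prog[OF chosen_residual[OF lo'(3) ch k(1)], of \<kappa>] by (simp add: lo')
      fix st2 assume 2: "frame {rR, rJ, rB} {aD, aM} st' st2 \<and> ix st2 rB < cn st' \<and> 0 < residual st' (ix st2 rB) \<and>
         (\<forall>r<cn st'. 0 < residual st' r \<longrightarrow> ar st' aN (ix st2 rB) 0 \<le> ar st' aN r 0)"
      have e2: "dm st2 = n" "cn st2 = s" "lo st2 = lo st'" "ar st2 aU = ar st' aU" "ar st2 aX = ar st' aX"
        "ar st2 aN = ar st' aN" "ar st2 aW = ar st' aW" "ix st2 rK = k"
        using 2 lo' k by (auto simp: frame_def)
      have res2: "residual st2 = residual st'" by (simp add: residual_def fun_eq_iff e2 lo')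
      show "run \<kappa> (pivot_prog ;; exchange_prog) st2 (600 * (n + 1) + 2000 * (s + 1) * (n + 1))
         (\<lambda>st''. ix st'' rK = k \<and> I (Suc k) (set_ix rK (Suc k) st''))"
      proof (rule run_Seq, rule run_post)
        show "run \<kappa> pivot_prog st2 (600 * (n + 1)) (\<lambda>st''. frame {rJ, rP} {} st2 st'' \<and>
           ix st'' rP < dm st2 \<and>
           0 < (1 - ar st2 aU 0 (ix st'' rP)) * (ar st2 aX (ix st2 rB) (ix st'' rP) * ar st2 aX (ix st2 rB) (ix st'' rP)))"
          using run_pivot_prog[of st2 \<kappa>] 2 by (simp add: res2 e2)
        fix st3 assume 3: "frame {rJ, rP} {} st2 st3 \<and> ix st3 rP < dm st2 \<and>
           0 < (1 - ar st2 aU 0 (ix st3 rP)) * (ar st2 aX (ix st2 rB) (ix st3 rP) * ar st2 aX (ix st2 rB) (ix st3 rP))"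
        define b p where "b = ix st2 rB" and "p = ix st3 rP"
        have e3: "dm st3 = n" "cn st3 = s" "lo st3 = lo st'" "ar st3 = ar st2" "ix st3 rK = k" "ix st3 rB = b"
          using 3 e2 by (auto simp: frame_def b_def fun_eq_iff)
        have bp: "b < s" "p < n" using 2 3 lo' e2 by (auto simp: b_def p_def)
        show "run \<kappa> exchange_prog st3 (2000 * (s + 1) * (n + 1))
          (\<lambda>st''. ix st'' rK = k \<and> I (Suc k) (set_ix rK (Suc k) st''))"
        proof (rule run_post)
          show "run \<kappa> exchange_prog st3 (2000 * (s + 1) * (n + 1)) (\<lambda>st4.
             frame {rJ, rR} {aU, aW, aA, aD, aX} st3 st4 \<and>
             ar st4 aU 0 = (ar st3 aU 0)(p := 1) \<and>
             (\<forall>j<dm st3. ar st4 aW p j = lo st3 (3 + (b * dm st3 + j))) \<and>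
             (\<forall>q. q \<noteq> p \<longrightarrow> ar st4 aW q = ar st3 aW q) \<and>
             (\<forall>r<cn st3. \<forall>j<dm st3. ar st4 aX r j = (if j = p then ar st3 aX r p / ar st3 aX b p
                else ar st3 aX r j - ar st3 aX r p / ar st3 aX b p * ar st3 aX b j)))"
            using run_exchange_prog[of st3 b p \<kappa>] bp e3 by (simp add: p_def)
          fix st4 assume 4: "frame {rJ, rR} {aU, aW, aA, aD, aX} st3 st4 \<and>
             ar st4 aU 0 = (ar st3 aU 0)(p := 1) \<and>
             (\<forall>j<dm st3. ar st4 aW p j = lo st3 (3 + (b * dm st3 + j))) \<and>
             (\<forall>q. q \<noteq> p \<longrightarrow> ar st4 aW q = ar st3 aW q) \<and>
             (\<forall>r<cn st3. \<forall>j<dm st3. ar st4 aX r j = (if j = p then ar st3 aX r p / ar st3 aX b p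
                else ar st3 aX r j - ar st3 aX r p / ar st3 aX b p * ar st3 aX b j))"
          have "chosen (Suc k) (set_ix rK (Suc k) st4)"
            by (rule chosen_step[OF lo'(3) ch bp(1) _ _ bp(2)])
              (use 2 3 4 e2 e3 lo' in \<open>simp_all add: b_def p_def\<close>)
          moreover have "frame ?R ?A st (set_ix rK (Suc k) st4)"
          proof -
            have "frame ?R ?A st st2" by (rule frame_trans[OF fr conjunct1[OF 2]]) auto
            then have "frame ?R ?A st st3" by (rule frame_trans[OF _ conjunct1[OF 3]]) auto
            then have "frame ?R ?A st st4" by (rule frame_trans[OF _ conjunct1[OF 4]]) auto
            then show ?thesis by (simp add: frame_def)
          qed
          moreover have "ix st4 rK = k" using 4 e3 by (simp add: frame_def)
          ultimately show "ix st4 rK = k \<and> I (Suc k) (set_ix rK (Suc k) st4)" by (simp add: I_def)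
        qed
      qed
    qed
  next
    fix st' assume "I n st'"
    then show "?Q st'" using chosen_all by (simp add: I_def)
  qed (use lo in \<open>auto simp: I_def frame_def\<close>)
  show ?thesis
    unfolding choose_prog_def
    apply (rule run_cost)
     apply (rule run_Seq)
     apply (rule run_row_loop[where i = 0 and V = "\<lambda>_. 0"])
        apply simp_all[2]
      apply (use loop lo in \<open>simp cong: if_cong\<close>)
     apply simp
    apply (simp add: ccost_def algebra_simps lo)
    done
qed

section \<open>Inserting vectors into a triangular basis\<close>

definition lat :: "nat \<Rightarrow> (nat \<Rightarrow> nat \<Rightarrow> real) \<Rightarrow> (nat \<Rightarrow> real) \<Rightarrow> bool" where
  "lat n H x \<longleftrightarrow> (\<exists>c :: nat \<Rightarrow> int. \<forall>j<n. x j = (\<Sum>i<n. of_int (c i) * H i j))"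

text \<open>The row lattice of \<open>H\<close> enlarged by a pending row \<open>y\<close>.
  Euclidean operations lose none of its members, and once \<open>y\<close> is zero it is the row
  lattice itself. Only the first n entries count, as rows in memory are infinite.\<close>

definition gen :: "nat \<Rightarrow> (nat \<Rightarrow> nat \<Rightarrow> real) \<Rightarrow> (nat \<Rightarrow> real) \<Rightarrow> (nat \<Rightarrow> real) \<Rightarrow> bool" where
  "gen n H y x \<longleftrightarrow> (\<exists>(c :: nat \<Rightarrow> int) (d :: int).
     \<forall>j<n. x j = (\<Sum>i<n. of_int (c i) * H i j) + of_int d * y j)"

lemma sum_fun_upd:
  fixes c :: "nat \<Rightarrow> int" and h :: "nat \<Rightarrow> real"
  assumes "i < n"
  shows "(\<Sum>k<n. of_int ((c(i := e)) k) * h k) = (\<Sum>k<n. of_int (c k) * h k) + of_int (e - c i) * h i"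
proof -
  have "(\<Sum>k<n. of_int ((c(i := e)) k) * h k)
      = (\<Sum>k<n. of_int (c k) * h k + (if k = i then of_int (e - c i) * h i else 0))"
    by (rule sum.cong) (auto simp: algebra_simps)
  then show ?thesis using assms by (simp add: sum.distrib)
qed

lemma gen_self: "gen n H y y"
  unfolding gen_def by (rule exI[of _ "\<lambda>_. 0"], rule exI[of _ 1]) simp

lemma lat_gen:
  assumes "lat n H x"
  shows "gen n H y x"
proof -
  obtain c :: "nat \<Rightarrow> int" where "\<forall>j<n. x j = (\<Sum>i<n. of_int (c i) * H i j)"
    using assms unfolding lat_def by blast
  then show ?thesis unfolding gen_def by (intro exI[of _ c] exI[of _ 0]) simp
qed

lemma gen_lat:
  assumes "gen n H y x" "\<forall>j<n. y j = 0"
  shows "lat n H x"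
proof -
  obtain c :: "nat \<Rightarrow> int" and d :: int
    where "\<forall>j<n. x j = (\<Sum>i<n. of_int (c i) * H i j) + of_int d * y j"
    using assms(1) unfolding gen_def by blast
  then show ?thesis using assms(2) unfolding lat_def by (intro exI[of _ c]) simp
qed

lemma gen_subtract:
  assumes "gen n H y x" "i < n" "\<And>j. j < n \<Longrightarrow> y' j = y j - of_int q * H i j"
  shows "gen n H y' x"
proof -
  obtain c :: "nat \<Rightarrow> int" and d :: int
    where x: "\<forall>j<n. x j = (\<Sum>i<n. of_int (c i) * H i j) + of_int d * y j"
    using assms(1) unfolding gen_def by blast
  have "x j = (\<Sum>k<n. of_int ((c(i := c i + d * q)) k) * H k j) + of_int d * y' j" if "j < n" for j
  proof -
    have "of_int d * y j = of_int d * y' j + of_int (d * q) * H i j"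
      unfolding assms(3)[OF that] by (simp add: algebra_simps)
    then show ?thesis
      using x that sum_fun_upd[OF assms(2), of c "c i + d * q" "\<lambda>k. H k j"] by simp
  qed
  then show ?thesis unfolding gen_def by blast
qed

lemma gen_swap:
  assumes "gen n H y x" "i < n" "\<And>j. j < n \<Longrightarrow> H' i j = y j" "\<And>j. j < n \<Longrightarrow> y' j = H i j"
    "\<And>k. k \<noteq> i \<Longrightarrow> H' k = H k"
  shows "gen n H' y' x"
proof -
  obtain c :: "nat \<Rightarrow> int" and d :: int
    where x: "\<forall>j<n. x j = (\<Sum>i<n. of_int (c i) * H i j) + of_int d * y j"
    using assms(1) unfolding gen_def by blast
  have "x j = (\<Sum>k<n. of_int ((c(i := d)) k) * H' k j) + of_int (c i) * y' j" if j: "j < n" for j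
  proof -
    have "(\<Sum>k<n. of_int ((c(i := d)) k) * H' k j)
       = (\<Sum>k<n. of_int (c k) * H k j + (if k = i then of_int d * y j - of_int (c i) * H i j else 0))"
      using assms(3)[OF j] assms(5) by (intro sum.cong) auto
    also have "\<dots> = (\<Sum>k<n. of_int (c k) * H k j) + (of_int d * y j - of_int (c i) * H i j)"
      using assms(2) by (simp add: sum.distrib)
    finally show ?thesis using x j assms(4)[OF j] by simp
  qed
  then show ?thesis unfolding gen_def by blast
qed

text \<open>The half-open interval serves the reduction above the diagonal, the bound on the
  absolute value serves the halving of pivots.\<close>

lemma round_remainder:
  fixes x h :: real
  assumes "h \<noteq> 0"
  shows "- 1 / 2 \<le> (x - of_int \<lfloor>x / h + 1 / 2\<rfloor> * h) / h"
    and "(x - of_int \<lfloor>x / h + 1 / 2\<rfloor> * h) / h < 1 / 2"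
    and "\<bar>x - of_int \<lfloor>x / h + 1 / 2\<rfloor> * h\<bar> \<le> \<bar>h\<bar> / 2"
proof -
  let ?r = "x - of_int \<lfloor>x / h + 1 / 2\<rfloor> * h"
  have e: "?r / h = x / h - of_int \<lfloor>x / h + 1 / 2\<rfloor>" using assms by (simp add: diff_divide_distrib)
  show 1: "- 1 / 2 \<le> ?r / h" and 2: "?r / h < 1 / 2" unfolding e by linarith+
  have "\<bar>?r / h\<bar> \<le> 1 / 2" using 1 2 by linarith
  then show "\<bar>?r\<bar> \<le> \<bar>h\<bar> / 2" using assms by (simp add: abs_divide divide_le_eq)
qed

lemma run_ifless_true:
  assumes "vval e st < vval f st" "run \<kappa> c st T Q"
  shows "run \<kappa> (ifless e f c d) st (vcost e + vcost f + 1 + T) Q"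
  using run_ifless[of e st f \<kappa> c T Q d 0] assms by simp

lemma run_ifless_false:
  assumes "\<not> vval e st < vval f st" "run \<kappa> d st T Q"
  shows "run \<kappa> (ifless e f c d) st (vcost e + vcost f + 1 + T) Q"
  using run_ifless[of e st f \<kappa> c 0 Q d T] assms by simp

lemma run_row_loop_eq:
  assumes "\<And>k r. ival e (set_ix x k (set_row a i r st)) = i"
    and "\<And>k. k < dm st \<Longrightarrow>
      vval v (set_ix x k (set_row a i (\<lambda>j. if j < k then V j else ar st a i j) st)) = V k"
    and "st' = set_ix x (dm st) (set_row a i (\<lambda>j. if j < dm st then V j else ar st a i j) st)"
    and "Q st'" "x \<noteq> rC"
  shows "run \<kappa> (row_loop x a e v) st (dm st * (ccost e (IR x) + vcost v + 63) + 42) Q"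
  using assms(1,2,4,5) unfolding assms(3) by (rule run_row_loop)

definition identity_prog :: rcom where
  "identity_prog = loop rI IDim (row_loop rJ aH (IR rI) (VN 0) ;; vset aH (IR rI) (IR rI) (VN 1))"

lemma run_identity_prog:
  "run \<kappa> identity_prog st (1000 * (dm st + 1) * (dm st + 1)) (\<lambda>st'. frame {rI, rJ} {aH} st st' \<and>
     (\<forall>i<dm st. \<forall>j<dm st. ar st' aH i j = (if i = j then 1 else 0)))" (is "run _ _ _ _ ?Q")
proof -
  define I where "I = (\<lambda>k st'. frame {rI, rJ} {aH} st st' \<and>
     (\<forall>i<k. \<forall>j<dm st. ar st' aH i j = (if i = j then 1 else 0)))"
  have "run \<kappa> identity_prog st (dm st * (800 * (dm st + 1) + icost IDim + 60) + icost IDim + 40) ?Q"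
    unfolding identity_prog_def
  proof (rule run_loop[where I = I])
    fix k st' assume k: "k < dm st" "I k st'" "ix st' rI = k"
    have fr: "dm st' = dm st" using k by (auto simp: I_def frame_def)
    let ?st1 = "set_ix rJ (dm st) (set_row aH k (\<lambda>j. if j < dm st then 0 else ar st' aH k j) st')"
    have I1: "I (Suc k) (set_ix rI (Suc k) (set_ar aH k k 1 ?st1))"
      using k fr unfolding I_def frame_def by (auto simp: less_Suc_eq)
    show "run \<kappa> (row_loop rJ aH (IR rI) (VN 0) ;; vset aH (IR rI) (IR rI) (VN 1)) st'
       (800 * (dm st + 1)) (\<lambda>st''. ix st'' rI = k \<and> I (Suc k) (set_ix rI (Suc k) st''))"
      apply (rule run_cost, rule run_Seq)
       apply (rule run_row_loop[where i = k and V = "\<lambda>_. 0"])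
          apply (use k fr in simp_all)[2]
        apply (rule run_vset)
        apply (use k fr I1 in \<open>simp cong: if_cong\<close>)
       apply simp
      apply (simp add: ccost_def fr)
      done
  qed (auto simp: I_def frame_def)
  then show ?thesis by (rule run_cost) (simp add: algebra_simps)
qed

text \<open>Only a round with nonzero remainder swaps rows and advances \<open>rC\<close>. A round
  with remainder 0 ends the loop, so there is at most one of them per call and it needs no
  counting.\<close>

definition euclid_body :: rcom where
  "euclid_body =
     vset aD (IC 0) (IC 0)
       (VFloor (VAdd (VDiv (VA aA (IC 0) (IR rI)) (VA aH (IR rI) (IR rI))) (VDiv (VN 1) (VN 2)))) ;;
     row_loop rJ aA (IC 0)
       (VSub (VA aA (IC 0) (IR rJ)) (VMul (VA aD (IC 0) (IC 0)) (VA aH (IR rI) (IR rJ)))) ;;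
     ifless (VN 0) (VMul (VA aA (IC 0) (IR rI)) (VA aA (IC 0) (IR rI)))
       (iset rC (IAdd (IR rC) (IC 1)) ;;
        row_loop rJ aM (IC 0) (VA aA (IC 0) (IR rJ)) ;;
        row_loop rJ aA (IC 0) (VA aH (IR rI) (IR rJ)) ;;
        row_loop rJ aH (IR rI) (VA aM (IC 0) (IR rJ)))
       Skip"

text \<open>\<open>y\<close> is the remainder row. The two cases are kept apart because only the
  second one can be charged to the counter.\<close>

lemma run_euclid_body:
  assumes i: "ix st rI = i" "i < dm st"
    and y: "\<And>j. y j = ar st aA 0 j - of_int \<lfloor>ar st aA 0 i / ar st aH i i + 1 / 2\<rfloor> * ar st aH i j"
  shows "y i = 0 \<Longrightarrow> run \<kappa> euclid_body st (3000 * (dm st + 1))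
      (\<lambda>st'. frame {rJ, rC} {aD, aA, aM, aH} st st' \<and> ix st' rC = ix st rC \<and> ar st' aH = ar st aH \<and>
        (\<forall>j<dm st. ar st' aA 0 j = y j))" (is "_ \<Longrightarrow> run _ _ _ _ ?Q1")
    and "y i \<noteq> 0 \<Longrightarrow> run \<kappa> euclid_body st (3000 * (dm st + 1))
      (\<lambda>st'. frame {rJ, rC} {aD, aA, aM, aH} st st' \<and> ix st' rC = Suc (ix st rC) \<and>
        (\<forall>j<dm st. ar st' aA 0 j = ar st aH i j) \<and> (\<forall>j<dm st. ar st' aH i j = y j) \<and>
        (\<forall>k. k \<noteq> i \<longrightarrow> ar st' aH k = ar st aH k))" (is "_ \<Longrightarrow> run _ _ _ _ ?Q2")
proof -
  let ?n = "dm st" and ?q = "\<lfloor>ar st aA 0 i / ar st aH i i + 1 / 2\<rfloor>"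
  let ?st1 = "set_ix rJ ?n (set_row aA 0 (\<lambda>j. if j < ?n then y j else ar st aA 0 j)
     (set_ar aD 0 0 (of_int ?q) st))"
  let ?st2 = "set_ix rJ ?n (set_row aM 0 (\<lambda>j. if j < ?n then y j else ar st aM 0 j)
     (set_ix rC (ix st rC + 1) ?st1))"
  let ?st3 = "set_ix rJ ?n (set_row aA 0 (\<lambda>j. if j < ?n then ar st aH i j else ar ?st2 aA 0 j) ?st2)"
  let ?st4 = "set_ix rJ ?n (set_row aH i (\<lambda>j. if j < ?n then y j else ar st aH i j) ?st3)"
  have stop: "run \<kappa> euclid_body st (3000 * (?n + 1)) ?Q1" if "y i = 0"
    unfolding euclid_body_def
    apply (rule run_cost, rule run_Seq, rule run_vset, rule run_Seq)
     apply (rule run_row_loop[where i = 0 and V = y])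
        apply (use i y in simp_all)[2]
      apply (rule run_ifless_false)
       apply (use i that in simp)
      apply (rule run_Skip)
      apply (use i that in \<open>simp add: frame_def cong: if_cong\<close>)
     apply simp
    apply (simp add: ccost_def)
    done
  have pos: "0 < y i * y i" if "y i \<noteq> 0"
    using that by (metis not_square_less_zero linorder_cases mult_eq_0_iff)
  have swap: "run \<kappa> euclid_body st (3000 * (?n + 1)) ?Q2" if "y i \<noteq> 0"
  proof -
    define st0 where "st0 = set_ar aD 0 0 (of_int ?q) st"
    define st1 where "st1 = set_ix rJ (dm st0) (set_row aA 0 (\<lambda>j. if j < dm st0 then y j else ar st0 aA 0 j) st0)"
    define st2 where "st2 = set_ix rC (ix st1 rC + 1) st1"
    define st3 where "st3 = set_ix rJ (dm st2) (set_row aM 0 (\<lambda>j. if j < dm st2 then y j else ar st2 aM 0 j) st2)"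
    define st4 where "st4 = set_ix rJ (dm st3)
       (set_row aA 0 (\<lambda>j. if j < dm st3 then ar st aH i j else ar st3 aA 0 j) st3)"
    define st5 where "st5 = set_ix rJ (dm st4) (set_row aH i (\<lambda>j. if j < dm st4 then y j else ar st4 aH i j) st4)"
    have 0: "dm st0 = ?n" "ix st0 rI = i" "ar st0 aH = ar st aH" "ar st0 aA = ar st aA"
      "ar st0 aD 0 0 = of_int ?q" "ix st0 rC = ix st rC" "frame {rJ, rC} {aD, aA, aM, aH} st st0"
      using i by (simp_all add: st0_def frame_def)
    have 1: "dm st1 = ?n" "ix st1 rI = i" "ar st1 aH = ar st aH" "\<And>j. j < ?n \<Longrightarrow> ar st1 aA 0 j = y j"
      "ix st1 rC = ix st rC" "frame {rJ, rC} {aD, aA, aM, aH} st st1"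
      using 0 by (simp_all add: st1_def frame_def)
    have 2: "dm st2 = ?n" "ix st2 rI = i" "ar st2 aH = ar st aH" "\<And>j. j < ?n \<Longrightarrow> ar st2 aA 0 j = y j"
      "ix st2 rC = Suc (ix st rC)" "frame {rJ, rC} {aD, aA, aM, aH} st st2"
      using 1 by (simp_all add: st2_def frame_def)
    have 3: "dm st3 = ?n" "ix st3 rI = i" "ar st3 aH = ar st aH" "\<And>j. j < ?n \<Longrightarrow> ar st3 aM 0 j = y j"
      "ix st3 rC = Suc (ix st rC)" "frame {rJ, rC} {aD, aA, aM, aH} st st3"
      using 2 by (simp_all add: st3_def frame_def)
    have 4: "dm st4 = ?n" "ix st4 rI = i" "ar st4 aH = ar st aH" "\<And>j. j < ?n \<Longrightarrow> ar st4 aM 0 j = y j"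
      "\<And>j. j < ?n \<Longrightarrow> ar st4 aA 0 j = ar st aH i j"
      "ix st4 rC = Suc (ix st rC)" "frame {rJ, rC} {aD, aA, aM, aH} st st4"
      using 3 by (simp_all add: st4_def frame_def)
    have 5: "?Q2 st5"
      using 4 by (simp add: st5_def frame_def)
    have r5: "run \<kappa> (row_loop rJ aH (IR rI) (VA aM (IC 0) (IR rJ))) st4 (300 * (?n + 1)) ?Q2"
      by (rule run_cost, rule run_row_loop_eq[OF _ _ st5_def])
        (use 4 5 in \<open>simp_all add: ccost_def, linarith?\<close>)
    have r4: "run \<kappa> (row_loop rJ aA (IC 0) (VA aH (IR rI) (IR rJ)) ;;
        row_loop rJ aH (IR rI) (VA aM (IC 0) (IR rJ))) st3 (600 * (?n + 1)) ?Q2"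
      by (rule run_cost, rule run_Seq,
          rule run_row_loop_eq[OF _ _ st4_def])
        (use 3 r5 in \<open>simp_all add: ccost_def, linarith?\<close>)
    have r3: "run \<kappa> (row_loop rJ aM (IC 0) (VA aA (IC 0) (IR rJ)) ;;
        row_loop rJ aA (IC 0) (VA aH (IR rI) (IR rJ)) ;;
        row_loop rJ aH (IR rI) (VA aM (IC 0) (IR rJ))) st2 (900 * (?n + 1)) ?Q2"
      by (rule run_cost, rule run_Seq, rule run_row_loop_eq[OF _ _ st3_def])
        (use 2 r4 in \<open>simp_all add: ccost_def, linarith?\<close>)
    have r2: "run \<kappa> (iset rC (IAdd (IR rC) (IC 1)) ;; row_loop rJ aM (IC 0) (VA aA (IC 0) (IR rJ)) ;;
        row_loop rJ aA (IC 0) (VA aH (IR rI) (IR rJ)) ;;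
        row_loop rJ aH (IR rI) (VA aM (IC 0) (IR rJ))) st1 (1000 * (?n + 1)) ?Q2"
      by (rule run_cost, rule run_Seq, rule run_count, rule r3[unfolded st2_def]) simp
    have r1: "run \<kappa> (ifless (VN 0) (VMul (VA aA (IC 0) (IR rI)) (VA aA (IC 0) (IR rI)))
       (iset rC (IAdd (IR rC) (IC 1)) ;; row_loop rJ aM (IC 0) (VA aA (IC 0) (IR rJ)) ;;
        row_loop rJ aA (IC 0) (VA aH (IR rI) (IR rJ)) ;;
        row_loop rJ aH (IR rI) (VA aM (IC 0) (IR rJ))) Skip) st1 (1400 * (?n + 1)) ?Q2"
      by (rule run_cost, rule run_ifless_true[OF _ r2])
        (use 1 i pos[OF that] in \<open>simp_all add: ccost_def, linarith?\<close>)
    have r0: "run \<kappa> (row_loop rJ aA (IC 0)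
         (VSub (VA aA (IC 0) (IR rJ)) (VMul (VA aD (IC 0) (IC 0)) (VA aH (IR rI) (IR rJ)))) ;;
       ifless (VN 0) (VMul (VA aA (IC 0) (IR rI)) (VA aA (IC 0) (IR rI)))
       (iset rC (IAdd (IR rC) (IC 1)) ;; row_loop rJ aM (IC 0) (VA aA (IC 0) (IR rJ)) ;;
        row_loop rJ aA (IC 0) (VA aH (IR rI) (IR rJ)) ;;
        row_loop rJ aH (IR rI) (VA aM (IC 0) (IR rJ))) Skip) st0 (1900 * (?n + 1)) ?Q2"
      by (rule run_cost, rule run_Seq, rule run_row_loop_eq[OF _ _ st1_def])
        (use 0 y r1 in \<open>simp_all add: ccost_def, linarith?\<close>)
    have eq0: "st0 = set_ar aD (ival (IC 0) st) (ival (IC 0) st)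
        (vval (VFloor (VAdd (VDiv (VA aA (IC 0) (IR rI)) (VA aH (IR rI) (IR rI))) (VDiv (VN 1) (VN 2)))) st) st"
      using i by (simp add: st0_def)
    show ?thesis
      unfolding euclid_body_def
      by (rule run_cost, rule run_Seq, rule run_vset, rule r0[unfolded eq0]) (simp add: ccost_def)
  qed
  show "y i = 0 \<Longrightarrow> run \<kappa> euclid_body st (3000 * (?n + 1)) ?Q1" by (rule stop)
  show "y i \<noteq> 0 \<Longrightarrow> run \<kappa> euclid_body st (3000 * (?n + 1)) ?Q2" by (rule swap)
qed

text \<open>The body is run with 0 in place of \<open>\<kappa>\<close>, so \<open>T1\<close> bounds
  its actual cost. The advance of \<open>rC\<close> releases \<open>\<kappa>\<close>, which is
  enough for the test and the body. Rounds of this kind leave \<open>T2\<close> unchanged, however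
  many there are.\<close>

lemma run_while_pay:
  assumes "vval e st < vval f st"
    and "run 0 c st T1 (\<lambda>st'. ix st' rC = Suc (ix st rC) \<and> run \<kappa> (whileless e f c) st' T2 Q)"
    and "vcost e + vcost f + 1 + T1 \<le> \<kappa>"
  shows "run \<kappa> (whileless e f c) st T2 Q"
  unfolding run_def
proof (intro allI impI)
  fix \<sigma> assume r: "rep \<sigma> st"
  obtain t1 \<sigma>1 st1 where 1: "exec c \<sigma> t1 \<sigma>1" "rep \<sigma>1 st1" "t1 \<le> T1"
      "ix st1 rC = Suc (ix st rC)" "run \<kappa> (whileless e f c) st1 T2 Q"
    using assms(2) r unfolding run_def[of 0] by auto
  obtain t2 \<sigma>2 st2 where 2: "exec (whileless e f c) \<sigma>1 t2 \<sigma>2" "rep \<sigma>2 st2"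
      "t2 + \<kappa> * ix st1 rC \<le> T2 + \<kappa> * ix st2 rC" "Q st2"
    using 1(2,5) unfolding run_def by blast
  have "exec (whileless e f c) \<sigma> (vcost e + vcost f + 1 + t1 + t2) \<sigma>2"
    using exec_WhileTrue[of "vcomp e" \<sigma> "vcomp f" c t1 \<sigma>1 t2 \<sigma>2] assms(1) r 1 2
    by (simp add: whileless_def vcost_def reval_vcomp)
  moreover have "vcost e + vcost f + 1 + t1 + t2 + \<kappa> * ix st rC \<le> T2 + \<kappa> * ix st2 rC"
    using 1(3,4) 2(3) assms(3) by simp
  ultimately show "\<exists>t \<sigma>' st'. exec (whileless e f c) \<sigma> t \<sigma>' \<and> rep \<sigma>' st' \<and>
      t + \<kappa> * ix st rC \<le> T2 + \<kappa> * ix st' rC \<and> Q st'"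
    using 2(2,4) by blast
qed

section \<open>Triangular bases in coordinates and the number of exchanges\<close>

locale lattice_coords = lattice_input +
  fixes w a :: "nat \<Rightarrow> real vec"
  assumes a_carrier: "\<And>q. q < n \<Longrightarrow> a q \<in> carrier_vec n"
    and w_vs: "\<And>p. p < n \<Longrightarrow> \<exists>r<s. w p = vs ! r \<and> irred (vs ! r)"
    and w_dual: "\<And>p q. p < n \<Longrightarrow> q < n \<Longrightarrow> w p \<bullet> a q = (if p = q then 1 else 0)"
begin

lemma w_L: "p < n \<Longrightarrow> w p \<in> L" and w_norm: "p < n \<Longrightarrow> vnorm (w p) \<le> B"
  and w_irred: "p < n \<Longrightarrow> irred (w p)"
  using w_vs[of p] vs_L vs_norm by auto

lemma w_carrier: "p < n \<Longrightarrow> w p \<in> carrier_vec n"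
  using w_L L_carrier by blast

text \<open>Rows are coordinate vectors with respect to \<open>w\<close>, in general not integral.
  The last condition only places them inside \<open>L\<close>; that they generate \<open>L\<close>
  is read off from \<open>lat\<close> in \<open>rows_span\<close>.\<close>

definition good :: "(nat \<Rightarrow> nat \<Rightarrow> real) \<Rightarrow> bool" where
  "good H \<longleftrightarrow> (\<forall>i<n. \<forall>j<i. H i j = 0) \<and> (\<forall>i<n. H i i \<noteq> 0) \<and>
     (\<forall>i<n. comb n {..<n} (H i) w \<in> L)"

definition (in lattice_input) covol_bound :: real where
  "covol_bound = fact n * B ^ n"

lemma good_prod:
  assumes "good H"
  shows "1 \<le> (\<Prod>i<n. \<bar>H i i\<bar>) * covol_bound"
  unfolding covol_bound_def
  by (rule triangular_prod_ge[where L = L and w = w and a = a])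
    (use assms w_carrier a_carrier w_dual L_int w_norm in \<open>auto simp: good_def\<close>)

text \<open>The product of the diagonal is the inverse of the index of the lattice of the
  \<open>w p\<close> in the lattice of the rows, and \<open>rC\<close> counts its halvings.
  \<open>G\<close> marks the coordinate rows that must stay expressible; \<open>k\<close> is the
  number of cleared columns in the pending row.\<close>

definition euclid_inv :: "((nat \<Rightarrow> real) \<Rightarrow> bool) \<Rightarrow> nat \<Rightarrow> state \<Rightarrow> bool" where
  "euclid_inv G k st \<longleftrightarrow> good (ar st aH) \<and> 2 ^ ix st rC * (\<Prod>i<n. \<bar>ar st aH i i\<bar>) \<le> 1 \<and>
     (\<forall>j<k. j < n \<longrightarrow> ar st aA 0 j = 0) \<and> comb n {..<n} (ar st aA 0) w \<in> L \<and>
     (\<forall>x. G x \<longrightarrow> gen n (ar st aH) (ar st aA 0) x)"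

text \<open>The diagonal product is at most \<open>1 / 2 ^ c\<close> by assumption and at least
  \<open>1 / covol_bound\<close> by \<open>good_prod\<close>.\<close>

lemma exchange_count:
  assumes "good H" "2 ^ c * (\<Prod>i<n. \<bar>H i i\<bar>) \<le> 1"
  shows "2 ^ c \<le> covol_bound"
proof -
  have nn: "0 \<le> (\<Prod>i<n. \<bar>H i i\<bar>)" by (rule prod_nonneg) simp
  \<comment> \<open>As \<open>B\<close> carries no sign condition, the sign is derived from
    \<open>good_prod\<close>.\<close>
  have b: "0 \<le> covol_bound"
  proof (rule ccontr)
    assume "\<not> ?thesis"
    then have "(\<Prod>i<n. \<bar>H i i\<bar>) * covol_bound \<le> 0" using nn by (simp add: mult_nonneg_nonpos)
    then show False using good_prod[OF assms(1)] by simp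
  qed
  have "2 ^ c * 1 \<le> 2 ^ c * ((\<Prod>i<n. \<bar>H i i\<bar>) * covol_bound)"
    using good_prod[OF assms(1)] by (intro mult_left_mono) auto
  also have "\<dots> \<le> 1 * covol_bound"
    unfolding mult.assoc[symmetric] using assms(2) b by (rule mult_right_mono)
  finally show ?thesis by simp
qed

lemma comb_subtract_L:
  assumes "comb n {..<n} x w \<in> L" "comb n {..<n} h w \<in> L"
    and "\<And>j. j < n \<Longrightarrow> y j = x j - of_int q * h j"
  shows "comb n {..<n} y w \<in> L"
proof -
  have "comb n {..<n} y w = comb n {..<n} x w + of_int (- q) \<cdot>\<^sub>v comb n {..<n} h w"
  proof (rule eq_vecI)
    fix m assume "m < dim_vec (comb n {..<n} x w + of_int (- q) \<cdot>\<^sub>v comb n {..<n} h w)"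
    then have m: "m < n" by simp
    have "(\<Sum>i<n. y i * w i $ m) = (\<Sum>i<n. x i * w i $ m - of_int q * (h i * w i $ m))"
      by (intro sum.cong) (simp_all add: assms(3) algebra_simps)
    then show "comb n {..<n} y w $ m = (comb n {..<n} x w + of_int (- q) \<cdot>\<^sub>v comb n {..<n} h w) $ m"
      using m by (simp add: sum_subtractf sum_distrib_left sum_negf)
  qed simp
  then show ?thesis using int_module_add_mult[OF L_module assms(1,2), of "- q"] by simp
qed

text \<open>In an exchange the new pivot is at most half the old one and the other diagonal entries
  stay, so the product makes up for the doubled power of 2. Left of column i both rows vanish, hence
  their combination keeps the triangular shape.\<close>

lemma euclid_step:
  assumes inv: "euclid_inv G i st" and i: "i < n"
    and y: "\<And>j. y j = ar st aA 0 j - of_int \<lfloor>ar st aA 0 i / ar st aH i i + 1 / 2\<rfloor> * ar st aH i j"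
  shows "\<lbrakk>y i = 0; ix st' rC = ix st rC; ar st' aH = ar st aH; \<forall>j<n. ar st' aA 0 j = y j\<rbrakk>
      \<Longrightarrow> euclid_inv G (Suc i) st'"
    and "\<lbrakk>y i \<noteq> 0; ix st' rC = Suc (ix st rC); \<forall>j<n. ar st' aA 0 j = ar st aH i j;
      \<forall>j<n. ar st' aH i j = y j; \<forall>k. k \<noteq> i \<longrightarrow> ar st' aH k = ar st aH k\<rbrakk>
      \<Longrightarrow> euclid_inv G i st'"
proof -
  let ?H = "ar st aH" and ?A = "ar st aA 0" and ?q = "\<lfloor>ar st aA 0 i / ar st aH i i + 1 / 2\<rfloor>"
  have H: "good ?H" and A: "\<forall>j<i. j < n \<longrightarrow> ?A j = 0" "comb n {..<n} ?A w \<in> L"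
    and g: "\<And>x. G x \<Longrightarrow> gen n ?H ?A x" and c: "2 ^ ix st rC * (\<Prod>i<n. \<bar>?H i i\<bar>) \<le> 1"
    using inv by (auto simp: euclid_inv_def)
  have y0: "\<forall>j<i. y j = 0" using A(1) H i by (auto simp: y good_def)
  have yL: "comb n {..<n} y w \<in> L"
    by (rule comb_subtract_L[OF A(2), of "?H i" _ ?q]) (use H i y in \<open>auto simp: good_def\<close>)
  have gy: "gen n ?H y x" if "G x" for x
    by (rule gen_subtract[OF g[OF that] i, of _ ?q]) (simp add: y)
  show "euclid_inv G (Suc i) st'"
    if "y i = 0" "ix st' rC = ix st rC" "ar st' aH = ?H" "\<forall>j<n. ar st' aA 0 j = y j"
  proof -
    have "comb n {..<n} (ar st' aA 0) w = comb n {..<n} y w" using that(4) by (intro comb_cong) auto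
    moreover have "gen n ?H (ar st' aA 0) x" if "G x" for x
      by (rule gen_subtract[OF gy[OF that] i, of _ 0]) (use \<open>\<forall>j<n. ar st' aA 0 j = y j\<close> in simp)
    ultimately show ?thesis
      using that y0 yL H c unfolding euclid_inv_def by (auto simp: less_Suc_eq)
  qed
  show "euclid_inv G i st'"
    if yi: "y i \<noteq> 0" and rc: "ix st' rC = Suc (ix st rC)" and A': "\<forall>j<n. ar st' aA 0 j = ?H i j"
      and Hi: "\<forall>j<n. ar st' aH i j = y j" and Hk: "\<forall>k. k \<noteq> i \<longrightarrow> ar st' aH k = ?H k"
  proof -
    let ?H' = "ar st' aH"
    have "comb n {..<n} (?H' i) w = comb n {..<n} y w" using Hi by (intro comb_cong) auto
    then have good: "good ?H'"
      unfolding good_def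
    proof (intro conjI allI impI)
      fix k j assume kj: "k < n" "j < k"
      show "?H' k j = 0"
        using kj H Hi Hk y0 by (cases "k = i") (auto simp: good_def)
    next
      fix k assume k: "k < n"
      show "?H' k k \<noteq> 0"
        using k H Hi Hk yi by (cases "k = i") (auto simp: good_def)
    next
      fix k assume k: "k < n"
      show "comb n {..<n} (?H' k) w \<in> L"
        using k H Hk yL \<open>comb n {..<n} (?H' i) w = comb n {..<n} y w\<close>
        by (cases "k = i") (auto simp: good_def)
    qed
    have comb: "comb n {..<n} (ar st' aA 0) w \<in> L"
    proof -
      have "comb n {..<n} (ar st' aA 0) w = comb n {..<n} (?H i) w" using A' by (intro comb_cong) auto
      then show ?thesis using H i by (simp add: good_def)
    qed
    have half: "\<bar>y i\<bar> \<le> \<bar>?H i i\<bar> / 2"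
      unfolding y using H i by (intro round_remainder(3)) (simp add: good_def)
    have "(\<Prod>k<n. \<bar>?H' k k\<bar>) = \<bar>y i\<bar> * (\<Prod>k\<in>{..<n} - {i}. \<bar>?H k k\<bar>)"
      using i Hi Hk by (subst prod.remove[of _ i]) (auto intro!: prod.cong)
    also have "\<dots> \<le> \<bar>?H i i\<bar> / 2 * (\<Prod>k\<in>{..<n} - {i}. \<bar>?H k k\<bar>)"
      using half by (intro mult_right_mono prod_nonneg) auto
    also have "\<dots> = (\<Prod>k<n. \<bar>?H k k\<bar>) / 2"
      using i by (simp add: prod.remove[of "{..<n}" i])
    finally have "2 ^ ix st' rC * (\<Prod>k<n. \<bar>?H' k k\<bar>) \<le> 2 ^ ix st' rC * ((\<Prod>k<n. \<bar>?H k k\<bar>) / 2)"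
      by (intro mult_left_mono) auto
    moreover have "2 ^ ix st' rC * ((\<Prod>k<n. \<bar>?H k k\<bar>) / 2) = 2 ^ ix st rC * (\<Prod>k<n. \<bar>?H k k\<bar>)"
      by (simp add: rc)
    ultimately have cnt: "2 ^ ix st' rC * (\<Prod>k<n. \<bar>?H' k k\<bar>) \<le> 1" using c by linarith
    have "gen n ?H' (ar st' aA 0) x" if "G x" for x
      by (rule gen_swap[OF gy[OF that] i]) (use A' Hi Hk in auto)
    then show ?thesis
      using good cnt comb A' H i unfolding euclid_inv_def by (auto simp: good_def)
  qed
qed

end

section \<open>Insertion of all vectors of \<open>S\<close>\<close>

definition euclid_while :: rcom where
  "euclid_while = whileless (VN 0) (VMul (VA aA (IC 0) (IR rI)) (VA aA (IC 0) (IR rI))) euclid_body"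

definition euclid_prog :: rcom where
  "euclid_prog = loop rI IDim euclid_while"

definition insert_prog :: rcom where
  "insert_prog = identity_prog ;;
     loop rR ICount (row_loop rJ aA (IC 0) (VA aX (IR rR) (IR rJ)) ;; euclid_prog)"

definition reduced :: "(nat \<Rightarrow> nat \<Rightarrow> real) \<Rightarrow> nat \<Rightarrow> nat \<Rightarrow> bool" where
  "reduced H i j \<longleftrightarrow> - 1 / 2 \<le> H i j / H j j \<and> H i j / H j j < 1 / 2"

lemma gen_cong:
  assumes "gen n H y x" "\<And>j. j < n \<Longrightarrow> x' j = x j"
  shows "gen n H y x'"
  using assms unfolding gen_def by simp

text \<open>Subtracting q times row k from row i is made good by raising the coefficient of row k by
  q times that of row i.\<close>

lemma lat_subtract_row:
  assumes "lat n H x" "i < n" "k < n" "i \<noteq> k"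
    and "\<And>j. j < n \<Longrightarrow> H' i j = H i j - of_int q * H k j" "\<And>m. m \<noteq> i \<Longrightarrow> H' m = H m"
  shows "lat n H' x"
proof -
  obtain c :: "nat \<Rightarrow> int" where x: "\<forall>j<n. x j = (\<Sum>i<n. of_int (c i) * H i j)"
    using assms(1) unfolding lat_def by blast
  have "x j = (\<Sum>m<n. of_int ((c(k := c k + q * c i)) m) * H' m j)" if j: "j < n" for j
  proof -
    have "(\<Sum>m<n. of_int ((c(k := c k + q * c i)) m) * H' m j)
       = (\<Sum>m<n. of_int (c m) * H' m j) + of_int (q * c i) * H' k j"
      using sum_fun_upd[OF assms(3), of c "c k + q * c i" "\<lambda>m. H' m j"] by simp
    also have "(\<Sum>m<n. of_int (c m) * H' m j)
       = (\<Sum>m<n. of_int (c m) * H m j + (if m = i then - of_int (c i) * (of_int q * H k j) else 0))"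
      by (rule sum.cong) (auto simp: assms(5)[OF j] assms(6) algebra_simps)
    also have "\<dots> = (\<Sum>m<n. of_int (c m) * H m j) - of_int (c i) * (of_int q * H k j)"
      using assms(2) by (simp add: sum.distrib)
    finally show ?thesis using x j assms(4,6) by simp
  qed
  then show ?thesis unfolding lat_def by blast
qed

context lattice_coords
begin

text \<open>The exchanges are paid by \<open>\<kappa>\<close>; what remains is at most one round
  with remainder 0 and the tests. \<open>K\<close> bounds the counter and acts only as a termination
  measure, so it does not enter the cost.\<close>

lemma run_euclid_while:
  assumes "euclid_inv G i st" "dm st = n" "ix st rI = i" "i < n" "4000 * (n + 1) \<le> \<kappa>"
  shows "run \<kappa> euclid_while st (4000 * (n + 1))
     (\<lambda>st'. euclid_inv G (Suc i) st' \<and> frame {rJ, rC} {aD, aA, aM, aH} st st')"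
proof -
  obtain K where K: "covol_bound < 2 ^ K" using real_arch_pow[of 2 covol_bound] by auto
  show ?thesis using assms(1-3)
  proof (induction "K - ix st rC" arbitrary: st rule: less_induct)
    case less
    let ?A = "ar st aA 0" and ?H = "ar st aH"
    let ?Q = "\<lambda>st'. euclid_inv G (Suc i) st' \<and> frame {rJ, rC} {aD, aA, aM, aH} st st'"
    let ?e = "VMul (VA aA (IC 0) (IR rI)) (VA aA (IC 0) (IR rI))"
    have tc: "vcost (VN 0) + vcost ?e + 1 = 137" by (simp add: ccost_def)
    have rc: "ix st' rC < K" if "euclid_inv G i st'" for st'
    proof -
      have "(2::real) ^ ix st' rC < 2 ^ K"
        using that exchange_count K unfolding euclid_inv_def by (meson le_less_trans)
      then show ?thesis by simp
    qed
    define y where "y = (\<lambda>j. ?A j - of_int \<lfloor>?A i / ?H i i + 1 / 2\<rfloor> * ?H i j)"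
    have pos: "vval (VN 0) st < vval ?e st" if "?A i \<noteq> 0"
    proof -
      have "0 < ?A i * ?A i" using that by (metis not_square_less_zero linorder_cases mult_eq_0_iff)
      then show ?thesis using less.prems by simp
    qed
    have body: "y i = 0 \<Longrightarrow> run \<kappa> euclid_body st (3000 * (n + 1))
        (\<lambda>st'. frame {rJ, rC} {aD, aA, aM, aH} st st' \<and> ix st' rC = ix st rC \<and> ar st' aH = ?H \<and>
          (\<forall>j<n. ar st' aA 0 j = y j))"
      "y i \<noteq> 0 \<Longrightarrow> run 0 euclid_body st (3000 * (n + 1))
        (\<lambda>st'. frame {rJ, rC} {aD, aA, aM, aH} st st' \<and> ix st' rC = Suc (ix st rC) \<and>
          (\<forall>j<n. ar st' aA 0 j = ?H i j) \<and> (\<forall>j<n. ar st' aH i j = y j) \<and>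
          (\<forall>k. k \<noteq> i \<longrightarrow> ar st' aH k = ?H k))"
      using run_euclid_body[of st i y] less.prems assms(4) by (simp_all add: y_def)
    have y: "y j = ?A j - of_int \<lfloor>?A i / ?H i i + 1 / 2\<rfloor> * ?H i j" for j by (simp add: y_def)
    show ?case
    proof (cases "?A i = 0")
      case True
      have "?Q st" using less.prems True by (auto simp: euclid_inv_def frame_def less_Suc_eq)
      then have "run \<kappa> euclid_while st (vcost (VN 0) + vcost ?e + 1) ?Q"
        unfolding euclid_while_def using less.prems True by (intro run_while_stop) simp_all
      then show ?thesis unfolding tc by (rule run_cost) simp
    next
      case False
      show ?thesis
      proof (cases "y i = 0")
        case True
        have "run \<kappa> (euclid_body ;; euclid_while) st (3000 * (n + 1) + 137) ?Q"
        proof (rule run_Seq, rule run_post[OF body(1)[OF True]])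
          fix st' assume st': "frame {rJ, rC} {aD, aA, aM, aH} st st' \<and> ix st' rC = ix st rC \<and>
             ar st' aH = ?H \<and> (\<forall>j<n. ar st' aA 0 j = y j)"
          have "euclid_inv G (Suc i) st'"
            by (rule euclid_step(1)[OF less.prems(1) assms(4) y True]) (use st' in auto)
          moreover have "ix st' rI = i" "ar st' aA 0 i = 0"
            using st' less.prems True assms(4) by (auto simp: frame_def)
          ultimately have "run \<kappa> euclid_while st' (vcost (VN 0) + vcost ?e + 1) ?Q"
            unfolding euclid_while_def using st' by (intro run_while_stop) simp_all
          then show "run \<kappa> euclid_while st' 137 ?Q" unfolding tc .
        qed
        then have "run \<kappa> euclid_while st (vcost (VN 0) + vcost ?e + 1 + (3000 * (n + 1) + 137)) ?Q"
          using pos[OF False] unfolding euclid_while_def by (intro run_while_step)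
        then show ?thesis unfolding tc by (rule run_cost) simp
      next
        case y0: False
        have "run 0 euclid_body st (3000 * (n + 1))
          (\<lambda>st'. ix st' rC = Suc (ix st rC) \<and> run \<kappa> euclid_while st' (4000 * (n + 1)) ?Q)"
        proof (rule run_post[OF body(2)[OF y0]])
          fix st' assume st': "frame {rJ, rC} {aD, aA, aM, aH} st st' \<and> ix st' rC = Suc (ix st rC) \<and>
             (\<forall>j<n. ar st' aA 0 j = ?H i j) \<and> (\<forall>j<n. ar st' aH i j = y j) \<and>
             (\<forall>k. k \<noteq> i \<longrightarrow> ar st' aH k = ?H k)"
          have inv: "euclid_inv G i st'"
            by (rule euclid_step(2)[OF less.prems(1) assms(4) y y0]) (use st' in auto)
          have d: "dm st' = n" "ix st' rI = i" using st' less.prems by (auto simp: frame_def)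
          have "run \<kappa> euclid_while st' (4000 * (n + 1))
             (\<lambda>st''. euclid_inv G (Suc i) st'' \<and> frame {rJ, rC} {aD, aA, aM, aH} st' st'')"
            by (rule less.hyps[OF _ inv d]) (use rc[OF less.prems(1)] st' in simp)
          then have "run \<kappa> euclid_while st' (4000 * (n + 1)) ?Q"
            by (rule run_post) (use st' frame_trans in blast)
          then show "ix st' rC = Suc (ix st rC) \<and> run \<kappa> euclid_while st' (4000 * (n + 1)) ?Q"
            using st' by simp
        qed
        then show ?thesis
          unfolding euclid_while_def
          by (rule run_while_pay[OF pos[OF False]]) (use tc assms(5) in simp)
      qed
    qed
  qed
qed

lemma run_euclid_prog:
  assumes "euclid_inv G 0 st" "dm st = n" "4000 * (n + 1) \<le> \<kappa>"
  shows "run \<kappa> euclid_prog st (5000 * (n + 1) * (n + 1))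
     (\<lambda>st'. euclid_inv G n st' \<and> frame {rI, rJ, rC} {aD, aA, aM, aH} st st')" (is "run _ _ _ _ ?Q")
proof -
  define I where "I = (\<lambda>k st'. euclid_inv G k st' \<and> frame {rI, rJ, rC} {aD, aA, aM, aH} st st')"
  have set_inv: "euclid_inv G m (set_ix rI l st') = euclid_inv G m st'" for m l st'
    by (simp add: euclid_inv_def)
  have "run \<kappa> euclid_prog st (n * (4000 * (n + 1) + icost IDim + 60) + icost IDim + 40) ?Q"
    unfolding euclid_prog_def
  proof (rule run_loop[where I = I])
    fix k st' assume k: "k < n" "I k st'" "ix st' rI = k"
    then have 1: "euclid_inv G k st'" "dm st' = n" using assms by (auto simp: I_def frame_def)
    show "run \<kappa> euclid_while st' (4000 * (n + 1)) (\<lambda>st''. ix st'' rI = k \<and> I (Suc k) (set_ix rI (Suc k) st''))"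
      by (rule run_post[OF run_euclid_while[OF 1 k(3,1) assms(3)]])
        (use k in \<open>auto simp: I_def set_inv frame_def\<close>)
  qed (use assms in \<open>auto simp: I_def set_inv frame_def\<close>)
  then show ?thesis by (rule run_cost) (simp add: algebra_simps)
qed

definition lat_inv :: "nat \<Rightarrow> state \<Rightarrow> bool" where
  "lat_inv k st \<longleftrightarrow> good (ar st aH) \<and> 2 ^ ix st rC * (\<Prod>i<n. \<bar>ar st aH i i\<bar>) \<le> 1 \<and>
     (\<forall>r<k. lat n (ar st aH) (ar st aX r))"

lemma comb_coords:
  assumes "r < s" "\<And>j. j < n \<Longrightarrow> y j = vs ! r \<bullet> a j"
  shows "comb n {..<n} y w \<in> L"
proof -
  have "comb n {..<n} y w = comb n {..<n} (\<lambda>p. vs ! r \<bullet> a p) w"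
    using assms(2) by (intro comb_cong) simp
  also have "\<dots> = vs ! r"
    by (rule dual_expansion[OF w_carrier a_carrier w_dual vs_carrier[OF assms(1)], symmetric])
  finally show ?thesis using vs_L[OF assms(1)] by simp
qed

lemma good_identity:
  assumes "\<forall>i<n. \<forall>j<n. H i j = (if i = j then 1 else 0)"
  shows "good H"
  unfolding good_def
proof (intro conjI allI impI)
  fix i assume i: "i < n"
  have "comb n {..<n} (H i) w = w i"
  proof (rule eq_vecI)
    fix j assume "j < dim_vec (w i)"
    then have j: "j < n" using w_carrier[OF i] by simp
    have "(\<Sum>p<n. H i p * w p $ j) = (\<Sum>p<n. if p = i then w p $ j else 0)"
      using assms i by (intro sum.cong) auto
    then show "comb n {..<n} (H i) w $ j = w i $ j" using i j by simp
  qed (use w_carrier[OF i] in simp)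
  then show "comb n {..<n} (H i) w \<in> L" using w_L[OF i] by simp
qed (use assms in auto)

lemma run_insert_prog:
  assumes st: "dm st = n" "cn st = s" "ix st rC = 0" and \<kappa>: "4000 * (n + 1) \<le> \<kappa>"
    and X: "\<And>r j. r < s \<Longrightarrow> j < n \<Longrightarrow> ar st aX r j = vs ! r \<bullet> a j"
  shows "run \<kappa> insert_prog st (20000 * (s + 1) * (n + 1) * (n + 1))
     (\<lambda>st'. lat_inv s st' \<and> frame {rR, rI, rJ, rC} {aD, aA, aM, aH} st st')" (is "run _ _ _ _ ?Q")
proof -
  let ?R = "{rR, rI, rJ, rC}" and ?B = "{aD, aA, aM, aH}"
  define I where "I = (\<lambda>k st'. lat_inv k st' \<and> frame ?R ?B st st')"
  have loop: "run \<kappa> (loop rR ICount (row_loop rJ aA (IC 0) (VA aX (IR rR) (IR rJ)) ;; euclid_prog)) st1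
     (s * (6000 * (n + 1) * (n + 1) + icost ICount + 60) + icost ICount + 40) ?Q"
    if st1: "frame {rI, rJ} {aH} st st1" "\<forall>i<n. \<forall>j<n. ar st1 aH i j = (if i = j then 1 else 0)" for st1
  proof (rule run_loop[where I = I])
    show "I 0 (set_ix rR 0 st1)"
      using st1 good_identity[OF st1(2)] st by (auto simp: I_def lat_inv_def frame_def)
  next
    fix k st2 assume k: "k < s" "I k st2" "ix st2 rR = k"
    have d: "dm st2 = n" "ar st2 aX = ar st aX" using k st by (auto simp: I_def frame_def)
    define st3 where "st3 = set_ix rJ (dm st2)
       (set_row aA 0 (\<lambda>j. if j < dm st2 then ar st aX k j else ar st2 aA 0 j) st2)"
    \<comment> \<open>The rows before k are already in the row lattice and row k is the pending row
      itself, so \<open>gen\<close> holds for all of them at the start.\<close>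
    define G where "G = (\<lambda>x. \<exists>r\<le>k. x = ar st aX r)"
    have A3: "ar st3 aA 0 j = ar st aX k j" if "j < n" for j using that d by (simp add: st3_def)
    have d3: "dm st3 = n" "ar st3 aH = ar st2 aH" "ar st3 aX = ar st aX" "ix st3 rC = ix st2 rC"
      "ix st3 rR = k" "frame ?R ?B st st3"
      using k d by (auto simp: st3_def I_def frame_def)
    have "gen n (ar st3 aH) (ar st3 aA 0) x" if Gx: "G x" for x
    proof -
      obtain r where r: "r \<le> k" "x = ar st aX r" using Gx by (auto simp: G_def)
      show ?thesis
      proof (cases "r = k")
        case True
        show ?thesis by (rule gen_cong[OF gen_self]) (simp add: A3 r True)
      next
        case False
        then have "lat n (ar st3 aH) x" using k r d d3 by (simp add: I_def lat_inv_def)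
        then show ?thesis by (rule lat_gen)
      qed
    qed
    moreover have "comb n {..<n} (ar st3 aA 0) w \<in> L"
      by (rule comb_coords[OF k(1)]) (simp add: A3 X k)
    ultimately have inv: "euclid_inv G 0 st3"
      using k d3 by (simp add: euclid_inv_def I_def lat_inv_def)
    have e: "run \<kappa> euclid_prog st3 (5000 * (n + 1) * (n + 1))
       (\<lambda>st''. ix st'' rR = k \<and> I (Suc k) (set_ix rR (Suc k) st''))"
    proof (rule run_post[OF run_euclid_prog[OF inv d3(1) \<kappa>]])
      fix st4 assume 4: "euclid_inv G n st4 \<and> frame {rI, rJ, rC} ?B st3 st4"
      have zero: "\<forall>j<n. ar st4 aA 0 j = 0" using 4 by (simp add: euclid_inv_def)
      have "ar st4 aX = ar st aX" using 4 d3 by (simp add: frame_def)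
      moreover have "lat n (ar st4 aH) (ar st aX r)" if "r \<le> k" for r
        using 4 zero that by (intro gen_lat[where y = "ar st4 aA 0"]) (auto simp: euclid_inv_def G_def)
      ultimately have "lat_inv (Suc k) (set_ix rR (Suc k) st4)"
        using 4 by (simp add: lat_inv_def euclid_inv_def less_Suc_eq_le)
      moreover have "frame ?R ?B st st4"
        by (rule frame_trans[OF d3(6) conjunct2[OF 4]]) auto
      ultimately show "ix st4 rR = k \<and> I (Suc k) (set_ix rR (Suc k) st4)"
        using 4 d3 by (simp add: I_def frame_def)
    qed
    show "run \<kappa> (row_loop rJ aA (IC 0) (VA aX (IR rR) (IR rJ)) ;; euclid_prog) st2
       (6000 * (n + 1) * (n + 1)) (\<lambda>st''. ix st'' rR = k \<and> I (Suc k) (set_ix rR (Suc k) st''))"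
      by (rule run_cost, rule run_Seq, rule run_row_loop_eq[OF _ _ st3_def])
        (use k d e in \<open>simp_all add: ccost_def algebra_simps, linarith?\<close>)
  qed (use st in \<open>auto simp: I_def frame_def lat_inv_def\<close>)
  show ?thesis
    unfolding insert_prog_def
  proof (rule run_cost, rule run_Seq, rule run_post)
    show "run \<kappa> identity_prog st (1000 * (n + 1) * (n + 1)) (\<lambda>st'. frame {rI, rJ} {aH} st st' \<and>
       (\<forall>i<n. \<forall>j<n. ar st' aH i j = (if i = j then 1 else 0)))"
      using run_identity_prog[of \<kappa> st] by (simp add: st)
  qed (use loop in \<open>auto simp: algebra_simps\<close>)
qed

end

section \<open>Reducing the triangular basis\<close>

text \<open>Within a row the columns are treated from left to right: row \<open>rK\<close> vanishes
  left of its diagonal, so subtracting it does not disturb entries reduced before. Row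
  \<open>rK\<close> need not be reduced yet, because entries are compared only with its diagonal
  entry, which never changes.\<close>

definition reduce_prog :: rcom where
  "reduce_prog = loop rI IDim (loop rK IDim (ifless (VI (IR rI)) (VI (IR rK))
     (vset aD (IC 0) (IC 0)
       (VFloor (VAdd (VDiv (VA aH (IR rI) (IR rK)) (VA aH (IR rK) (IR rK))) (VDiv (VN 1) (VN 2)))) ;;
      row_loop rJ aH (IR rI)
       (VSub (VA aH (IR rI) (IR rJ)) (VMul (VA aD (IC 0) (IC 0)) (VA aH (IR rK) (IR rJ)))))
     Skip))"

context lattice_coords
begin

definition reduced_inv :: "nat \<Rightarrow> nat \<Rightarrow> state \<Rightarrow> bool" where
  "reduced_inv i k st \<longleftrightarrow> good (ar st aH) \<and> (\<forall>r<s. lat n (ar st aH) (ar st aX r)) \<and>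
     (\<forall>m<i. \<forall>j<n. m < j \<longrightarrow> reduced (ar st aH) m j) \<and>
     (\<forall>j<k. j < n \<longrightarrow> i < j \<longrightarrow> reduced (ar st aH) i j)"

lemma reduced_inv_step:
  assumes inv: "reduced_inv i k st" and ik: "i < k" "k < n"
    and X: "ar st' aX = ar st aX"
    and Hi: "\<And>j. j < n \<Longrightarrow> ar st' aH i j =
       ar st aH i j - of_int \<lfloor>ar st aH i k / ar st aH k k + 1 / 2\<rfloor> * ar st aH k j"
    and Hm: "\<And>m. m \<noteq> i \<Longrightarrow> ar st' aH m = ar st aH m"
  shows "reduced_inv i (Suc k) st'"
proof -
  let ?H = "ar st aH" and ?H' = "ar st' aH" and ?q = "\<lfloor>ar st aH i k / ar st aH k k + 1 / 2\<rfloor>"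
  have tri: "\<And>m j. m < n \<Longrightarrow> j < m \<Longrightarrow> ?H m j = 0" and diag: "\<And>m. m < n \<Longrightarrow> ?H m m \<noteq> 0"
    and rows: "\<And>m. m < n \<Longrightarrow> comb n {..<n} (?H m) w \<in> L"
    and lat: "\<And>r. r < s \<Longrightarrow> lat n ?H (ar st aX r)"
    and red: "\<And>m j. m < i \<Longrightarrow> m < j \<Longrightarrow> j < n \<Longrightarrow> reduced ?H m j"
      "\<And>j. j < k \<Longrightarrow> i < j \<Longrightarrow> reduced ?H i j"
    using inv ik by (auto simp: reduced_inv_def good_def)
  have low: "?H' i j = ?H i j" if "j < k" for j
    using Hi[of j] tri[of k j] that ik by simp
  have diag': "?H' m m = ?H m m" if "m < n" for m
    using Hm[of m] low[OF ik(1)] by (cases "m = i") auto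
  have "good ?H'"
    unfolding good_def
  proof (intro conjI allI impI)
    fix m j assume "m < n" "j < m"
    then show "?H' m j = 0" using Hm[of m] low[of j] tri ik by (cases "m = i") auto
  next
    fix m assume "m < n"
    then show "?H' m m \<noteq> 0" using diag' diag by simp
  next
    fix m assume m: "m < n"
    show "comb n {..<n} (?H' m) w \<in> L"
    proof (cases "m = i")
      case True
      then show ?thesis using comb_subtract_L[OF rows[of i] rows[OF ik(2)] Hi] ik by simp
    next
      case False
      then show ?thesis using Hm rows[OF m] by simp
    qed
  qed
  moreover have "lat n ?H' (ar st' aX r)" if "r < s" for r
    unfolding X by (rule lat_subtract_row[OF lat[OF that], of i k _ ?q]) (use ik Hi Hm in auto)
  moreover have "reduced ?H' m j" if "m < i" "m < j" "j < n" for m j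
    using red(1)[OF that] that Hm[of m] diag'[OF that(3)] by (simp add: reduced_def)
  moreover have "reduced ?H' i j" if "j < Suc k" "i < j" for j
  proof (cases "j = k")
    case True
    have "reduced ?H' i k"
      unfolding reduced_def diag'[OF ik(2)] Hi[OF ik(2)]
      using round_remainder(1,2)[OF diag[OF ik(2)]] by blast
    then show ?thesis using True by simp
  next
    case False
    then have "j < k" using that by simp
    then show ?thesis
      using red(2)[of j] low[of j] diag'[of j] that ik by (simp add: reduced_def)
  qed
  ultimately show ?thesis by (auto simp: reduced_inv_def)
qed

lemma run_reduce_prog:
  assumes st: "dm st = n" "good (ar st aH)" "\<forall>r<s. lat n (ar st aH) (ar st aX r)"
  shows "run \<kappa> reduce_prog st (3000 * (n + 1) * (n + 1) * (n + 1))
     (\<lambda>st'. reduced_inv n 0 st' \<and> frame {rI, rJ, rK} {aD, aH} st st')" (is "run _ _ _ _ ?Q")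
proof -
  let ?R = "{rI, rJ, rK}" and ?B = "{aD, aH}"
  let ?body = "ifless (VI (IR rI)) (VI (IR rK))
     (vset aD (IC 0) (IC 0)
       (VFloor (VAdd (VDiv (VA aH (IR rI) (IR rK)) (VA aH (IR rK) (IR rK))) (VDiv (VN 1) (VN 2)))) ;;
      row_loop rJ aH (IR rI)
       (VSub (VA aH (IR rI) (IR rJ)) (VMul (VA aD (IC 0) (IC 0)) (VA aH (IR rK) (IR rJ)))))
     Skip"
  have set_inv: "reduced_inv i k (set_ix x m st') = reduced_inv i k st'" for i k x m st'
    by (simp add: reduced_inv_def)
  define I where "I = (\<lambda>i st'. reduced_inv i 0 st' \<and> frame ?R ?B st st')"
  have inner: "run \<kappa> (loop rK IDim ?body) st1 (n * (1500 * (n + 1) + icost IDim + 60) + icost IDim + 40)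
     (\<lambda>st''. ix st'' rI = i \<and> I (Suc i) (set_ix rI (Suc i) st''))"
    if st1: "i < n" "I i st1" "ix st1 rI = i" for i st1
  proof (rule run_loop[where I = "\<lambda>k st'. reduced_inv i k st' \<and> frame ?R ?B st st' \<and> ix st' rI = i"])
    fix k st2 assume k: "k < n" "reduced_inv i k st2 \<and> frame ?R ?B st st2 \<and> ix st2 rI = i" "ix st2 rK = k"
    have d: "dm st2 = n" "ix st2 rI = i" using k st by (auto simp: frame_def)
    let ?Q2 = "\<lambda>st''. ix st'' rK = k \<and> reduced_inv i (Suc k) (set_ix rK (Suc k) st'') \<and>
       frame ?R ?B st (set_ix rK (Suc k) st'') \<and> ix (set_ix rK (Suc k) st'') rI = i"
    let ?q = "\<lfloor>ar st2 aH i k / ar st2 aH k k + 1 / 2\<rfloor>"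
    show "run \<kappa> ?body st2 (1500 * (n + 1)) ?Q2"
    proof (cases "i < k")
      case True
      define st3 where "st3 = set_ar aD 0 0 (of_int ?q) st2"
      define st4 where "st4 = set_ix rJ (dm st3) (set_row aH i
         (\<lambda>j. if j < dm st3 then ar st2 aH i j - of_int ?q * ar st2 aH k j else ar st3 aH i j) st3)"
      have 3: "dm st3 = n" "ix st3 rI = i" "ix st3 rK = k" "ar st3 aH = ar st2 aH" "ar st3 aD 0 0 = of_int ?q"
        using d k by (simp_all add: st3_def)
      have "reduced_inv i (Suc k) st4"
        by (rule reduced_inv_step[OF conjunct1[OF k(2)] True k(1)]) (simp_all add: st4_def st3_def d)
      moreover have "frame ?R ?B st st4" "ix st4 rI = i" "ix st4 rK = k"
        using k by (auto simp: st4_def st3_def frame_def)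
      ultimately have Q4: "?Q2 st4" by (simp add: set_inv frame_def)
      have neq: "k \<noteq> i" using True by simp
      have r3: "run \<kappa> (row_loop rJ aH (IR rI)
         (VSub (VA aH (IR rI) (IR rJ)) (VMul (VA aD (IC 0) (IC 0)) (VA aH (IR rK) (IR rJ))))) st3 (700 * (n + 1)) ?Q2"
        by (rule run_cost, rule run_row_loop_eq[OF _ _ st4_def, where Q = ?Q2])
          (use 3 neq Q4 in \<open>(simp_all add: ccost_def; fail)?, simp_all add: ccost_def, linarith?\<close>)
      have eq3: "st3 = set_ar aD (ival (IC 0) st2) (ival (IC 0) st2)
          (vval (VFloor (VAdd (VDiv (VA aH (IR rI) (IR rK)) (VA aH (IR rK) (IR rK))) (VDiv (VN 1) (VN 2)))) st2) st2"
        using d k by (simp add: st3_def)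
      show ?thesis
        by (rule run_cost, rule run_ifless_true, use True d k in simp, rule run_Seq, rule run_vset,
            rule r3[unfolded eq3]) (simp add: ccost_def)
    next
      case False
      have "reduced_inv i (Suc k) st2" using k(2) False by (auto simp: reduced_inv_def less_Suc_eq)
      then have "?Q2 st2" using k by (simp add: set_inv frame_def)
      then show ?thesis
        by (intro run_cost[OF run_ifless_false[OF _ run_Skip]]) (use False d k in simp_all)
    qed
  next
    show "reduced_inv i 0 (set_ix rK 0 st1) \<and> frame ?R ?B st (set_ix rK 0 st1) \<and> ix (set_ix rK 0 st1) rI = i"
      using st1 by (simp add: I_def set_inv frame_def)
  next
    fix st' assume st': "reduced_inv i n st' \<and> frame ?R ?B st st' \<and> ix st' rI = i"
    then have "reduced_inv (Suc i) 0 st'" by (auto simp: reduced_inv_def less_Suc_eq)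
    then show "ix st' rI = i \<and> I (Suc i) (set_ix rI (Suc i) st')"
      using st' by (simp add: I_def set_inv frame_def)
  qed (use st in \<open>auto simp: frame_def\<close>)
  have "run \<kappa> reduce_prog st (n * ((n * (1500 * (n + 1) + icost IDim + 60) + icost IDim + 40) + icost IDim + 60)
     + icost IDim + 40) ?Q"
    unfolding reduce_prog_def
  proof (rule run_loop[where I = I])
    show "I 0 (set_ix rI 0 st)" using st by (simp add: I_def reduced_inv_def frame_def)
  qed (use inner st in \<open>auto simp: I_def frame_def\<close>)
  then show ?thesis by (rule run_cost) (simp add: algebra_simps)
qed

end

section \<open>Connected components\<close>

text \<open>Multiplication by the matrix of the \<open>w p\<close> turns coordinates back into
  vectors of the Euclidean space, where scalar products can be taken.\<close>

definition product_prog :: rcom where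
  "product_prog = loop rI IDim (loop rK IDim
     (sum_loop rJ aG (IR rI) (IR rK) (VMul (VA aH (IR rI) (IR rJ)) (VA aW (IR rJ) (IR rK)))))"

lemma run_product_prog:
  "run \<kappa> product_prog st (2000 * (dm st + 1) * (dm st + 1) * (dm st + 1))
     (\<lambda>st'. frame {rI, rJ, rK} {aG} st st' \<and>
        (\<forall>i<dm st. \<forall>k<dm st. ar st' aG i k = (\<Sum>j<dm st. ar st aH i j * ar st aW j k)))"
    (is "run _ _ _ _ ?Q")
proof -
  let ?n = "dm st" and ?R = "{rI, rJ, rK}"
  let ?g = "\<lambda>i k. \<Sum>j<?n. ar st aH i j * ar st aW j k"
  define I where "I = (\<lambda>m st'. frame ?R {aG} st st' \<and> (\<forall>i<m. \<forall>k<?n. ar st' aG i k = ?g i k))"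
  define J where "J = (\<lambda>i m st'. I i st' \<and> ix st' rI = i \<and> (\<forall>k<m. ar st' aG i k = ?g i k))"
  have inner: "run \<kappa> (loop rK IDim (sum_loop rJ aG (IR rI) (IR rK)
      (VMul (VA aH (IR rI) (IR rJ)) (VA aW (IR rJ) (IR rK))))) st1
      (?n * (1000 * (?n + 1) + icost IDim + 60) + icost IDim + 40)
      (\<lambda>st''. ix st'' rI = i \<and> I (Suc i) (set_ix rI (Suc i) st''))"
    if st1: "i < ?n" "I i st1" "ix st1 rI = i" for i st1
  proof (rule run_loop[where I = "J i"])
    fix k st2 assume k: "k < ?n" "J i k st2" "ix st2 rK = k"
    have d: "dm st2 = ?n" "ix st2 rI = i" "ar st2 aH = ar st aH" "ar st2 aW = ar st aW"
      using k by (auto simp: J_def I_def frame_def)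
    have J: "J i (Suc k) (set_ix rK (Suc k) (set_ix rJ ?n (set_ar aG i k (?g i k) st2)))"
      using k by (auto simp: J_def I_def frame_def less_Suc_eq)
    show "run \<kappa> (sum_loop rJ aG (IR rI) (IR rK) (VMul (VA aH (IR rI) (IR rJ)) (VA aW (IR rJ) (IR rK))))
       st2 (1000 * (?n + 1)) (\<lambda>st''. ix st'' rK = k \<and> J i (Suc k) (set_ix rK (Suc k) st''))"
      apply (rule run_cost)
       apply (rule run_sum_loop[where i = i and j = k and V = "\<lambda>j. ar st aH i j * ar st aW j k"])
             apply (use k d J in simp_all)[7]
      apply (simp add: ccost_def d)
      done
  qed (use st1 in \<open>auto simp: J_def I_def frame_def less_Suc_eq\<close>)
  have "run \<kappa> product_prog st (?n * ((?n * (1000 * (?n + 1) + icost IDim + 60) + icost IDim + 40)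
     + icost IDim + 60) + icost IDim + 40) ?Q"
    unfolding product_prog_def
    by (rule run_loop[where I = I]) (use inner in \<open>auto simp: I_def frame_def\<close>)
  then show ?thesis by (rule run_cost) (simp add: algebra_simps)
qed

text \<open>Components are represented by labels: an edge \<open>(i, k)\<close> replaces every label equal to that of \<open>k\<close>
  by the label of \<open>i\<close>.\<close>

definition relabel_prog :: rcom where
  "relabel_prog =
     sum_loop rJ aD (IC 0) (IC 0) (VMul (VA aG (IR rI) (IR rJ)) (VA aG (IR rK) (IR rJ))) ;;
     ifless (VN 0) (VMul (VA aD (IC 0) (IC 0)) (VA aD (IC 0) (IC 0)))
       (vset aM (IC 0) (IC 0) (VA aL (IC 0) (IR rK)) ;;
        vset aM (IC 0) (IC 1) (VA aL (IC 0) (IR rI)) ;;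
        loop rJ IDim (ifless (VN 0)
          (VMul (VSub (VA aL (IC 0) (IR rJ)) (VA aM (IC 0) (IC 0))) (VSub (VA aL (IC 0) (IR rJ)) (VA aM (IC 0) (IC 0))))
          Skip (vset aL (IC 0) (IR rJ) (VA aM (IC 0) (IC 1)))))
       Skip"

definition component_prog :: rcom where
  "component_prog = row_loop rJ aL (IC 0) (VI (IR rJ)) ;;
     loop rI IDim (loop rK IDim relabel_prog)"

lemma square_pos_iff: "0 < x * x \<longleftrightarrow> x \<noteq> (0::real)"
  by (metis mult_eq_0_iff not_real_square_gt_zero)

text \<open>Both labels are saved in \<open>aM\<close> before the sweep, because the sweep
  overwrites the label of k.\<close>

lemma run_relabel_prog:
  assumes ik: "ix st rI = i" "ix st rK = k" "i < dm st" "k < dm st"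
    and lab: "\<And>m. m < dm st \<Longrightarrow> ar st aL 0 m = real (lab m)"
  shows "run \<kappa> relabel_prog st (2000 * (dm st + 1)) (\<lambda>st'. frame {rJ} {aD, aM, aL} st st' \<and>
    (\<forall>m<dm st. ar st' aL 0 m = real (if (\<Sum>j<dm st. ar st aG i j * ar st aG k j) \<noteq> 0 \<and> lab m = lab k
       then lab i else lab m)))" (is "run _ _ _ _ ?Q")
proof -
  let ?n = "dm st" and ?p = "\<Sum>j<dm st. ar st aG i j * ar st aG k j"
  let ?body = "ifless (VN 0)
          (VMul (VSub (VA aL (IC 0) (IR rJ)) (VA aM (IC 0) (IC 0))) (VSub (VA aL (IC 0) (IR rJ)) (VA aM (IC 0) (IC 0))))
          Skip (vset aL (IC 0) (IR rJ) (VA aM (IC 0) (IC 1)))"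
  define st1 where "st1 = set_ix rJ ?n (set_ar aD 0 0 ?p st)"
  define st2 where "st2 = set_ar aM 0 0 (real (lab k)) st1"
  define st3 where "st3 = set_ar aM 0 1 (real (lab i)) st2"
  have 1: "dm st1 = ?n" "ix st1 rI = i" "ix st1 rK = k" "ar st1 aL = ar st aL" "ar st1 aD 0 0 = ?p"
    "frame {rJ} {aD, aM, aL} st st1"
    using ik by (simp_all add: st1_def frame_def)
  have 3: "dm st3 = ?n" "ar st3 aL = ar st aL" "ar st3 aM 0 0 = real (lab k)"
     "ar st3 aM 0 (Suc 0) = real (lab i)" "frame {rJ} {aD, aM, aL} st st3"
    using 1 by (simp_all add: st3_def st2_def frame_def)
  have loop: "run \<kappa> (loop rJ IDim ?body) st3 (?n * (700 + icost IDim + 60) + icost IDim + 40) ?Q"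
    if p: "?p \<noteq> 0"
  proof (rule run_loop[where I = "\<lambda>l st'. frame {rJ} {aL} st3 st' \<and>
      (\<forall>m<?n. ar st' aL 0 m = real (if m < l \<and> lab m = lab k then lab i else lab m))"])
    fix l st' assume l: "l < ?n" "frame {rJ} {aL} st3 st' \<and>
      (\<forall>m<?n. ar st' aL 0 m = real (if m < l \<and> lab m = lab k then lab i else lab m))" "ix st' rJ = l"
    have d: "ar st' aM = ar st3 aM" "ar st' aL 0 l = real (lab l)" using l by (auto simp: frame_def)
    let ?Q2 = "\<lambda>st''. ix st'' rJ = l \<and> frame {rJ} {aL} st3 (set_ix rJ (Suc l) st'') \<and>
      (\<forall>m<?n. ar (set_ix rJ (Suc l) st'') aL 0 m = real (if m < Suc l \<and> lab m = lab k then lab i else lab m))"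
    show "run \<kappa> ?body st' 700 ?Q2"
    proof (cases "lab l = lab k")
      case True
      then have "?Q2 (set_ar aL 0 l (real (lab i)) st')"
        using l by (auto simp: frame_def less_Suc_eq)
      then have "run \<kappa> (vset aL (IC 0) (IR rJ) (VA aM (IC 0) (IC 1))) st'
         (ccost (IC 0) (IR rJ) + vcost (VA aM (IC 0) (IC 1)) + 1) ?Q2"
        using l d 3 by (intro run_vset) simp
      then have "run \<kappa> ?body st' (vcost (VN 0) + vcost (VMul (VSub (VA aL (IC 0) (IR rJ)) (VA aM (IC 0) (IC 0)))
          (VSub (VA aL (IC 0) (IR rJ)) (VA aM (IC 0) (IC 0)))) + 1 +
          (ccost (IC 0) (IR rJ) + vcost (VA aM (IC 0) (IC 1)) + 1)) ?Q2"
        using True l d 3 by (intro run_ifless_false) simp_all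
      then show ?thesis by (rule run_cost) (simp add: ccost_def)
    next
      case False
      then have "?Q2 st'" using l by (auto simp: frame_def less_Suc_eq)
      then have "run \<kappa> ?body st' (vcost (VN 0) + vcost (VMul (VSub (VA aL (IC 0) (IR rJ)) (VA aM (IC 0) (IC 0)))
          (VSub (VA aL (IC 0) (IR rJ)) (VA aM (IC 0) (IC 0)))) + 1 + 1) ?Q2"
        using False l d 3 by (intro run_ifless_true run_Skip) (simp_all add: square_pos_iff)
      then show ?thesis by (rule run_cost) (simp add: ccost_def)
    qed
  qed (use 3 lab p frame_trans[OF 3(5), of "{rJ}" "{aL}" _ "{rJ}" "{aD, aM, aL}"] in
      \<open>auto simp: frame_def\<close>)
  have r1: "run \<kappa> (ifless (VN 0) (VMul (VA aD (IC 0) (IC 0)) (VA aD (IC 0) (IC 0)))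
       (vset aM (IC 0) (IC 0) (VA aL (IC 0) (IR rK)) ;;
        vset aM (IC 0) (IC 1) (VA aL (IC 0) (IR rI)) ;;
        loop rJ IDim ?body) Skip) st1 (1300 * (?n + 1)) ?Q"
  proof (cases "?p = 0")
    case True
    then have "?Q st1" using 1 lab by simp
    then have "run \<kappa> (ifless (VN 0) (VMul (VA aD (IC 0) (IC 0)) (VA aD (IC 0) (IC 0)))
       (vset aM (IC 0) (IC 0) (VA aL (IC 0) (IR rK)) ;;
        vset aM (IC 0) (IC 1) (VA aL (IC 0) (IR rI)) ;;
        loop rJ IDim ?body) Skip) st1
       (vcost (VN 0) + vcost (VMul (VA aD (IC 0) (IC 0)) (VA aD (IC 0) (IC 0))) + 1 + 1) ?Q"
      using 1 True by (intro run_ifless_false run_Skip) simp_all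
    then show ?thesis by (rule run_cost) (simp add: ccost_def)
  next
    case False
    have eq2: "st2 = set_ar aM (ival (IC 0) st1) (ival (IC 0) st1) (vval (VA aL (IC 0) (IR rK)) st1) st1"
      using 1 lab ik by (simp add: st2_def)
    have eq3: "st3 = set_ar aM (ival (IC 0) st2) (ival (IC 1) st2) (vval (VA aL (IC 0) (IR rI)) st2) st2"
      using 1 lab ik by (simp add: st3_def st2_def)
    note l3 = loop[OF False, unfolded eq3]
    have r2: "run \<kappa> (vset aM (IC 0) (IC 1) (VA aL (IC 0) (IR rI)) ;; loop rJ IDim ?body) st2
      ((ccost (IC 0) (IC 1) + vcost (VA aL (IC 0) (IR rI)) + 1)
         + (?n * (700 + icost IDim + 60) + icost IDim + 40)) ?Q"
      by (rule run_Seq, rule run_vset, rule l3)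
    show ?thesis
      by (rule run_cost, rule run_ifless_true, use 1 False in \<open>simp add: square_pos_iff\<close>,
          rule run_Seq, rule run_vset, rule r2[unfolded eq2]) (simp add: ccost_def)
  qed
  show ?thesis
    unfolding relabel_prog_def
    apply (rule run_cost, rule run_Seq)
     apply (rule run_sum_loop[where i = 0 and j = 0 and V = "\<lambda>j. ar st aG i j * ar st aG k j"])
           apply (use ik in simp_all)[5]
      apply (use r1 in \<open>simp add: st1_def\<close>)
     apply simp
    apply (simp add: ccost_def)
    done
qed

definition edges :: "state \<Rightarrow> (nat \<times> nat) set" where
  "edges st = {(i, k). i < dm st \<and> k < dm st \<and> (\<Sum>j<dm st. ar st aG i j * ar st aG k j) \<noteq> 0}"

lemma sym_edges: "sym (edges st)"
  by (rule symI) (simp add: edges_def mult.commute)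

text \<open>\<open>P\<close> marks the pairs already treated. Equal labels always certify a path,
  treated edges have equal labels; once all pairs are treated, the label classes are exactly the
  components.\<close>

definition labels_inv :: "(nat \<times> nat) set \<Rightarrow> (nat \<times> nat \<Rightarrow> bool) \<Rightarrow> (nat \<Rightarrow> nat) \<Rightarrow> state \<Rightarrow> bool" where
  "labels_inv E P lab st \<longleftrightarrow> (\<forall>m<dm st. lab m < dm st \<and> ar st aL 0 m = real (lab m)) \<and>
     (\<forall>m<dm st. \<forall>l<dm st. lab m = lab l \<longrightarrow> (m, l) \<in> E\<^sup>*) \<and>
     (\<forall>(i, k)\<in>E. P (i, k) \<longrightarrow> lab i = lab k)"

lemma labels_inv_mono:
  assumes "labels_inv E P lab st" "\<And>i k. (i, k) \<in> E \<Longrightarrow> P' (i, k) \<Longrightarrow> P (i, k)"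
  shows "labels_inv E P' lab st"
  using assms unfolding labels_inv_def by blast

text \<open>Only the classes of i and k are merged, and a path between them runs through the edge,
  in either direction by symmetry.\<close>

lemma relabel_connected:
  assumes sym: "sym E" and ik: "(i, k) \<in> E" "i < n" "k < n"
    and conn: "\<And>m l. m < n \<Longrightarrow> l < n \<Longrightarrow> lab m = lab l \<Longrightarrow> (m, l) \<in> E\<^sup>*"
    and ml: "m < n" "l < n" "(if lab m = lab k then lab i else lab m) = (if lab l = lab k then lab i else lab l)"
  shows "(m, l) \<in> E\<^sup>*"
proof -
  have symr: "(y, x) \<in> E\<^sup>*" if "(x, y) \<in> E\<^sup>*" for x y using sym_rtrancl[OF sym] that by (rule symD)
  have ik': "(i, k) \<in> E\<^sup>*" "(k, i) \<in> E\<^sup>*" using ik(1) symr by blast+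
  show ?thesis
  proof (cases "lab m = lab k"; cases "lab l = lab k")
    assume "lab m = lab k" "lab l \<noteq> lab k"
    then have "(m, k) \<in> E\<^sup>*" "(i, l) \<in> E\<^sup>*" using conn ml ik by auto
    then show ?thesis using ik'(2) by (meson rtrancl_trans)
  next
    assume "lab m \<noteq> lab k" "lab l = lab k"
    then have "(m, i) \<in> E\<^sup>*" "(k, l) \<in> E\<^sup>*" using conn ml ik by auto
    then show ?thesis using ik'(1) by (meson rtrancl_trans)
  qed (use conn ml in auto)
qed

lemma run_component_prog:
  "run \<kappa> component_prog st (4000 * (dm st + 1) * (dm st + 1) * (dm st + 1)) (\<lambda>st'.
     frame {rI, rJ, rK} {aL, aD, aM} st st' \<and> (\<exists>lab. labels_inv (edges st) (\<lambda>_. True) lab st'))"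
    (is "run _ _ _ _ ?Q")
proof -
  let ?n = "dm st" and ?E = "edges st" and ?R = "{rI, rJ, rK}" and ?B = "{aL, aD, aM}"
  define I where "I = (\<lambda>i st'. frame ?R ?B st st' \<and> (\<exists>lab. labels_inv ?E (\<lambda>(i', k'). i' < i) lab st'))"
  define J where "J = (\<lambda>i k st'. frame ?R ?B st st' \<and> ix st' rI = i \<and>
     (\<exists>lab. labels_inv ?E (\<lambda>(i', k'). i' < i \<or> (i' = i \<and> k' < k)) lab st'))"
  have Eb: "i < ?n" "k < ?n" if "(i, k) \<in> ?E" for i k using that by (auto simp: edges_def)
  have set_inv: "labels_inv E P lab (set_ix x m st') = labels_inv E P lab st'" for E P lab x m st'
    by (simp add: labels_inv_def)
  have inner: "run \<kappa> (loop rK IDim relabel_prog) st1 (?n * (2000 * (?n + 1) + icost IDim + 60) + icost IDim + 40)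
      (\<lambda>st''. ix st'' rI = i \<and> I (Suc i) (set_ix rI (Suc i) st''))"
    if st1: "i < ?n" "I i st1" "ix st1 rI = i" for i st1
  proof (rule run_loop[where I = "J i"])
    fix k st2 assume k: "k < ?n" "J i k st2" "ix st2 rK = k"
    have d: "dm st2 = ?n" "ix st2 rI = i" "ar st2 aG = ar st aG" "frame ?R ?B st st2"
      using k by (auto simp: J_def frame_def)
    obtain lab where lab: "labels_inv ?E (\<lambda>(i', k'). i' < i \<or> (i' = i \<and> k' < k)) lab st2"
      using k(2) unfolding J_def by blast
    define lab' where "lab' = (\<lambda>m. if (i, k) \<in> ?E \<and> lab m = lab k then lab i else lab m)"
    have e: "(\<Sum>j<?n. ar st aG i j * ar st aG k j) \<noteq> 0 \<longleftrightarrow> (i, k) \<in> ?E"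
      using st1 k by (simp add: edges_def)
    have rel: "run \<kappa> relabel_prog st2 (2000 * (?n + 1)) (\<lambda>st'. frame {rJ} {aD, aM, aL} st2 st' \<and>
      (\<forall>m<?n. ar st' aL 0 m = real (lab' m)))"
      using run_relabel_prog[of st2 i k lab \<kappa>] st1 k d lab
      by (simp add: labels_inv_def lab'_def e cong: if_cong)
    show "run \<kappa> relabel_prog st2 (2000 * (?n + 1)) (\<lambda>st''. ix st'' rK = k \<and> J i (Suc k) (set_ix rK (Suc k) st''))"
    proof (rule run_post[OF rel])
      fix st3 assume 3: "frame {rJ} {aD, aM, aL} st2 st3 \<and> (\<forall>m<?n. ar st3 aL 0 m = real (lab' m))"
      have d3: "dm st3 = ?n" "ix st3 rK = k" "ix st3 rI = i" using 3 d k by (auto simp: frame_def)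
      have fr: "frame ?R ?B st st3" by (rule frame_trans[OF d(4) conjunct1[OF 3]]) auto
      have lt: "lab' m < ?n" if "m < ?n" for m
        using lab that st1(1) d(1) by (auto simp: labels_inv_def lab'_def)
      have conn: "(m, l) \<in> ?E\<^sup>*" if "m < ?n" "l < ?n" "lab' m = lab' l" for m l
      proof (cases "(i, k) \<in> ?E")
        case True
        show ?thesis
          by (rule relabel_connected[OF sym_edges True Eb[OF True], of lab])
            (use lab that d(1) True in \<open>auto simp: labels_inv_def lab'_def\<close>)
      next
        case False
        then show ?thesis using lab that d(1) by (auto simp: labels_inv_def lab'_def)
      qed
      have old: "lab i' = lab k'" if "(i', k') \<in> ?E" "i' < i \<or> (i' = i \<and> k' < k)" for i' k'
        using lab that unfolding labels_inv_def by blast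
      have new: "lab' i' = lab' k'" if "(i', k') \<in> ?E" "i' < i \<or> (i' = i \<and> k' < Suc k)" for i' k'
      proof (cases "i' = i \<and> k' = k")
        case True
        then show ?thesis using that by (simp add: lab'_def)
      next
        case False
        \<comment> \<open>The new label is a function of the old one, so edges respected before stay
          respected.\<close>
        then have "lab i' = lab k'" using old[OF that(1)] that(2) by auto
        then show ?thesis by (simp add: lab'_def)
      qed
      have "labels_inv ?E (\<lambda>(i', k'). i' < i \<or> (i' = i \<and> k' < Suc k)) lab' st3"
        unfolding labels_inv_def using 3 lt conn new d3 by auto
      then show "ix st3 rK = k \<and> J i (Suc k) (set_ix rK (Suc k) st3)"
        using d3 fr unfolding J_def by (auto simp: set_inv frame_def)
    qed
  next
    show "J i 0 (set_ix rK 0 st1)"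
      using st1 by (auto simp: J_def I_def set_inv frame_def)
  next
    fix st' assume st': "J i ?n st'"
    then obtain lab where lab: "labels_inv ?E (\<lambda>(i', k'). i' < i \<or> (i' = i \<and> k' < ?n)) lab st'"
      unfolding J_def by blast
    then have "labels_inv ?E (\<lambda>(i', k'). i' < Suc i) lab st'"
      by (rule labels_inv_mono) (use Eb in \<open>auto simp: less_Suc_eq\<close>)
    then show "ix st' rI = i \<and> I (Suc i) (set_ix rI (Suc i) st')"
      using st' by (auto simp: J_def I_def set_inv frame_def)
  qed (auto simp: J_def frame_def)
  define st1 where "st1 = set_ix rJ (dm st) (set_row aL 0 (\<lambda>j. if j < dm st then real j else ar st aL 0 j) st)"
  have outer: "run \<kappa> (loop rI IDim (loop rK IDim relabel_prog)) st1
     (?n * ((?n * (2000 * (?n + 1) + icost IDim + 60) + icost IDim + 40) + icost IDim + 60) + icost IDim + 40) ?Q"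
  proof (rule run_loop[where I = I])
    have "labels_inv ?E (\<lambda>(i', k'). i' < 0) (\<lambda>m. m) st1"
      by (auto simp: labels_inv_def st1_def)
    then show "I 0 (set_ix rI 0 st1)"
      unfolding I_def set_inv by (auto simp: frame_def st1_def)
  next
    fix st' assume "I ?n st'"
    then obtain lab where "labels_inv ?E (\<lambda>(i', k'). i' < ?n) lab st'" "frame ?R ?B st st'"
      unfolding I_def by blast
    moreover from this(1) have "labels_inv ?E (\<lambda>_. True) lab st'"
      by (rule labels_inv_mono) (use Eb in auto)
    ultimately show "?Q st'" by blast
  qed (use inner in \<open>auto simp: I_def frame_def\<close>)
  show ?thesis
    unfolding component_prog_def
    by (rule run_cost, rule run_Seq, rule run_row_loop_eq[OF _ _ st1_def])
      (use outer in \<open>simp_all add: ccost_def algebra_simps, linarith?\<close>)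
qed

section \<open>Writing the blocks\<close>

text \<open>The machine has no equality test. Labels differ iff the square of their difference is
  positive, so \<open>c\<close> stands in the branch taken when the test fails.\<close>

definition label_eq :: "rcom \<Rightarrow> rcom" where
  "label_eq c = ifless (VN 0)
     (VMul (VSub (VA aL (IC 0) (IR rJ)) (VI (IR rI))) (VSub (VA aL (IC 0) (IR rJ)) (VI (IR rI)))) Skip c"

lemma run_label_eq:
  assumes "ar st aL 0 (ix st rJ) = real l"
    and "l = ix st rI \<Longrightarrow> run \<kappa> c st T Q" "l \<noteq> ix st rI \<Longrightarrow> Q st"
  shows "run \<kappa> (label_eq c) st (300 + T) Q"
proof (cases "l = ix st rI")
  case True
  then show ?thesis
    unfolding label_eq_def
    by (intro run_cost[OF run_ifless_false]) (use assms in \<open>simp_all add: ccost_def, linarith?\<close>)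
next
  case False
  then have "0 < (real l - real (ix st rI)) * (real l - real (ix st rI))"
    by (simp add: square_pos_iff)
  then show ?thesis
    unfolding label_eq_def
    by (intro run_cost[OF run_ifless_true[OF _ run_Skip]]) (use assms False in \<open>simp_all add: ccost_def, linarith?\<close>)
qed

definition count_prog :: rcom where
  "count_prog = iset rM (IC 0) ;;
     loop rI IDim
       (iset rT (IC 0) ;;
        loop rJ IDim (label_eq (iset rT (IAdd (IR rT) (IC 1)))) ;;
        ifless (VN 0) (VI (IR rT))
          (vset aV (IC 0) (IR rM) (VI (IR rT)) ;; iset rM (IAdd (IR rM) (IC 1))) Skip)"

definition nonempty_labels :: "nat \<Rightarrow> (nat \<Rightarrow> nat) \<Rightarrow> nat \<Rightarrow> nat list" where
  "nonempty_labels n lab k = filter (\<lambda>l. block n lab l \<noteq> []) [0..<k]"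

lemma run_count_prog:
  assumes lab: "\<forall>m<dm st. ar st aL 0 m = real (lab m)"
  shows "run \<kappa> count_prog st (2000 * (dm st + 1) * (dm st + 1)) (\<lambda>st'.
     frame {rI, rJ, rT, rM} {aV} st st' \<and> ix st' rM = length (nonempty_labels (dm st) lab (dm st)) \<and>
     (\<forall>x<ix st' rM. ar st' aV 0 x = real (length (block (dm st) lab (nonempty_labels (dm st) lab (dm st) ! x)))))"
    (is "run _ _ _ _ ?Q")
proof -
  let ?n = "dm st" and ?R = "{rI, rJ, rT, rM}"
  let ?ls = "nonempty_labels ?n lab"
  define I where "I = (\<lambda>i st'. frame ?R {aV} st st' \<and> ix st' rM = length (?ls i) \<and>
     (\<forall>x<length (?ls i). ar st' aV 0 x = real (length (block ?n lab (?ls i ! x)))))"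
  let ?if = "ifless (VN 0) (VI (IR rT))
          (vset aV (IC 0) (IR rM) (VI (IR rT)) ;; iset rM (IAdd (IR rM) (IC 1))) Skip"
  let ?count = "loop rJ IDim (label_eq (iset rT (IAdd (IR rT) (IC 1))))"
  have if_ok: "run \<kappa> ?if st2 500 (\<lambda>st''. ix st'' rI = i \<and> I (Suc i) (set_ix rI (Suc i) st''))"
    if i: "i < ?n" "I i st2" "ix st2 rI = i" "ix st2 rT = length (block ?n lab i)" for i st2
  proof (cases "block ?n lab i = []")
    case True
    then have "?ls (Suc i) = ?ls i" by (simp add: nonempty_labels_def)
    then have "I (Suc i) (set_ix rI (Suc i) st2)" using i by (simp add: I_def frame_def)
    then show ?thesis
      by (intro run_cost[OF run_ifless_false[OF _ run_Skip]]) (use i True in simp_all)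
  next
    case False
    then have ls: "?ls (Suc i) = ?ls i @ [i]" by (simp add: nonempty_labels_def)
    define st3 where "st3 = set_ar aV 0 (length (?ls i)) (real (length (block ?n lab i))) st2"
    have "I (Suc i) (set_ix rI (Suc i) (set_ix rM (Suc (length (?ls i))) st3))"
      using i by (auto simp: I_def frame_def ls nth_append st3_def less_Suc_eq)
    moreover have "ix st3 rM = length (?ls i)" "ix st3 rI = i" using i by (simp_all add: I_def st3_def)
    ultimately have r3: "run \<kappa> (iset rM (IAdd (IR rM) (IC 1))) st3 40
       (\<lambda>st''. ix st'' rI = i \<and> I (Suc i) (set_ix rI (Suc i) st''))"
      by (intro run_cost[OF run_iset]) simp_all
    have eq3: "st3 = set_ar aV (ival (IC 0) st2) (ival (IR rM) st2) (vval (VI (IR rT)) st2) st2"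
      using i by (simp add: st3_def I_def)
    show ?thesis
      by (rule run_cost, rule run_ifless_true, use i False in simp, rule run_Seq, rule run_vset,
          rule r3[unfolded eq3]) (simp add: ccost_def)
  qed
  have body: "run \<kappa> (iset rT (IC 0) ;; ?count ;; ?if) st1 (1500 * (?n + 1))
      (\<lambda>st''. ix st'' rI = i \<and> I (Suc i) (set_ix rI (Suc i) st''))"
    if st1: "i < ?n" "I i st1" "ix st1 rI = i" for i st1
  proof -
    have count: "run \<kappa> ?count (set_ix rT 0 st1) (?n * ((300 + 40) + icost IDim + 60) + icost IDim + 40)
      (\<lambda>st'. run \<kappa> ?if st' 500 (\<lambda>st''. ix st'' rI = i \<and> I (Suc i) (set_ix rI (Suc i) st'')))"
    proof (rule run_loop[where I = "\<lambda>j st'. I i st' \<and> ix st' rI = i \<and>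
        ix st' rT = length (filter (\<lambda>m. lab m = i) [0..<j])"])
      fix j st2 assume j: "j < ?n" "I i st2 \<and> ix st2 rI = i \<and>
        ix st2 rT = length (filter (\<lambda>m. lab m = i) [0..<j])" "ix st2 rJ = j"
      have "ar st2 aL = ar st aL" using j by (simp add: I_def frame_def)
      then have L: "ar st2 aL 0 (ix st2 rJ) = real (lab j)" using j lab by simp
      have set_inv: "I i (set_ix rJ k (set_ix rT l st'))" "I i (set_ix rJ k st')" if "I i st'" for k l st'
        using that by (auto simp: I_def frame_def)
      show "run \<kappa> (label_eq (iset rT (IAdd (IR rT) (IC 1)))) st2 (300 + 40)
        (\<lambda>st''. ix st'' rJ = j \<and> I i (set_ix rJ (Suc j) st'') \<and> ix (set_ix rJ (Suc j) st'') rI = i \<and>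
          ix (set_ix rJ (Suc j) st'') rT = length (filter (\<lambda>m. lab m = i) [0..<Suc j]))"
        by (rule run_label_eq[OF L], rule run_cost, rule run_iset) (use j set_inv in auto)
    next
      fix st' assume "I i st' \<and> ix st' rI = i \<and> ix st' rT = length (filter (\<lambda>m. lab m = i) [0..<?n])"
      then show "run \<kappa> ?if st' 500 (\<lambda>st''. ix st'' rI = i \<and> I (Suc i) (set_ix rI (Suc i) st''))"
        using if_ok[OF st1(1)] by (simp add: block_def)
    qed (use st1 in \<open>auto simp: I_def frame_def\<close>)
    show ?thesis
      by (rule run_cost, rule run_Seq, rule run_iset, rule run_Seq) (use count in \<open>simp_all, linarith?\<close>)
  qed
  have "run \<kappa> (loop rI IDim (iset rT (IC 0) ;; ?count ;; ?if)) (set_ix rM 0 st)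
     (?n * (1500 * (?n + 1) + icost IDim + 60) + icost IDim + 40) ?Q"
    by (rule run_loop[where I = I]) (use body in \<open>auto simp: I_def frame_def nonempty_labels_def\<close>)
  then show ?thesis
    unfolding count_prog_def
    by (intro run_cost[OF run_Seq[OF run_iset]]) (simp_all add: algebra_simps, linarith?)
qed

text \<open>The vectors start behind the number of blocks and the \<open>rM\<close> lengths. The
  cells written here may still contain input; everything required from it has been moved to the
  arrays.\<close>

definition emit_prog :: rcom where
  "emit_prog = iset rO (IAdd (IC 1) (IR rM)) ;;
     loop rI IDim (loop rJ IDim (label_eq
       (loop rK IDim (emit (IR rO) (VA aG (IR rJ) (IR rK)) ;; iset rO (IAdd (IR rO) (IC 1))))))"

definition row_list :: "state \<Rightarrow> nat \<Rightarrow> real list" where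
  "row_list st j = map (ar st aG j) [0..<dm st]"

definition emitted :: "state \<Rightarrow> real list \<Rightarrow> state \<Rightarrow> bool" where
  "emitted st xs st' \<longleftrightarrow> (\<exists>f g. st' = st\<lparr>ix := f, lo := g\<rparr> \<and> f rC = ix st rC \<and> f rM = ix st rM \<and>
     f rO = 1 + ix st rM + length xs \<and> (\<forall>x<length xs. g (1 + ix st rM + x) = xs ! x))"

lemma emitted_set_ix:
  assumes "emitted st xs st'" "x \<noteq> rC" "x \<noteq> rM" "x \<noteq> rO"
  shows "emitted st xs (set_ix x k st')"
proof -
  obtain f g where "st' = st\<lparr>ix := f, lo := g\<rparr>" "f rC = ix st rC" "f rM = ix st rM"
     "f rO = 1 + ix st rM + length xs" "\<forall>x<length xs. g (1 + ix st rM + x) = xs ! x"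
    using assms(1) unfolding emitted_def by blast
  then show ?thesis using assms(2-4)
    unfolding emitted_def by (intro exI[of _ "f(x := k)"] exI[of _ g]) simp
qed

lemma emitted_append:
  assumes "emitted st xs st'"
  shows "emitted st (xs @ [v]) (set_ix rO (ix st' rO + 1) (st'\<lparr>lo := (lo st')(ix st' rO := v)\<rparr>))"
proof -
  obtain f g where 1: "st' = st\<lparr>ix := f, lo := g\<rparr>" "f rC = ix st rC" "f rM = ix st rM"
     "f rO = 1 + ix st rM + length xs" "\<forall>x<length xs. g (1 + ix st rM + x) = xs ! x"
    using assms(1) unfolding emitted_def by blast
  then show ?thesis
    unfolding emitted_def
    by (intro exI[of _ "f(rO := f rO + 1)"] exI[of _ "g(f rO := v)"]) (auto simp: nth_append less_Suc_eq)
qed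

lemma length_concat_blocks:
  "length (concat (map (block n lab) [0..<i])) = card {m. m < n \<and> lab m < i}"
proof (induction i)
  case (Suc i)
  have "length (block n lab i) = card {m. m < n \<and> lab m = i}"
    by (subst distinct_card[symmetric]) (auto simp: set_block, simp add: block_def)
  moreover have "{m. m < n \<and> lab m < Suc i} = {m. m < n \<and> lab m < i} \<union> {m. m < n \<and> lab m = i}" by auto
  moreover have "card ({m. m < n \<and> lab m < i} \<union> {m. m < n \<and> lab m = i})
     = card {m. m < n \<and> lab m < i} + card {m. m < n \<and> lab m = i}"
    by (rule card_Un_disjoint) auto
  ultimately show ?case using Suc by simp
qed simp

lemma run_emit_prog:
  assumes lab: "\<forall>m<dm st. ar st aL 0 m = real (lab m)" and M: "1 \<le> ix st rM" "ix st rM \<le> dm st"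
  shows "run \<kappa> emit_prog st (3000 * (dm st + 1) * (dm st + 1) * (dm st + 1)) (\<lambda>st'.
     emitted st (concat (map (\<lambda>l. concat (map (row_list st) (block (dm st) lab l))) [0..<dm st])) st')"
    (is "run _ _ _ _ ?Q")
proof -
  let ?n = "dm st"
  \<comment> \<open>The output before label i, before row j of that label, and before column k of
    that row.\<close>
  define Z1 where "Z1 = (\<lambda>i. concat (map (\<lambda>l. concat (map (row_list st) (block ?n lab l))) [0..<i]))"
  define Z2 where "Z2 = (\<lambda>i j. Z1 i @ concat (map (row_list st) (filter (\<lambda>m. lab m = i) [0..<j])))"
  define Z3 where "Z3 = (\<lambda>i j k. Z2 i j @ map (ar st aG j) [0..<k])"
  have len_rows: "length (concat (map (row_list st) js)) = ?n * length js" for js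
    by (induction js) (auto simp: row_list_def)
  have len1: "length (Z1 i) = ?n * card {m. m < ?n \<and> lab m < i}" for i
  proof -
    have "Z1 i = concat (map (row_list st) (concat (map (block ?n lab) [0..<i])))"
      by (induction i) (simp_all add: Z1_def)
    then show ?thesis by (simp only: len_rows length_concat_blocks)
  qed
  \<comment> \<open>Row j and the rows written before it are different rows among n, so row j still
    fits into the \<open>n^2\<close> coordinate cells, which lie below \<open>base\<close>.\<close>
  have len2: "length (Z2 i j) + ?n \<le> ?n * ?n" if "j < ?n" "lab j = i" for i j
  proof -
    have "length (filter (\<lambda>m. lab m = i) [0..<j]) = card {m. m < j \<and> lab m = i}"
      by (subst distinct_card[symmetric]) (auto intro!: arg_cong[of _ _ card])
    then have "length (Z2 i j) + ?n = ?n * (card {m. m < ?n \<and> lab m < i} + card {m. m < j \<and> lab m = i} + 1)"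
      using len_rows by (simp add: Z2_def len1 algebra_simps)
    also have "card {m. m < ?n \<and> lab m < i} + card {m. m < j \<and> lab m = i} + 1
       = card ({m. m < ?n \<and> lab m < i} \<union> {m. m < j \<and> lab m = i} \<union> {j})"
      using that by (subst card_Un_disjoint, simp, simp, auto, subst card_Un_disjoint, auto)
    also have "\<dots> \<le> card {..<?n}" using that by (intro card_mono) auto
    finally show ?thesis by simp
  qed
  have inner: "run \<kappa> (loop rK IDim (emit (IR rO) (VA aG (IR rJ) (IR rK)) ;; iset rO (IAdd (IR rO) (IC 1)))) st2
     (?n * (400 + icost IDim + 60) + icost IDim + 40)
     (\<lambda>st''. ix st'' rI = i \<and> ix st'' rJ = j \<and> emitted st (Z2 i (Suc j)) st'')"
    if 2: "ix st2 rI = i" "ix st2 rJ = j" "emitted st (Z2 i j) st2" "j < ?n" "lab j = i" for i j st2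
  proof (rule run_loop[where I = "\<lambda>k st'. ix st' rI = i \<and> ix st' rJ = j \<and> emitted st (Z3 i j k) st'"])
    show "ix (set_ix rK 0 st2) rI = i \<and> ix (set_ix rK 0 st2) rJ = j \<and> emitted st (Z3 i j 0) (set_ix rK 0 st2)"
      using 2 emitted_set_ix[OF 2(3), of rK 0] by (simp add: Z3_def)
  next
    fix k st3 assume k: "k < ?n" "ix st3 rI = i \<and> ix st3 rJ = j \<and> emitted st (Z3 i j k) st3" "ix st3 rK = k"
    have em: "emitted st (Z3 i j k) st3" using k by simp
    have d: "ar st3 = ar st" "ix st3 rO = 1 + ix st rM + length (Z3 i j k)" "base st3 = base st"
      using em by (auto simp: emitted_def base_def)
    have "length (Z3 i j k) < ?n * ?n" using len2[OF 2(4,5)] k by (simp add: Z3_def)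
    then have b: "2 \<le> ix st3 rO" "ix st3 rO < base st3" using d M by (simp_all add: base_def)
    define st4 where "st4 = st3\<lparr>lo := (lo st3)(ix st3 rO := ar st aG j k)\<rparr>"
    have "emitted st (Z3 i j (Suc k)) (set_ix rO (ix st3 rO + 1) st4)"
      using emitted_append[OF em, of "ar st aG j k"] by (simp add: Z3_def st4_def)
    then have e4: "emitted st (Z3 i j (Suc k)) (set_ix rK (Suc k) (set_ix rO (ix st3 rO + 1) st4))"
      by (rule emitted_set_ix) simp_all
    have r4: "run \<kappa> (iset rO (IAdd (IR rO) (IC 1))) st4 40 (\<lambda>st''. ix st'' rK = k \<and>
      ix (set_ix rK (Suc k) st'') rI = i \<and> ix (set_ix rK (Suc k) st'') rJ = j \<and>
      emitted st (Z3 i j (Suc k)) (set_ix rK (Suc k) st''))"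
      by (rule run_cost, rule run_iset) (use e4 k in \<open>simp_all add: st4_def\<close>)
    have eq4: "st4 = st3\<lparr>lo := (lo st3)(ival (IR rO) st3 := vval (VA aG (IR rJ) (IR rK)) st3)\<rparr>"
      using k d by (simp add: st4_def)
    show "run \<kappa> (emit (IR rO) (VA aG (IR rJ) (IR rK)) ;; iset rO (IAdd (IR rO) (IC 1))) st3 400
      (\<lambda>st''. ix st'' rK = k \<and> ix (set_ix rK (Suc k) st'') rI = i \<and> ix (set_ix rK (Suc k) st'') rJ = j \<and>
       emitted st (Z3 i j (Suc k)) (set_ix rK (Suc k) st''))"
      by (rule run_cost, rule run_Seq, rule run_emit, rule r4[unfolded eq4]) (use b in \<open>simp_all add: ccost_def\<close>)
  next
    fix st' assume "ix st' rI = i \<and> ix st' rJ = j \<and> emitted st (Z3 i j ?n) st'"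
    then show "ix st' rI = i \<and> ix st' rJ = j \<and> emitted st (Z2 i (Suc j)) st'"
      using 2 by (simp add: Z3_def Z2_def row_list_def)
  qed (auto simp: emitted_def)
  let ?body = "label_eq (loop rK IDim (emit (IR rO) (VA aG (IR rJ) (IR rK)) ;; iset rO (IAdd (IR rO) (IC 1))))"
  have middle: "run \<kappa> (loop rJ IDim ?body) st1
     (?n * ((300 + (?n * (400 + icost IDim + 60) + icost IDim + 40)) + icost IDim + 60) + icost IDim + 40)
     (\<lambda>st''. ix st'' rI = i \<and> emitted st (Z1 (Suc i)) st'')"
    if 1: "ix st1 rI = i" "emitted st (Z1 i) st1" for i st1
  proof (rule run_loop[where I = "\<lambda>j st'. ix st' rI = i \<and> emitted st (Z2 i j) st'"])
    show "ix (set_ix rJ 0 st1) rI = i \<and> emitted st (Z2 i 0) (set_ix rJ 0 st1)"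
      using 1 emitted_set_ix[OF 1(2), of rJ 0] by (simp add: Z2_def)
  next
    fix j st2 assume j: "j < ?n" "ix st2 rI = i \<and> emitted st (Z2 i j) st2" "ix st2 rJ = j"
    have L: "ar st2 aL 0 (ix st2 rJ) = real (lab j)"
      using j lab by (auto simp: emitted_def)
    show "run \<kappa> ?body st2 (300 + (?n * (400 + icost IDim + 60) + icost IDim + 40))
      (\<lambda>st''. ix st'' rJ = j \<and> ix (set_ix rJ (Suc j) st'') rI = i \<and>
        emitted st (Z2 i (Suc j)) (set_ix rJ (Suc j) st''))"
    proof (rule run_label_eq[OF L])
      assume "lab j = ix st2 rI"
      then have "lab j = i" using j by simp
      from inner[of st2 i j] this j
      have "run \<kappa> (loop rK IDim (emit (IR rO) (VA aG (IR rJ) (IR rK)) ;; iset rO (IAdd (IR rO) (IC 1)))) st2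
         (?n * (400 + icost IDim + 60) + icost IDim + 40)
         (\<lambda>st''. ix st'' rI = i \<and> ix st'' rJ = j \<and> emitted st (Z2 i (Suc j)) st'')" by simp
      then show "run \<kappa> (loop rK IDim (emit (IR rO) (VA aG (IR rJ) (IR rK)) ;; iset rO (IAdd (IR rO) (IC 1)))) st2
         (?n * (400 + icost IDim + 60) + icost IDim + 40)
         (\<lambda>st''. ix st'' rJ = j \<and> ix (set_ix rJ (Suc j) st'') rI = i \<and>
           emitted st (Z2 i (Suc j)) (set_ix rJ (Suc j) st''))"
        by (rule run_post) (auto intro: emitted_set_ix)
    next
      assume "lab j \<noteq> ix st2 rI"
      then have "Z2 i (Suc j) = Z2 i j" using j by (simp add: Z2_def)
      then show "ix st2 rJ = j \<and> ix (set_ix rJ (Suc j) st2) rI = i \<and>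
        emitted st (Z2 i (Suc j)) (set_ix rJ (Suc j) st2)"
        using j emitted_set_ix[of st "Z2 i j" st2 rJ "Suc j"] by simp
    qed
  next
    fix st' assume "ix st' rI = i \<and> emitted st (Z2 i ?n) st'"
    then show "ix st' rI = i \<and> emitted st (Z1 (Suc i)) st'" by (simp add: Z2_def Z1_def block_def)
  qed (auto simp: emitted_def)
  have start: "emitted st [] (set_ix rO (1 + ix st rM) st)"
    unfolding emitted_def by (intro exI[of _ "(ix st)(rO := 1 + ix st rM)"] exI[of _ "lo st"]) simp
  have "run \<kappa> (loop rI IDim (loop rJ IDim ?body)) (set_ix rO (1 + ix st rM) st)
     (?n * ((?n * ((300 + (?n * (400 + icost IDim + 60) + icost IDim + 40)) + icost IDim + 60) + icost IDim + 40)
        + icost IDim + 60) + icost IDim + 40) ?Q"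
  proof (rule run_loop[where I = "\<lambda>i st'. emitted st (Z1 i) st'"])
    show "emitted st (Z1 0) (set_ix rI 0 (set_ix rO (1 + ix st rM) st))"
      using emitted_set_ix[OF start, of rI 0] by (simp add: Z1_def)
  next
    fix i st1 assume i: "emitted st (Z1 i) st1" "ix st1 rI = i"
    show "run \<kappa> (loop rJ IDim ?body) st1
     (?n * ((300 + (?n * (400 + icost IDim + 60) + icost IDim + 40)) + icost IDim + 60) + icost IDim + 40)
     (\<lambda>st''. ix st'' rI = i \<and> emitted st (Z1 (Suc i)) (set_ix rI (Suc i) st''))"
      by (rule run_post[OF middle[OF i(2,1)]]) (auto intro: emitted_set_ix)
  qed (auto simp: emitted_def Z1_def)
  then show ?thesis
    unfolding emit_prog_def
    by (intro run_cost[OF run_Seq[OF run_iset]]) (simp_all add: algebra_simps, linarith?)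
qed

text \<open>Registers and arrays can be located only while cells 0 and 1 are intact. So the first
  length, which belongs in cell 1, is left out here, and the number of blocks is parked at address
  \<open>1 + n + n^2\<close>, beyond the output and below \<open>base\<close>.\<close>

definition tail_prog :: rcom where
  "tail_prog = loop rI (IR rM)
     (ifless (VN 0) (VI (IR rI)) (emit (IAdd (IC 1) (IR rI)) (VA aV (IC 0) (IR rI))) Skip) ;;
     emit (IAdd (IC 1) (IAdd IDim (IMul IDim IDim))) (VI (IR rM))"

lemma run_tail_prog:
  assumes M: "ix st rM = M" "1 \<le> M" "M \<le> dm st"
    and xs: "length xs \<le> dm st * dm st" "\<forall>x<length xs. lo st (1 + M + x) = xs ! x"
  shows "run \<kappa> tail_prog st (1000 * (dm st + 1)) (\<lambda>st'. dm st' = dm st \<and> ix st' rC = ix st rC \<and>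
     ar st' = ar st \<and> (\<forall>x. 1 \<le> x \<and> x < M \<longrightarrow> lo st' (1 + x) = ar st aV 0 x) \<and>
     (\<forall>x<length xs. lo st' (1 + M + x) = xs ! x) \<and> lo st' (1 + (dm st + dm st * dm st)) = real M)"
    (is "run _ _ _ _ ?Q")
proof -
  let ?n = "dm st"
  define I :: "nat \<Rightarrow> state \<Rightarrow> bool" where "I = (\<lambda>k st'. dm st' = ?n \<and> cn st' = cn st \<and> ix st' rC = ix st rC \<and> ix st' rM = M \<and>
     ar st' = ar st \<and> (\<forall>x. 1 \<le> x \<and> x < k \<longrightarrow> lo st' (1 + x) = ar st aV 0 x) \<and>
     (\<forall>x<length xs. lo st' (1 + M + x) = xs ! x))"
  let ?last = "emit (IAdd (IC 1) (IAdd IDim (IMul IDim IDim))) (VI (IR rM))"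
  have last: "run \<kappa> ?last st' 50 ?Q" if I: "I M st'" for st'
  proof (rule run_cost, rule run_emit)
    have "1 + M + x \<noteq> 1 + (?n + ?n * ?n)" if "x < length xs" for x using that M xs(1) by linarith
    moreover have "1 + x \<noteq> 1 + (?n + ?n * ?n)" if "x < M" for x using that M by linarith
    ultimately show "?Q (st'\<lparr>lo := (lo st')(ival (IAdd (IC 1) (IAdd IDim (IMul IDim IDim))) st' :=
        vval (VI (IR rM)) st')\<rparr>)"
      using I by (simp add: I_def)
  qed (use I M in \<open>simp_all add: I_def base_def\<close>)
  have "run \<kappa> (loop rI (IR rM)
     (ifless (VN 0) (VI (IR rI)) (emit (IAdd (IC 1) (IR rI)) (VA aV (IC 0) (IR rI))) Skip)) st
     (M * (400 + icost (IR rM) + 60) + icost (IR rM) + 40) (\<lambda>st'. run \<kappa> ?last st' 50 ?Q)"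
  proof (rule run_loop[where I = I])
    fix k st' assume k: "k < M" "I k st'" "ix st' rI = k"
    have b: "1 + k < base st'" using k M by (simp add: base_def I_def)
    show "run \<kappa> (ifless (VN 0) (VI (IR rI)) (emit (IAdd (IC 1) (IR rI)) (VA aV (IC 0) (IR rI))) Skip) st' 400
      (\<lambda>st''. ix st'' rI = k \<and> I (Suc k) (set_ix rI (Suc k) st''))"
    proof (cases "k = 0")
      case True
      then have "I (Suc k) (set_ix rI (Suc k) st')" using k by (simp add: I_def)
      then show ?thesis
        by (intro run_cost[OF run_ifless_false[OF _ run_Skip]]) (use k True in simp_all)
    next
      case False
      define st2 where "st2 = st'\<lparr>lo := (lo st')(1 + k := ar st aV 0 k)\<rparr>"
      have "I (Suc k) (set_ix rI (Suc k) st2)" using k by (auto simp: I_def st2_def less_Suc_eq)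
      moreover have "st'\<lparr>lo := (lo st')(ival (IAdd (IC 1) (IR rI)) st' := vval (VA aV (IC 0) (IR rI)) st')\<rparr> = st2"
        using k by (simp add: st2_def I_def)
      ultimately have "run \<kappa> (emit (IAdd (IC 1) (IR rI)) (VA aV (IC 0) (IR rI))) st'
         (icost (IAdd (IC 1) (IR rI)) + vcost (VA aV (IC 0) (IR rI)) + 1)
         (\<lambda>st''. ix st'' rI = k \<and> I (Suc k) (set_ix rI (Suc k) st''))"
        using k b False by (intro run_emit) (simp_all add: st2_def)
      then have "run \<kappa> (ifless (VN 0) (VI (IR rI)) (emit (IAdd (IC 1) (IR rI)) (VA aV (IC 0) (IR rI))) Skip) st'
         (vcost (VN 0) + vcost (VI (IR rI)) + 1 + (icost (IAdd (IC 1) (IR rI)) + vcost (VA aV (IC 0) (IR rI)) + 1))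
         (\<lambda>st''. ix st'' rI = k \<and> I (Suc k) (set_ix rI (Suc k) st''))"
        using k False by (intro run_ifless_true) simp_all
      then show ?thesis by (rule run_cost) (simp add: ccost_def)
    qed
  qed (use M xs last in \<open>auto simp: I_def\<close>)
  then have "run \<kappa> tail_prog st ((M * (400 + icost (IR rM) + 60) + icost (IR rM) + 40) + 50) ?Q"
    unfolding tail_prog_def by (rule run_Seq)
  then show ?thesis
  proof (rule run_cost)
    have "M * 479 \<le> ?n * 479" using M(3) by (rule mult_le_mono1)
    then show "(M * (400 + icost (IR rM) + 60) + icost (IR rM) + 40) + 50 \<le> 1000 * (?n + 1)" by simp
  qed
qed

section \<open>Correctness of the blocks\<close>

lemma concat_blocks:
  "concat (blocks n lab b) = concat (map (\<lambda>l. map b (block n lab l)) [0..<n])"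
proof -
  have "concat (map (\<lambda>l. map b (block n lab l)) (filter (\<lambda>l. block n lab l \<noteq> []) xs))
    = concat (map (\<lambda>l. map b (block n lab l)) xs)" for xs
    by (induction xs) auto
  then show ?thesis by (simp add: blocks_def)
qed

lemma length_blocks: "length (blocks n lab b) = length (nonempty_labels n lab n)"
  by (simp add: blocks_def nonempty_labels_def)

lemma nth_blocks:
  assumes "x < length (nonempty_labels n lab n)"
  shows "blocks n lab b ! x = map b (block n lab (nonempty_labels n lab n ! x))"
  using assms by (simp add: blocks_def nonempty_labels_def)

context lattice_coords
begin

text \<open>The rows lie in \<open>L\<close> by \<open>good\<close>. Conversely each vector of
  \<open>S\<close> is an integer combination of rows in coordinates, hence also as a vector, and
  \<open>S\<close> generates \<open>L\<close>.\<close>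

lemma rows_span:
  assumes H: "good H" "\<forall>r<s. lat n H (X r)"
    and X: "\<And>r j. r < s \<Longrightarrow> j < n \<Longrightarrow> X r j = vs ! r \<bullet> a j"
  shows "L = int_span n ((\<lambda>i. comb n {..<n} (H i) w) ` {..<n})"
proof (rule equalityI)
  let ?b = "\<lambda>i. comb n {..<n} (H i) w"
  have sub: "?b ` {..<n} \<subseteq> carrier_vec n" by auto
  show "int_span n (?b ` {..<n}) \<subseteq> L"
    by (rule int_span_least[OF L_module]) (use H(1) in \<open>auto simp: good_def\<close>)
  have "vs ! r \<in> int_span n (?b ` {..<n})" if r: "r < s" for r
  proof -
    obtain c :: "nat \<Rightarrow> int" where c: "\<forall>j<n. X r j = (\<Sum>i<n. of_int (c i) * H i j)"
      using H(2) r unfolding lat_def by blast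
    have v: "vs ! r = comb n {..<n} (\<lambda>p. vs ! r \<bullet> a p) w"
      by (rule dual_expansion[OF w_carrier a_carrier w_dual vs_carrier[OF r]])
    have "vs ! r = comb n {..<n} (\<lambda>i. of_int (c i)) ?b"
    proof (rule eq_vecI)
      fix m assume "m < dim_vec (comb n {..<n} (\<lambda>i. of_int (c i)) ?b)"
      then have m: "m < n" by simp
      have "vs ! r $ m = (\<Sum>p<n. (vs ! r \<bullet> a p) * w p $ m)"
        using arg_cong[OF v, of "\<lambda>v. v $ m"] m by simp
      also have "\<dots> = (\<Sum>p<n. (\<Sum>i<n. of_int (c i) * H i p) * w p $ m)"
        using X[OF r] c by (intro sum.cong) auto
      also have "\<dots> = (\<Sum>p<n. \<Sum>i<n. of_int (c i) * (H i p * w p $ m))"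
        by (simp add: sum_distrib_right mult.assoc)
      also have "\<dots> = (\<Sum>i<n. of_int (c i) * (\<Sum>p<n. H i p * w p $ m))"
        by (subst sum.swap) (simp add: sum_distrib_left)
      finally show "vs ! r $ m = comb n {..<n} (\<lambda>i. of_int (c i)) ?b $ m" using m by simp
    qed (use vs_carrier[OF r] in simp)
    then show ?thesis
      unfolding int_span_family[OF finite_lessThan sub] by (rule range_eqI[where x = c])
  qed
  then have "set vs \<subseteq> int_span n (?b ` {..<n})" by (auto simp: in_set_conv_nth)
  then show "L \<subseteq> int_span n (?b ` {..<n})"
    using int_span_least[OF int_module_int_span[OF _ sub]] generates by auto
qed

definition (in lattice_input) decomposition :: "real vec list list \<Rightarrow> bool" where
  "decomposition Bs \<longleftrightarrow> (\<exists>Ls. list_all2 (lattice_basis n) Bs Ls \<and> (\<forall>M\<in>set Ls. indecomposable n M) \<and>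
     orthogonal_direct_sum n L Ls)"

lemma decomposition_blocks:
  assumes H: "good H" "\<forall>r<s. lat n H (X r)"
    and red: "\<forall>i<n. \<forall>j<n. i < j \<longrightarrow> reduced H i j"
    and X: "\<And>r j. r < s \<Longrightarrow> j < n \<Longrightarrow> X r j = vs ! r \<bullet> a j"
    and b: "\<And>i. i < n \<Longrightarrow> b i = comb n {..<n} (H i) w"
    and lab: "\<And>i. i < n \<Longrightarrow> lab i < n"
    and edge: "\<And>i j. i < n \<Longrightarrow> j < n \<Longrightarrow> b i \<bullet> b j \<noteq> 0 \<Longrightarrow> lab i = lab j"
    and conn: "\<And>i j. i < n \<Longrightarrow> j < n \<Longrightarrow> lab i = lab j \<Longrightarrow>
      (i, j) \<in> {(i, j). i < n \<and> j < n \<and> b i \<bullet> b j \<noteq> 0}\<^sup>*"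
  shows "decomposition (blocks n lab b)"
proof -
  have tri: "\<And>i j. i < n \<Longrightarrow> j < i \<Longrightarrow> H i j = 0" and diag: "\<And>i. i < n \<Longrightarrow> H i i \<noteq> 0"
    using H(1) by (auto simp: good_def)
  have red': "- 1 / 2 \<le> H i j / H j j \<and> H i j / H j j < 1 / 2" if "i < j" "j < n" for i j
    using red that by (auto simp: reduced_def)
  have bc: "b i \<in> carrier_vec n" if "i < n" for i using b[OF that] by simp
  obtain d where d: "\<And>i. i < n \<Longrightarrow> d i \<in> carrier_vec n"
    "\<And>i j. i < n \<Longrightarrow> j < n \<Longrightarrow> comb n {..<n} (H i) w \<bullet> d j = (if i = j then 1 else 0)"
    using triangular_dual[where n = n and w = w and a = a and H = H, OF w_carrier a_carrier w_dual tri diag]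
    by blast
  have bd: "b i \<bullet> d j = (if i = j then 1 else 0)" if "i < n" "j < n" for i j
    using d(2)[OF that] b[OF that(1)] by simp
  have bnz: "b i \<noteq> 0\<^sub>v n" if "i < n" for i
    using bd[OF that that] d(1)[OF that] by auto
  have L': "L = int_span n ((\<lambda>i. comb n {..<n} (H i) w) ` {..<n})" by (rule rows_span[OF H X])
  have Lb: "L = int_span n (b ` {..<n})"
    unfolding L' using b by (intro arg_cong[where f = "int_span n"] image_cong) auto
  have split: "b i \<in> A \<or> b i \<in> C"
    if AC: "A \<subseteq> L" "C \<subseteq> L" and orth: "\<And>x y. x \<in> A \<Longrightarrow> y \<in> C \<Longrightarrow> x \<bullet> y = 0"
      and sp: "\<And>z. z \<in> L \<Longrightarrow> \<exists>x\<in>A. \<exists>y\<in>C. z = x + y" and i: "i < n" for A C i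
  proof -
    \<comment> \<open>Irreducibility kills one of the two parts, so \<open>w p\<close> equals the
      other.\<close>
    have w: "w p \<in> A \<or> w p \<in> C" if p: "p < n" for p
    proof -
      obtain x y where xy: "x \<in> A" "y \<in> C" "w p = x + y" using sp[OF w_L[OF p]] by blast
      then have "x = 0\<^sub>v n \<or> y = 0\<^sub>v n"
        using w_irred[OF p] AC orth[OF xy(1,2)] unfolding irred_def by blast
      moreover have "x \<in> carrier_vec n" "y \<in> carrier_vec n" using xy AC L_carrier by auto
      ultimately show ?thesis using xy by auto
    qed
    show ?thesis
      unfolding b[OF i]
      by (rule reduced_row_split[OF w_carrier a_carrier w_dual tri diag red' L' AC orth sp w i])
  qed
  define Ls where "Ls = map (\<lambda>bs. int_span n (set bs)) (blocks n lab b)"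
  have Ls: "Ls = map (\<lambda>l. int_span n (b ` {i. i < n \<and> lab i = l})) (filter (\<lambda>l. block n lab l \<noteq> []) [0..<n])"
    by (simp add: Ls_def blocks_def set_block)
  have basis: "lattice_basis n (map b (block n lab l)) (int_span n (b ` {i. i < n \<and> lab i = l}))" for l
    by (rule blocks_lattice_basis[OF bc d(1) bd])
  have "list_all2 (lattice_basis n) (blocks n lab b) Ls"
    unfolding Ls blocks_def by (simp add: list_all2_conv_all_nth basis)
  moreover have "indecomposable n M" if "M \<in> set Ls" for M
  proof -
    obtain l where l: "M = int_span n (b ` {i. i < n \<and> lab i = l})" "block n lab l \<noteq> []"
      using \<open>M \<in> set Ls\<close> unfolding Ls by auto
    then obtain i0 where "i0 < n" "lab i0 = l" using set_block[of n lab l] by (metis (mono_tags, lifting) list.set_intros(1) mem_Collect_eq neq_Nil_conv)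
    moreover have "is_lattice n M" unfolding l(1) is_lattice_def using basis by blast
    ultimately show ?thesis
      by (intro block_indecomposable[OF bc bnz Lb edge conn split l(1)])
  qed
  moreover have "orthogonal_direct_sum n L Ls"
    unfolding Ls_def by (rule blocks_direct_sum[OF bc Lb lab edge])
  ultimately show ?thesis unfolding decomposition_def by blast
qed

text \<open>The \<open>w p\<close> are distinct members of \<open>S\<close>. This lets
  \<open>s n^2\<close> absorb the O(n^3) work done after the insertion.\<close>

lemma n_le_s: "n \<le> s"
proof -
  have "inj_on w {..<n}" by (rule inj_on_dual[where d = a]) (use w_dual in auto)
  then have "n = card (w ` {..<n})" by (simp add: card_image)
  also have "\<dots> \<le> card (set vs)"
  proof (rule card_mono)
    show "w ` {..<n} \<subseteq> set vs"
    proof (rule image_subsetI)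
      fix p assume "p \<in> {..<n}"
      then obtain r where "r < s" "w p = vs ! r" using w_vs[of p] by auto
      then show "w p \<in> set vs" by simp
    qed
  qed simp
  also have "\<dots> = s" using distinct_vs by (rule distinct_card)
  finally show ?thesis .
qed

end

section \<open>The complete program\<close>

definition rest_prog :: rcom where
  "rest_prog = insert_prog ;; reduce_prog ;; product_prog ;; component_prog ;;
     count_prog ;; emit_prog ;; tail_prog"

text \<open>The situation just before the last two stores: the first length is still in
  \<open>aV\<close>, and the number of blocks is in its parking cell.\<close>

definition written :: "nat \<Rightarrow> real vec list list \<Rightarrow> state \<Rightarrow> bool" where
  "written n Bs st \<longleftrightarrow> 1 \<le> length Bs \<and> length Bs \<le> n \<and> ar st aV 0 0 = real (length (Bs ! 0)) \<and>
     (\<forall>x. 1 \<le> x \<and> x < length Bs \<longrightarrow> lo st (1 + x) = real (length (Bs ! x))) \<and>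
     (\<forall>x<length (concat (map list_of_vec (concat Bs))).
        lo st (1 + length Bs + x) = concat (map list_of_vec (concat Bs)) ! x) \<and>
     lo st (1 + (n + n * n)) = real (length Bs) \<and>
     length (concat (map list_of_vec (concat Bs))) \<le> n * n"

lemma coordinates_blocks:
  assumes "\<And>i. b i = vec (dm st) (ar st aG i)"
  shows "concat (map list_of_vec (concat (blocks n lab b)))
    = concat (map (\<lambda>l. concat (map (row_list st) (block n lab l))) [0..<n])"
proof -
  have "list_of_vec \<circ> b = row_list st" by (simp add: assms row_list_def fun_eq_iff)
  then have "concat (map list_of_vec (concat (map (\<lambda>l. map b (block n lab l)) ls)))
    = concat (map (\<lambda>l. concat (map (row_list st) (block n lab l))) ls)" for ls
    by (induction ls) simp_all
  then show ?thesis by (simp add: concat_blocks)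
qed

lemma length_coordinates:
  "length (concat (map (\<lambda>l. concat (map (row_list st) (block (dm st) lab l))) [0..<dm st])) \<le> dm st * dm st"
proof -
  have rows: "length (concat (map (row_list st) js)) = dm st * length js" for js
    by (induction js) (auto simp: row_list_def)
  have "concat (map (\<lambda>l. concat (map (row_list st) (block (dm st) lab l))) ls)
    = concat (map (row_list st) (concat (map (block (dm st) lab) ls)))" for ls
    by (induction ls) simp_all
  then have "length (concat (map (\<lambda>l. concat (map (row_list st) (block (dm st) lab l))) [0..<dm st]))
    = dm st * card {m. m < dm st \<and> lab m < dm st}"
    by (simp only: rows length_concat_blocks)
  also have "card {m. m < dm st \<and> lab m < dm st} \<le> card {..<dm st}" by (rule card_mono) auto
  finally show ?thesis by simp
qed

context lattice_coords
begin

definition (in lattice_input) final :: "state \<Rightarrow> bool" where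
  "final st \<longleftrightarrow> dm st = n \<and> 2 ^ ix st rC \<le> covol_bound \<and> (\<exists>Bs. decomposition Bs \<and> written n Bs st)"

lemma run_output_progs:
  assumes n: "1 \<le> n" and st: "dm st = n" "2 ^ ix st rC \<le> covol_bound"
    and lab: "\<forall>m<n. lab m < n \<and> ar st aL 0 m = real (lab m)"
    and b: "\<And>i. b i = vec n (ar st aG i)" and dec: "decomposition (blocks n lab b)"
  shows "run \<kappa> (count_prog ;; emit_prog ;; tail_prog) st
    (2000 * (n + 1) * (n + 1) + (3000 * (n + 1) * (n + 1) * (n + 1) + 1000 * (n + 1))) final"
proof (rule run_Seq, rule run_post)
  let ?ls = "nonempty_labels n lab n" and ?Bs = "blocks n lab b"
  let ?C = "\<lambda>st'. frame {rI, rJ, rT, rM} {aV} st st' \<and> ix st' rM = length ?ls \<and>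
     (\<forall>x<ix st' rM. ar st' aV 0 x = real (length (block n lab (?ls ! x))))"
  show "run \<kappa> count_prog st (2000 * (n + 1) * (n + 1)) ?C"
    using run_count_prog[of st lab \<kappa>] lab by (simp add: st)
  fix st1 assume 1: "?C st1"
  define M where "M = length ?ls"
  \<comment> \<open>Index 0 has a label, so there is at least one block; then the vectors start at
    address 2 or later and cells 0 and 1 stay untouched.\<close>
  have "0 \<in> set (block n lab (lab 0))" using n by (simp add: set_block)
  then have "lab 0 \<in> set ?ls" using lab n by (auto simp: nonempty_labels_def)
  then have M: "1 \<le> M" unfolding M_def by (cases ?ls) auto
  have Mn: "M \<le> n" unfolding M_def nonempty_labels_def by (metis diff_zero length_filter_le length_upt)
  have d1: "dm st1 = n" "ix st1 rM = M" "ix st1 rC = ix st rC" "ar st1 aL = ar st aL" "ar st1 aG = ar st aG"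
    "\<And>x. x < M \<Longrightarrow> ar st1 aV 0 x = real (length (block n lab (?ls ! x)))"
    using 1 st by (auto simp: frame_def M_def)
  define zs where "zs = concat (map (\<lambda>l. concat (map (row_list st1) (block n lab l))) [0..<n])"
  have zs: "zs = concat (map list_of_vec (concat ?Bs))"
    unfolding zs_def by (rule coordinates_blocks[symmetric]) (simp add: b d1)
  have len: "length zs \<le> n * n" using length_coordinates[of st1 lab] by (simp add: zs_def d1)
  show "run \<kappa> (emit_prog ;; tail_prog) st1 (3000 * (n + 1) * (n + 1) * (n + 1) + 1000 * (n + 1)) final"
  proof (rule run_Seq, rule run_post)
    show "run \<kappa> emit_prog st1 (3000 * (n + 1) * (n + 1) * (n + 1)) (emitted st1 zs)"
      using run_emit_prog[of st1 lab \<kappa>] lab M Mn by (simp add: d1 zs_def)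
    fix st2 assume 2: "emitted st1 zs st2"
    then have d2: "dm st2 = n" "ix st2 rM = M" "ix st2 rC = ix st rC" "ar st2 = ar st1"
      "\<forall>x<length zs. lo st2 (1 + M + x) = zs ! x"
      using d1 by (auto simp: emitted_def)
    show "run \<kappa> tail_prog st2 (1000 * (n + 1)) final"
    proof (rule run_post)
      show "run \<kappa> tail_prog st2 (1000 * (n + 1)) (\<lambda>st'. dm st' = n \<and> ix st' rC = ix st2 rC \<and>
        ar st' = ar st2 \<and> (\<forall>x. 1 \<le> x \<and> x < M \<longrightarrow> lo st' (1 + x) = ar st2 aV 0 x) \<and>
        (\<forall>x<length zs. lo st' (1 + M + x) = zs ! x) \<and> lo st' (1 + (n + n * n)) = real M)"
        using run_tail_prog[of st2 M zs \<kappa>] M Mn len d2 by simp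
      fix st3 :: state assume 3: "dm st3 = n \<and> ix st3 rC = ix st2 rC \<and>
        ar st3 = ar st2 \<and> (\<forall>x. 1 \<le> x \<and> x < M \<longrightarrow> lo st3 (1 + x) = ar st2 aV 0 x) \<and>
        (\<forall>x<length zs. lo st3 (1 + M + x) = zs ! x) \<and> lo st3 (1 + (n + n * n)) = real M"
      have lb: "length (?Bs ! x) = length (block n lab (?ls ! x))" if "x < M" for x
        using nth_blocks[of x n lab b] that by (simp add: M_def)
      have "written n ?Bs st3"
        unfolding written_def zs[symmetric] length_blocks M_def[symmetric]
        using 3 M Mn d1(6) d2(4) lb len by simp
      then show "final st3" using 3 d2(3) st(2) dec unfolding final_def by auto
    qed
  qed
qed

lemma run_rest_prog:
  assumes n: "1 \<le> n" and \<kappa>: "4000 * (n + 1) \<le> \<kappa>"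
    and st: "dm st = n" "cn st = s" "ix st rC = 0"
    and X: "\<And>r j. r < s \<Longrightarrow> j < n \<Longrightarrow> ar st aX r j = vs ! r \<bullet> a j"
    and W: "w = (\<lambda>p. vec n (ar st aW p))"
  shows "run \<kappa> rest_prog st (40000 * (s + 1) * (n + 1) * (n + 1)) final"
proof -
  let ?T7 = "2000 * (n + 1) * (n + 1) + (3000 * (n + 1) * (n + 1) * (n + 1) + 1000 * (n + 1))"
  let ?T6 = "4000 * (n + 1) * (n + 1) * (n + 1) + ?T7"
  let ?T5 = "2000 * (n + 1) * (n + 1) * (n + 1) + ?T6"
  let ?T4 = "3000 * (n + 1) * (n + 1) * (n + 1) + ?T5"
  have "run \<kappa> rest_prog st (20000 * (s + 1) * (n + 1) * (n + 1) + ?T4) final"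
    unfolding rest_prog_def
  proof (rule run_Seq, rule run_post[OF run_insert_prog[OF st \<kappa> X]])
    fix st1 assume 1: "lat_inv s st1 \<and> frame {rR, rI, rJ, rC} {aD, aA, aM, aH} st st1"
    then have d1: "dm st1 = n" "ar st1 aX = ar st aX" "ar st1 aW = ar st aW"
      "good (ar st1 aH)" "\<forall>r<s. lat n (ar st1 aH) (ar st1 aX r)"
      using st by (auto simp: frame_def lat_inv_def)
    have cnt: "2 ^ ix st1 rC \<le> covol_bound"
      using 1 exchange_count unfolding lat_inv_def by blast
    show "run \<kappa> (reduce_prog ;; product_prog ;; component_prog ;; count_prog ;; emit_prog ;; tail_prog) st1 ?T4 final"
    proof (rule run_Seq, rule run_post[OF run_reduce_prog[OF d1(1,4,5)]])
      fix st2 assume 2: "reduced_inv n 0 st2 \<and> frame {rI, rJ, rK} {aD, aH} st1 st2"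
      then have d2: "dm st2 = n" "ar st2 aX = ar st aX" "ar st2 aW = ar st aW" "ix st2 rC = ix st1 rC"
        using d1 by (auto simp: frame_def)
      show "run \<kappa> (product_prog ;; component_prog ;; count_prog ;; emit_prog ;; tail_prog) st2 ?T5 final"
      proof (rule run_Seq, rule run_post[OF run_product_prog[of \<kappa> st2, unfolded d2(1)]])
        fix st3 :: state assume 3: "frame {rI, rJ, rK} {aG} st2 st3 \<and>
          (\<forall>i<n. \<forall>k<n. ar st3 aG i k = (\<Sum>j<n. ar st2 aH i j * ar st2 aW j k))"
        then have d3: "dm st3 = n" "ix st3 rC = ix st1 rC" using d2 by (auto simp: frame_def)
        show "run \<kappa> (component_prog ;; count_prog ;; emit_prog ;; tail_prog) st3 ?T6 final"
        proof (rule run_Seq, rule run_post[OF run_component_prog[of \<kappa> st3, unfolded d3(1)]])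
          fix st4 assume 4: "frame {rI, rJ, rK} {aL, aD, aM} st3 st4 \<and>
            (\<exists>lab. labels_inv (edges st3) (\<lambda>_. True) lab st4)"
          then obtain lab where lab: "labels_inv (edges st3) (\<lambda>_. True) lab st4" by blast
          have d4: "dm st4 = n" "ix st4 rC = ix st1 rC" "ar st4 aG = ar st3 aG"
            using 4 d3 by (auto simp: frame_def)
          define b where "b = (\<lambda>i. vec n (ar st4 aG i))"
          have b: "b i = comb n {..<n} (ar st2 aH i) w" if "i < n" for i
          proof (rule eq_vecI)
            fix k assume "k < dim_vec (comb n {..<n} (ar st2 aH i) w)"
            then have k: "k < n" by simp
            then show "b i $ k = comb n {..<n} (ar st2 aH i) w $ k"
              using 3 that by (simp add: b_def d4 W d2)
          qed (simp add: b_def)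
          have prod: "b i \<bullet> b k = (\<Sum>j<n. ar st3 aG i j * ar st3 aG k j)" for i k
            by (simp add: b_def d4 scalar_prod_def atLeast0LessThan)
          have E: "edges st3 = {(i, k). i < n \<and> k < n \<and> b i \<bullet> b k \<noteq> 0}"
            by (simp add: edges_def d3 prod)
          have "decomposition (blocks n lab b)"
          proof (rule decomposition_blocks[where H = "ar st2 aH" and X = "ar st2 aX"])
            show "good (ar st2 aH)" "\<forall>r<s. lat n (ar st2 aH) (ar st2 aX r)"
              "\<forall>i<n. \<forall>j<n. i < j \<longrightarrow> reduced (ar st2 aH) i j"
              using 2 by (auto simp: reduced_inv_def)
            show "ar st2 aX r j = vs ! r \<bullet> a j" if "r < s" "j < n" for r j using X[OF that] d2 by simp
            show "lab i < n" if "i < n" for i using lab that d4 by (simp add: labels_inv_def)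
            show "lab i = lab j" if "i < n" "j < n" "b i \<bullet> b j \<noteq> 0" for i j
              using lab that E unfolding labels_inv_def by blast
            show "(i, j) \<in> {(i, j). i < n \<and> j < n \<and> b i \<bullet> b j \<noteq> 0}\<^sup>*"
              if "i < n" "j < n" "lab i = lab j" for i j
              using lab that d4 unfolding E[symmetric] labels_inv_def by simp
          qed (rule b)
          then show "run \<kappa> (count_prog ;; emit_prog ;; tail_prog) st4 ?T7 final"
            using lab d4 cnt by (intro run_output_progs[OF n, where b = b and lab = lab])
              (auto simp: labels_inv_def b_def)
        qed
      qed
    qed
  qed
  then show ?thesis
  proof (rule run_cost)
    let ?m = "(n + 1) * (n + 1)"
    have "(n + 1) * ?m \<le> (s + 1) * ?m" using n_le_s by (intro mult_le_mono1) simp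
    moreover have "1 * ?m \<le> (s + 1) * ?m" by (rule mult_le_mono1) simp
    moreover have "(n + 1) * 1 \<le> (n + 1) * (n + 1)" by (rule mult_le_mono2) simp
    ultimately show "20000 * (s + 1) * (n + 1) * (n + 1) + ?T4 \<le> 40000 * (s + 1) * (n + 1) * (n + 1)"
      unfolding mult.assoc by linarith
  qed
qed

end

text \<open>The last two stores leave the source language because they destroy cells 1 and 0. The
  first still computes \<open>base\<close> and needs both cells. The address read by the second
  depends on cell 0 alone, which holds the dimension until the store takes effect.\<close>

definition decompose_prog :: rcom where
  "decompose_prog = (load_prog ;; choose_prog ;; rest_prog) ;;
     (Store (Num 1) (vcomp (VA aV (IC 0) (IC 0))) ;;
      Store (Num 0) (Mem (Plus (Num 1) (Plus (Mem (Num 0)) (Times (Mem (Num 0)) (Mem (Num 0)))))))"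

definition initial_state :: "nat \<Rightarrow> real \<Rightarrow> real vec list \<Rightarrow> state" where
  "initial_state n B vs = \<lparr>dm = n, cn = length vs, ix = (\<lambda>_. 0), ar = (\<lambda>_ _ _. 0),
     lo = load (encode_input n B vs)\<rparr>"

context lattice_input
begin

lemma length_coordinate_lists: "length (concat (map list_of_vec vs)) = s * n"
proof -
  have "length (concat (map list_of_vec xs)) = length xs * n" if "set xs \<subseteq> carrier_vec n" for xs :: "real vec list"
    using that by (induction xs) auto
  moreover have "set vs \<subseteq> carrier_vec n" using vs_carrier by (auto simp: in_set_conv_nth)
  ultimately show ?thesis by simp
qed

text \<open>The input ends before \<open>base\<close> and memory is 0 beyond it. Hence all registers
  and arrays start at 0, in particular the counter \<open>rC\<close>.\<close>

lemma rep_initial: "rep (load (encode_input n B vs)) (initial_state n B vs)"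
proof -
  have len: "length (encode_input n B vs) = 3 + s * n"
    by (simp add: encode_input_def length_coordinate_lists)
  have b: "base (initial_state n B vs) = n * s + n * n + (n + 4)"
    by (simp add: base_def initial_state_def)
  have z: "load (encode_input n B vs) (base (initial_state n B vs) + i) = 0" for i
    by (simp add: load_def len b mult.commute)
  show ?thesis
    unfolding rep_def using z by (simp add: initial_state_def) (simp add: load_def encode_input_def)
qed

lemma input_coordinates:
  assumes "r < s" "j < n"
  shows "load (encode_input n B vs) (3 + (r * n + j)) = vs ! r $ j"
proof -
  have nth: "concat (map list_of_vec xs) ! (r * n + j) = xs ! r $ j"
    if "set xs \<subseteq> carrier_vec n" "r < length xs" for xs :: "real vec list" and r
    using that
  proof (induction xs arbitrary: r)
    case (Cons x xs)
    have x: "dim_vec x = n" using Cons.prems by auto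
    show ?case
    proof (cases r)
      case 0
      then show ?thesis using assms(2) by (simp add: nth_append x)
    next
      case (Suc m)
      then show ?thesis using Cons by (simp add: nth_append x)
    qed
  qed simp
  have "Suc r * n \<le> s * n" using assms(1) by (intro mult_le_mono1) simp
  then have "r * n + j < s * n" using assms(2) by simp
  moreover have "set vs \<subseteq> carrier_vec n" using vs_carrier by (auto simp: in_set_conv_nth)
  ultimately show ?thesis
    using nth[of vs r] assms(1) by (simp add: load_def encode_input_def length_coordinate_lists)
qed

lemma run_main:
  assumes n: "1 \<le> n" and \<kappa>: "4000 * (n + 1) \<le> \<kappa>"
  shows "run \<kappa> (load_prog ;; choose_prog ;; rest_prog) (initial_state n B vs)
    (60000 * (s + 1) * (n + 1) * (n + 1)) (\<lambda>st. final st \<and> n \<le> s)"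
proof -
  let ?st = "initial_state n B vs"
  have d: "dm ?st = n" "cn ?st = s" "ix ?st rC = 0" "lo ?st 2 = B"
    by (simp_all add: initial_state_def load_def encode_input_def)
  have lo: "lo ?st (3 + (r * n + j)) = vs ! r $ j" if "r < s" "j < n" for r j
    using input_coordinates[OF that] by (simp add: initial_state_def)
  have "run \<kappa> (load_prog ;; choose_prog ;; rest_prog) ?st
    (2000 * (s + 1) * (n + 1) + (10000 * (s + 1) * (n + 1) * (n + 1) + 40000 * (s + 1) * (n + 1) * (n + 1)))
    (\<lambda>st. final st \<and> n \<le> s)"
  proof (rule run_Seq, rule run_post[OF run_load_prog[of \<kappa> ?st, unfolded d]])
    fix st1 assume 1: "frame {rR, rJ} {aX, aN} ?st st1 \<and>
      (\<forall>r<s. \<forall>j<n. ar st1 aX r j = lo ?st (3 + (r * n + j))) \<and>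
      (\<forall>r<s. ar st1 aN r 0 = (\<Sum>j<n. (lo ?st (3 + (r * n + j)))\<^sup>2))"
    have "ar st1 aN r 0 = vs ! r \<bullet> vs ! r" if "r < s" for r
      using 1 that lo unfolding scalar_prod_self[OF vs_carrier[OF that]] by simp
    then have ld: "loaded st1" using 1 d lo by (simp add: loaded_def frame_def)
    have X1: "\<forall>r<s. \<forall>j<n. ar st1 aX r j = vs ! r $ j" using 1 lo by simp
    show "run \<kappa> (choose_prog ;; rest_prog) st1
      (10000 * (s + 1) * (n + 1) * (n + 1) + 40000 * (s + 1) * (n + 1) * (n + 1)) (\<lambda>st. final st \<and> n \<le> s)"
    proof (rule run_Seq, rule run_post[OF run_choose_prog[OF ld X1]])
      fix st2 assume 2: "frame {rR, rJ, rB, rP, rK} {aU, aM, aD, aW, aA, aX} st1 st2 \<and>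
        (\<exists>w a. basis_chosen st2 w a)"
      then obtain w a where wa: "basis_chosen st2 w a" by blast
      interpret lattice_coords n L B vs w a
        by unfold_locales (use wa in \<open>auto simp: basis_chosen_def\<close>)
      have "dm st2 = n" "cn st2 = s" "ix st2 rC = 0" using 1 2 d by (auto simp: frame_def)
      then have "run \<kappa> rest_prog st2 (40000 * (s + 1) * (n + 1) * (n + 1)) final"
        by (rule run_rest_prog[OF n \<kappa>]) (use wa in \<open>auto simp: basis_chosen_def\<close>)
      then show "run \<kappa> rest_prog st2 (40000 * (s + 1) * (n + 1) * (n + 1)) (\<lambda>st. final st \<and> n \<le> s)"
        by (rule run_post) (simp add: n_le_s)
    qed
  qed
  then show ?thesis by (rule run_cost) (simp add: algebra_simps)
qed

lemma exec_decompose_prog: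
  assumes n: "1 \<le> n"
  shows "\<exists>t \<sigma> c Bs. exec decompose_prog (load (encode_input n B vs)) t \<sigma> \<and> n \<le> s \<and>
    t \<le> 60000 * (s + 1) * (n + 1) * (n + 1) + 200 + 4000 * (n + 1) * c \<and> 2 ^ c \<le> covol_bound \<and>
    decomposition Bs \<and> holds \<sigma> (encode_bases Bs)"
proof -
  \<comment> \<open>This covers one test and one round of \<open>euclid_body\<close>, so the
    exchanges enter the bound as their number times \<open>\<kappa>\<close>.\<close>
  let ?\<kappa> = "4000 * (n + 1)"
  obtain t \<sigma> st where ex: "exec (load_prog ;; choose_prog ;; rest_prog) (load (encode_input n B vs)) t \<sigma>"
    and rep: "rep \<sigma> st" and t: "t \<le> 60000 * (s + 1) * (n + 1) * (n + 1) + ?\<kappa> * ix st rC"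
    and fin: "final st" and ns: "n \<le> s"
    using run_main[OF n order_refl] rep_initial unfolding run_def by (auto simp: initial_state_def)
  obtain Bs where Bs: "decomposition Bs" "written n Bs st" and d: "dm st = n" and c: "2 ^ ix st rC \<le> covol_bound"
    using fin unfolding final_def by blast
  let ?v = "vcomp (VA aV (IC 0) (IC 0))"
  let ?e = "Mem (Plus (Num 1) (Plus (Mem (Num 0)) (Times (Mem (Num 0)) (Mem (Num 0)))))"
  define \<sigma>1 where "\<sigma>1 = \<sigma>(1 := ar st aV 0 0)"
  define \<sigma>2 where "\<sigma>2 = \<sigma>1(0 := real (length Bs))"
  have lo: "\<sigma> i = lo st i" if "i < base st" for i using rep that by (simp add: rep_def)
  have b: "base st = n * cn st + n * n + (n + 4)" by (simp add: base_def d)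
  have v: "reval ?v \<sigma> = ar st aV 0 0"
    using reval_vcomp[OF rep, of "VA aV (IC 0) (IC 0)"] by simp
  have e1: "exec (Store (Num 1) ?v) \<sigma> (rcost (Num 1) + rcost ?v + 1) \<sigma>1"
    using exec_Store[of "Num 1" ?v \<sigma>] unfolding v by (simp add: \<sigma>1_def)
  have s0: "\<sigma>1 0 = real n" using rep d by (simp add: \<sigma>1_def rep_def)
  have "addr (1 + (real n + real n * real n)) = 1 + (n + n * n)"
    using addr_of_nat[of "1 + (n + n * n)"] by simp
  moreover have "\<sigma>1 (1 + (n + n * n)) = real (length Bs)"
    using lo[of "1 + (n + n * n)"] b n Bs(2) by (simp add: \<sigma>1_def written_def)
  ultimately have e: "reval ?e \<sigma>1 = real (length Bs)" by (simp add: s0)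
  have e2: "exec (Store (Num 0) ?e) \<sigma>1 (rcost (Num 0) + rcost ?e + 1) \<sigma>2"
    using exec_Store[of "Num 0" ?e \<sigma>1] unfolding e by (simp add: \<sigma>2_def)
  have exec: "exec decompose_prog (load (encode_input n B vs))
     (t + ((rcost (Num 1) + rcost ?v + 1) + (rcost (Num 0) + rcost ?e + 1))) \<sigma>2"
    unfolding decompose_prog_def by (intro exec_Seq[OF ex] exec_Seq[OF e1 e2])
  have "rcost ?v = 31"
    using vcost_simps(2)[of aV "IC 0" "IC 0"] by (simp add: vcost_def ccost_def)
  then have cost: "(rcost (Num 1) + rcost ?v + 1) + (rcost (Num 0) + rcost ?e + 1) \<le> 200" by simp
  have "holds \<sigma>2 (encode_bases Bs)"
    unfolding holds_def
  proof (intro allI impI)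
    let ?zs = "concat (map list_of_vec (concat Bs))" and ?M = "length Bs"
    fix i assume i: "i < length (encode_bases Bs)"
    then have il: "i < 1 + ?M + length ?zs" by (simp add: encode_bases_def)
    have M: "1 \<le> ?M" "?M \<le> n" using Bs(2) by (auto simp: written_def)
    then have ne: "Bs \<noteq> []" by auto
    consider "i = 0" | "i = 1" | x where "i = 1 + x" "1 \<le> x" "x < ?M" | x where "i = 1 + ?M + x" "x < length ?zs"
    proof (cases "i < 1 + ?M")
      case True
      then show ?thesis using that(1,2) that(3)[of "i - 1"] by (cases "i = 0"; cases "i = 1") auto
    next
      case False
      then show ?thesis using that(4)[of "i - (1 + ?M)"] il by auto
    qed
    then show "\<sigma>2 i = encode_bases Bs ! i"
    proof cases
      case 1
      then show ?thesis by (simp add: \<sigma>2_def encode_bases_def)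
    next
      case 2
      then show ?thesis
        using Bs(2) ne by (simp add: \<sigma>2_def \<sigma>1_def encode_bases_def written_def nth_append)
    next
      case 3
      have "\<sigma>2 i = lo st (1 + x)"
        using 3 lo[of "1 + x"] b M by (simp add: \<sigma>2_def \<sigma>1_def)
      then show ?thesis using Bs(2) 3 by (simp add: encode_bases_def written_def nth_append)
    next
      case 4
      have "length ?zs \<le> n * n" using Bs(2) by (simp add: written_def)
      then have "\<sigma>2 i = lo st (1 + ?M + x)"
        using 4 lo[of "1 + ?M + x"] b M ne by (simp add: \<sigma>2_def \<sigma>1_def)
      then show ?thesis using Bs(2) 4 by (simp add: encode_bases_def written_def nth_append)
    qed
  qed
  then show ?thesis using exec t cost c ns Bs(1)
    by (intro exI[of _ "t + ((rcost (Num 1) + rcost ?v + 1) + (rcost (Num 0) + rcost ?e + 1))"]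
        exI[of _ \<sigma>2] exI[of _ "ix st rC"] exI[of _ Bs]) auto
qed

text \<open>A nonzero vector of an integral lattice has squared norm at least 1. This is what makes
  ln(n B) nonnegative.\<close>

lemma B_ge_1:
  assumes "1 \<le> n" "n \<le> s"
  shows "1 \<le> B"
proof -
  have 0: "0 < s" using assms by linarith
  then have nz: "vs ! 0 \<noteq> 0\<^sub>v n" using nth_mem[OF 0] set_vs by auto
  have nn: "0 \<le> vs ! 0 \<bullet> vs ! 0"
    unfolding scalar_prod_self[OF vs_carrier[OF 0]] by (rule sum_nonneg) simp
  have "vs ! 0 \<bullet> vs ! 0 \<in> \<int>" by (rule L_int[OF vs_L[OF 0] vs_L[OF 0]])
  moreover have "vs ! 0 \<bullet> vs ! 0 \<noteq> 0" using scalar_prod_self_zero[OF vs_carrier[OF 0]] nz by blast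
  ultimately have "1 \<le> \<bar>vs ! 0 \<bullet> vs ! 0\<bar>" by (rule Ints_nonzero_abs_ge1)
  then have "1 \<le> vnorm (vs ! 0)" using nn by (simp add: vnorm_def)
  then show ?thesis using vs_norm[OF 0] by linarith
qed

text \<open>As n! <= n^n, the covolume bound gives \<open>2 ^ c \<le> (n B) ^ n\<close>. The factor
  2 comes from ln 2 >= 1/2, which is ln x <= x - 1 at x = 1/2.\<close>

lemma exchange_count_ln:
  assumes "1 \<le> n" "1 \<le> B" "2 ^ c \<le> covol_bound"
  shows "real c \<le> 2 * real n * ln (real n * B)"
proof -
  have nB: "0 < real n * B" using assms by simp
  have "fact n \<le> real n ^ n" by (metis fact_le_power of_nat_fact of_nat_le_iff of_nat_power order_refl)
  then have "covol_bound \<le> real n ^ n * B ^ n"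
    unfolding covol_bound_def using assms(2) by (intro mult_right_mono) auto
  then have "2 ^ c \<le> (real n * B) ^ n" using assms(3) by (simp add: power_mult_distrib)
  then have "ln (2 ^ c) \<le> ln ((real n * B) ^ n)" using nB by (subst ln_le_cancel_iff) auto
  then have "real c * ln 2 \<le> real n * ln (real n * B)" using nB by (simp add: ln_realpow)
  moreover have "1 / 2 \<le> ln (2::real)"
    using ln_le_minus_one[of "1 / 2 :: real"] by (simp add: ln_div)
  then have "real c * (1 / 2) \<le> real c * ln 2" by (intro mult_left_mono) auto
  ultimately show ?thesis by linarith
qed

text \<open>The hypotheses yield the order s n^2 + n^2 ln(n B). The logarithm is traded for its
  square by x <= 1 + x^2. The extra 1 and all constants go into s n^2, which is at least 1 even when
  ln(n B) is 0.\<close>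

lemma cost_bound:
  assumes "1 \<le> n" "n \<le> s" "2 ^ c \<le> covol_bound"
    and t: "t \<le> 60000 * (s + 1) * (n + 1) * (n + 1) + 200 + 4000 * (n + 1) * c"
  shows "real t \<le> 600000 * (real n ^ 6 * (ln (real n * B))\<^sup>2 + real s * real n ^ 2)"
proof -
  define x where "x = ln (real n * B)"
  have B: "1 \<le> B" by (rule B_ge_1[OF assms(1,2)])
  have "1 * 1 \<le> real n * B" using assms(1) B by (intro mult_mono) auto
  then have x: "0 \<le> x" by (simp add: x_def)
  have c: "real c \<le> 2 * real n * x" unfolding x_def by (rule exchange_count_ln[OF assms(1) B assms(3)])
  have sn: "1 \<le> real s * real n ^ 2"
    using mult_mono[of 1 "real s" 1 "real n ^ 2"] assms(1,2) by simp
  \<comment> \<open>Each of the three factors at most doubles, whence 480000 = 8 times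
    60000.\<close>
  have "(s + 1) * ((n + 1) * (n + 1)) \<le> (2 * s) * ((2 * n) * (2 * n))"
    using assms(1,2) by (intro mult_le_mono) auto
  then have "real ((s + 1) * ((n + 1) * (n + 1))) \<le> real ((2 * s) * ((2 * n) * (2 * n)))"
    by (simp only: of_nat_le_iff)
  then have 1: "60000 * (real s + 1) * (real n + 1) * (real n + 1) \<le> 480000 * (real s * real n ^ 2)"
    by (simp add: power2_eq_square algebra_simps, linarith?)
  have "4000 * (real n + 1) * real c \<le> 4000 * (2 * real n) * (2 * real n * x)"
    using assms(1) c by (intro mult_mono) auto
  also have "\<dots> = 16000 * (real n ^ 2 * x)" by (simp add: power2_eq_square)
  also have "real n ^ 2 * x \<le> real n ^ 2 * (1 + x\<^sup>2)"
  proof (rule mult_left_mono)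
    have "0 \<le> (x - 1)\<^sup>2" by simp
    then show "x \<le> 1 + x\<^sup>2" using x by (simp add: power2_diff)
  qed simp
  also have "\<dots> = real n ^ 2 + real n ^ 2 * x\<^sup>2" by (simp add: algebra_simps)
  also have "\<dots> \<le> real s * real n ^ 2 + real n ^ 6 * x\<^sup>2"
  proof (rule add_mono)
    show "real n ^ 2 \<le> real s * real n ^ 2"
      using mult_right_mono[of 1 "real s" "real n ^ 2"] assms(1,2) by simp
    show "real n ^ 2 * x\<^sup>2 \<le> real n ^ 6 * x\<^sup>2"
      using assms(1) by (intro mult_right_mono power_increasing) auto
  qed
  finally have 2: "4000 * (real n + 1) * real c \<le> 16000 * (real s * real n ^ 2 + real n ^ 6 * x\<^sup>2)" by simp
  have "real t \<le> real (60000 * (s + 1) * (n + 1) * (n + 1) + 200 + 4000 * (n + 1) * c)"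
    using t by (simp only: of_nat_le_iff)
  also have "\<dots> = 60000 * (real s + 1) * (real n + 1) * (real n + 1) + 200 + 4000 * (real n + 1) * real c"
    by (simp add: algebra_simps)
  also have "\<dots> \<le> 480000 * (real s * real n ^ 2) + 200 * (real s * real n ^ 2)
      + 16000 * (real s * real n ^ 2 + real n ^ 6 * x\<^sup>2)"
    using 1 2 sn by linarith
  also have "\<dots> \<le> 600000 * (real n ^ 6 * x\<^sup>2 + real s * real n ^ 2)"
  proof -
    have arith: "480000 * v + 200 * v + 16000 * (v + u) \<le> 600000 * (u + v)" if "0 \<le> u" "1 \<le> v" for u v :: real
      using that by (simp add: algebra_simps)
    show ?thesis by (rule arith[OF _ sn]) simp
  qed
  finally show ?thesis by (simp add: x_def)
qed

end

theorem mainTheorem2: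
  shows "\<exists>(P :: rcom) (C :: real).
    \<forall>(n :: nat) (L :: real vec set) (B :: real) (vs :: real vec list).
      1 \<le> n \<longrightarrow>
      full_rank_lattice n L \<longrightarrow>
      integral_lattice n L \<longrightarrow>
      distinct vs \<longrightarrow>
      set vs = {v \<in> L - {0\<^sub>v n}. vnorm v \<le> B} \<longrightarrow>
      int_span n (set vs) = L \<longrightarrow>
      (\<exists>(t :: nat) (\<sigma> :: memory) (Bs :: real vec list list) (Ls :: real vec set list).
         exec P (load (encode_input n B vs)) t \<sigma> \<and>
         real t \<le> C * (real n ^ 6 * (ln (real n * B))\<^sup>2 + real (length vs) * real n ^ 2) \<and>
         holds \<sigma> (encode_bases Bs) \<and>
         list_all2 (lattice_basis n) Bs Ls \<and>
         (\<forall>M \<in> set Ls. indecomposable n M) \<and>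
         orthogonal_direct_sum n L Ls)"
proof (rule exI[of _ decompose_prog], rule exI[of _ 600000], intro allI impI)
  fix n :: nat and L :: "real vec set" and B :: real and vs :: "real vec list"
  assume n: "1 \<le> n" and "full_rank_lattice n L" "integral_lattice n L" "distinct vs"
    "set vs = {v \<in> L - {0\<^sub>v n}. vnorm v \<le> B}" "int_span n (set vs) = L"
  then interpret lattice_input n L B vs by unfold_locales
  obtain t \<sigma> c Bs where r: "exec decompose_prog (load (encode_input n B vs)) t \<sigma>" "n \<le> length vs"
    "t \<le> 60000 * (length vs + 1) * (n + 1) * (n + 1) + 200 + 4000 * (n + 1) * c" "2 ^ c \<le> covol_bound"
    "decomposition Bs" "holds \<sigma> (encode_bases Bs)"
    using exec_decompose_prog[OF n] by blast
  obtain Ls where "list_all2 (lattice_basis n) Bs Ls" "\<forall>M\<in>set Ls. indecomposable n M"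
    "orthogonal_direct_sum n L Ls"
    using r(5) unfolding decomposition_def by blast
  then show "\<exists>t \<sigma> Bs Ls. exec decompose_prog (load (encode_input n B vs)) t \<sigma> \<and>
     real t \<le> 600000 * (real n ^ 6 * (ln (real n * B))\<^sup>2 + real (length vs) * real n ^ 2) \<and>
     holds \<sigma> (encode_bases Bs) \<and> list_all2 (lattice_basis n) Bs Ls \<and>
     (\<forall>M\<in>set Ls. indecomposable n M) \<and> orthogonal_direct_sum n L Ls"
    using r(1,6) cost_bound[OF n r(2,4,3)] by blast
qed

end
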